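(* Assume that at least one of the following holds: (1) Condition 2A is satisfied for both $\mathcal I=\mathcal N$ and $\mathcal I=\mathcal P$; (2) Condition 2A is satisfied for $\mathcal I=\mathcal P$, and Condition 2B is satisfied (Conditions 2A and 2B are defined in the context). Then for $\mathcal I=\mathcal N$ and $\mathcal I=\mathcal P$ the Riccati equation $$-\frac{d\mathbf\Gamma^{\mathcal I}(t)}{dt}=\mathbf\Gamma^{\mathcal I}(t)\mathbf A+\mathbf C^{\mathcal I}\mathbf\Gamma^{\mathcal I}(t)-\mathbf\Gamma^{\mathcal I}(t)\mathbf B^{\mathcal I}\mathbf\Gamma^{\mathcal I}(t)+\mathbf D^{\mathcal I},\qquad \mathbf\Gamma^{\mathcal I}(T)=\mathbf E^{\mathcal I},$$ admits a unique solution on $[0,T]$. As a result, for $\mathcal I=\mathcal N$ and $\mathcal I=\mathcal P$ the FBSDE $$ \begin{aligned} d\mathbf x^{\mathcal I}(t)&=\big(\mathbf A\mathbf x^{\mathcal I}(t)-\mathbf B^{\mathcal I}\mathbf p^{\mathcal I}(t)\big)dt+\mathbf\Sigma\, d\mathbf W(t),\\ -d\mathbf p^{\mathcal I}(t)&=\big(\mathbf C^{\mathcal I}\mathbf p^{\mathcal I}(t)+\mathbf D^{\mathcal I}\mathbf x^{\mathcal I}(t)+\mathbf M^{\mathcal I}\big)dt-\mathbf Z^{\mathcal I}(t)d\mathbf W(t),\\ \mathbf x^{\mathcal I}(0)&=\mathbf x_0,\qquad \mathbf p^{\mathcal I}(T)=\mathbf E^{\mathcal I}\mathbf x^{\mathcal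 I}(T)+\mathbf h^{\mathcal I} \end{aligned} $$ is uniquely solvable, and its adjoint process can be written as $\mathbf p^{\mathcal I}(t)=\mathbf\Gamma^{\mathcal I}(t)\mathbf x^{\mathcal I}(t)+\mathbf g^{\mathcal I}(t)$, where $\mathbf g^{\mathcal I}$ is the solution of $$-\frac{d\mathbf g^{\mathcal I}(t)}{dt}=\big(\mathbf C^{\mathcal I}-\mathbf\Gamma^{\mathcal I}(t)\mathbf B^{\mathcal I}\big)\mathbf g^{\mathcal I}(t)+\mathbf M^{\mathcal I},\qquad \mathbf g^{\mathcal I}(T)=\mathbf h^{\mathcal I}.$$
   Context: **Coefficients.** All coefficients are constant: $A_\alpha\in\mathbb R^{n_\alpha\times n_\alpha}$, $B_\alpha,G_\alpha,\bar G_\alpha\in\mathbb R^{n_\alpha\times n_\beta}$, $C_\alpha,F_\alpha,\bar F_\alpha\in\mathbb R^{n_\alpha\times n_1}$, $D_\alpha\in\mathbb R^{n_\alpha\times m_\alpha}$, $A_\beta,G_\beta,\bar G_\beta\in\mathbb R^{n_\beta\times n_\alpha}$, $B_\beta\in\mathbb R^{n_\beta\times n_\beta}$, $C_\beta,F_\beta,\bar F_\beta\in\mathbb R^{n_\beta\times n_1}$, $D_\beta\in\mathbb R^{n_\beta\times m_\beta}$, $A_1,B_1,F_1,\bar F_1\in\mathbb R^{n_1\times n_1}$, $C_1,G_1,\bar G_1\in\mathbb R^{n_1\times n_\alpha}$, $D_1,H_1,\bar H_1\in\mathbb R^{n_1\times n_\beta}$, $E_1\in\mathbb R^{n_1\times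 m_1}$, vectors $M_\gamma,\bar M_\gamma\in\mathbb R^{n_\gamma}$ and $\sigma_\gamma\in\mathbb R^{n_\gamma\times d_\gamma}$ for $\gamma\in\{\alpha,\beta,1\}$. $D_\alpha,D_\beta,E_1$ have full column rank; $Q_\gamma\in\mathbb R^{n_\gamma\times n_\gamma}$, $R_\gamma\in\mathbb R^{m_\gamma\times m_\gamma}$ are (symmetric) positive definite and $\bar Q_\gamma\in\mathbb R^{n_\gamma\times n_\gamma}$ (symmetric) positive semi-definite. $T>0$ is fixed. $W^\alpha,W^\beta$ are independent Wiener processes in $\mathbb R^{d_\alpha},\mathbb R^{d_\beta}$; $\eta_\alpha,\eta_\beta,\eta_1$ are independent square-integrable random vectors in $\mathbb R^{n_\alpha},\mathbb R^{n_\beta},\mathbb R^{n_1}$, independent of the Wiener processes; $\mathcal F^\gamma_t=\sigma(\eta_\gamma,W^\gamma(s):s\le t)$. Solutions of the FBSDE are square-integrable $\mathcal F^\alpha\vee\mathcal F^\beta$-adapted. **Matrices.** $0$ and $I$ denote zero and identity blocks of appropriate sizes. Put $\ell_{\mathcal P}=3n_1+n_\alpha+n_\beta$ and $\ell_{\mathcal N}=3n_1+2(n_\alpha+n_\beta)$. $$\mathbf A=\begin{pmatrix}A_\alpha&B_\alpha&C_\alpha&0&0\\ A_\beta&B_\beta&C_\beta&0&0\\ C_1&D_1&A_1+B_1&0&0\\ 0&0&0&A_1&0\\ 0&0&0&0&A_1\end{pmatrix},$$ $$\mathbf B^{\mathcal N}=\begin{pmatrix}D_\alpha R_\alpha^{-1}D_\alpha^\top&0&0&0&0&0&0\\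 0&D_\beta R_\beta^{-1}D_\beta^\top&0&0&0&0&0\\ 0&0&E_1R_1^{-1}E_1^\top&0&0&0&0\\ 0&0&0&E_1R_1^{-1}E_1^\top&0&0&0\\ 0&0&0&0&E_1R_1^{-1}E_1^\top&0&0\end{pmatrix},$$ $$\mathbf C^{\mathcal N}=\begin{pmatrix}A_\alpha^\top&0&0&C_1^\top&0&A_\beta^\top&0\\ 0&B_\beta^\top&0&0&D_1^\top&0&B_\alpha^\top\\ 0&0&A_1^\top&0&0&0&0\\ C_\alpha^\top&0&0&(A_1+B_1)^\top&0&C_\beta^\top&0\\ 0&C_\beta^\top&0&0&(A_1+B_1)^\top&0&C_\alpha^\top\\ B_\alpha^\top&0&0&D_1^\top&0&B_\beta^\top&0\\ 0&A_\beta^\top&0&0&C_1^\top&0&A_\alpha^\top\end{pmatrix},$$ $$\mathbf D^{\mathcal N}=\begin{pmatrix}Q_\alpha&-Q_\alpha G_\alpha&-Q_\alpha F_\alpha&-(Q_1G_1)^\top&0\\ -Q_\beta G_\beta&Q_\beta&-Q_\beta F_\beta&0&-(Q_1H_1)^\top\\ -Q_1G_1&-Q_1H_1&Q_1(I-F_1)&0&0\\ -(Q_\alpha F_\alpha)^\top&(Q_\alpha F_\alpha)^\top G_\alpha&(Q_\alpha F_\alpha)^\top F_\alpha&(Q_1(I-F_1))^\top&0\\ (Q_\beta F_\beta)^\top G_\beta&-(Q_\beta F_\beta)^\top&(Q_\beta F_\beta)^\top F_\beta&0&(Q_1(I-F_1))^\top\\ -(Q_\alpha G_\alpha)^\top&(Q_\alpha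 G_\alpha)^\top G_\alpha&(Q_\alpha G_\alpha)^\top F_\alpha&-(Q_1H_1)^\top&0\\ (Q_\beta G_\beta)^\top G_\beta&-(Q_\beta G_\beta)^\top&(Q_\beta G_\beta)^\top F_\beta&0&-(Q_1G_1)^\top\end{pmatrix},$$ $$\mathbf M^{\mathcal N}=\begin{pmatrix}-Q_\alpha M_\alpha\\ -Q_\beta M_\beta\\ -Q_1M_1\\ (Q_\alpha F_\alpha)^\top M_\alpha\\ (Q_\beta F_\beta)^\top M_\beta\\ (Q_\alpha G_\alpha)^\top M_\alpha\\ (Q_\beta G_\beta)^\top M_\beta\end{pmatrix},\quad\mathbf\Sigma=\begin{pmatrix}\sigma_\alpha&0\\ 0&\sigma_\beta\\ 0&0\\ 0&0\\ 0&0\end{pmatrix},\quad\mathbf W=\begin{pmatrix}W^\alpha\\ W^\beta\end{pmatrix},\quad\mathbf x_0=\begin{pmatrix}\eta_\alpha\\ \eta_\beta\\ \mathbb E[\eta_1]\\ 0\\ 0\end{pmatrix}.$$ $\mathbf E^{\mathcal N}$ and $\mathbf h^{\mathcal N}$ are obtained from $\mathbf D^{\mathcal N}$ and $\mathbf M^{\mathcal N}$, respectively, by replacing every $Q_\gamma,F_\gamma,G_\gamma,H_1,M_\gamma$ ($\gamma\in\{\alpha,\beta,1\}$) by its barred counterpart. With $$\mathbf I_1=\begin{pmatrix}I&0&0&0&0&0&I\\ 0&I&0&0&0&I&0\\ 0&0&I&0&0&0&0\\ 0&0&0&I&0&0&0\\ 0&0&0&0&I&0&0\end{pmatrix},\qquad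 \mathbf I_2=\begin{pmatrix}I&0&0&0&0\\ 0&I&0&0&0\\ 0&0&I&0&0\\ 0&0&0&I&0\\ 0&0&0&0&I\\ 0&0&0&0&0\\ 0&0&0&0&0\end{pmatrix}$$ (block sizes $n_\alpha,n_\beta,n_1,n_1,n_1$, and additionally $n_\beta,n_\alpha$ for the last two), set $$\mathbf B^{\mathcal P}=\mathbf B^{\mathcal N}\mathbf I_2,\ \mathbf C^{\mathcal P}=\mathbf I_1\mathbf C^{\mathcal N}\mathbf I_2,\ \mathbf D^{\mathcal P}=\mathbf I_1\mathbf D^{\mathcal N},\ \mathbf E^{\mathcal P}=\mathbf I_1\mathbf E^{\mathcal N},\ \mathbf M^{\mathcal P}=\mathbf I_1\mathbf M^{\mathcal N},\ \mathbf h^{\mathcal P}=\mathbf I_1\mathbf h^{\mathcal N}.$$ $\lambda_{\min}$ denotes the smallest eigenvalue of a symmetric matrix. **Condition 2A (for $\mathcal I$).** There exist a symmetric matrix $\Pi_1^{\mathcal I}\in\mathbb R^{\ell_{\mathcal P}\times\ell_{\mathcal P}}$ and a matrix $\Pi_2^{\mathcal I}\in\mathbb R^{\ell_{\mathcal P}\times\ell_{\mathcal I}}$ such that, with $$\mathbf\Lambda^{\mathcal I}=\begin{pmatrix}-\Pi_1^{\mathcal I}\mathbf A+\Pi_2^{\mathcal I}\mathbf D^{\mathcal I}&\Pi_1^{\mathcal I}\mathbf B^{\mathcal I}-\mathbf A^\top\Pi_2^{\mathcal I}+\Pi_2^{\mathcal I}\mathbf C^{\mathcal I}\\ 0&(\mathbf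 B^{\mathcal I})^\top\Pi_2^{\mathcal I}\end{pmatrix},$$ one has $\lambda_{\min}(\mathbf\Lambda^{\mathcal I}+(\mathbf\Lambda^{\mathcal I})^\top)\ge0$ and $\lambda_{\min}(\Pi_1^{\mathcal I}+\Pi_2^{\mathcal I}\mathbf E^{\mathcal I}+(\mathbf E^{\mathcal I})^\top(\Pi_2^{\mathcal I})^\top)>0$. **Condition 2B.** There exist a symmetric matrix $\bar\Pi_1\in\mathbb R^{\ell_{\mathcal N}\times\ell_{\mathcal N}}$, a matrix $\bar\Pi_2\in\mathbb R^{\ell_{\mathcal N}\times\ell_{\mathcal N}}$, a matrix $\hat{\mathbf A}\in\mathbb R^{(n_\alpha+n_\beta)\times(n_\alpha+n_\beta)}$ and a matrix $\hat{\mathbf B}\in\mathbb R^{(n_\alpha+n_\beta)\times\ell_{\mathcal N}}$ such that, with $$\bar{\mathbf A}=\begin{pmatrix}\mathbf A&0\\ 0&\hat{\mathbf A}\end{pmatrix},\ \bar{\mathbf B}=\begin{pmatrix}\mathbf B^{\mathcal N}\\ \hat{\mathbf B}\end{pmatrix},\ \bar{\mathbf D}=(\mathbf D^{\mathcal N}\ \ 0),\ \bar{\mathbf E}=(\mathbf E^{\mathcal N}\ \ 0)$$ ($\bar{\mathbf A},\bar{\mathbf B},\bar{\mathbf D},\bar{\mathbf E}\in\mathbb R^{\ell_{\mathcal N}\times\ell_{\mathcal N}}$) and $$\bar{\mathbf\Lambda}=\begin{pmatrix}-\bar\Pi_1\bar{\mathbf A}+\bar\Pi_2\bar{\mathbf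 D}&\bar\Pi_1\bar{\mathbf B}-\bar{\mathbf A}^\top\bar\Pi_2+\bar\Pi_2\mathbf C^{\mathcal N}\\ 0&\bar{\mathbf B}^\top\bar\Pi_2\end{pmatrix},$$ one has $\lambda_{\min}(\bar{\mathbf\Lambda}+\bar{\mathbf\Lambda}^\top)\ge0$ and $\lambda_{\min}(\bar\Pi_1+\bar\Pi_2\bar{\mathbf E}+\bar{\mathbf E}^\top\bar\Pi_2^\top)>0$. *)

theory Defs
  imports "HOL-Probability.Probability"
begin

section \<open>Block matrices\<close>

text \<open>The index type of a block vector is the sum of the index types of its blocks. Since a matrix
  is a vector of rows, \<open>===\<close> stacks both vectors and matrices on top of each other, and \<open>|||\<close> puts
  matrices side by side.\<close>

definition vcat :: "'e ^ 'm \<Rightarrow> 'e ^ 'n \<Rightarrow> 'e ^ ('m::finite + 'n::finite)" (infixr "===" 55) where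
  "u === v = (\<chi> i. case i of Inl j \<Rightarrow> u $ j | Inr j \<Rightarrow> v $ j)"

definition hcat :: "real ^ 'm ^ 'k \<Rightarrow> real ^ 'n ^ 'k \<Rightarrow> real ^ ('m::finite + 'n::finite) ^ ('k::finite)"
    (infixr "|||" 60) where
  "X ||| Y = (\<chi> i. (X $ i) === (Y $ i))"

notation transpose ("_\<^sup>T" [1000] 999)

definition eigenvalues :: "real ^ 'n ^ 'n \<Rightarrow> real set" where
  "eigenvalues X = {l. \<exists>v. v \<noteq> 0 \<and> X *v v = l *\<^sub>R v}"

text \<open>Only meaningful for symmetric matrices, whose set of real eigenvalues is finite and nonempty.\<close>

definition lambda_min :: "real ^ 'n ^ 'n \<Rightarrow> real" where
  "lambda_min X = Min (eigenvalues X)"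

definition pos_def :: "real ^ 'n ^ 'n \<Rightarrow> bool" where
  "pos_def X \<longleftrightarrow> X\<^sup>T = X \<and> (\<forall>v. v \<noteq> 0 \<longrightarrow> 0 < v \<bullet> (X *v v))"

definition pos_semidef :: "real ^ 'n ^ 'n \<Rightarrow> bool" where
  "pos_semidef X \<longleftrightarrow> X\<^sup>T = X \<and> (\<forall>v. 0 \<le> v \<bullet> (X *v v))"

definition full_column_rank :: "real ^ 'm ^ 'n \<Rightarrow> bool" where
  "full_column_rank X \<longleftrightarrow> rank X = CARD('m)"


section \<open>Coefficients\<close>

text \<open>The state dimensions \<open>n\<^sub>\<alpha>, n\<^sub>\<beta>, n\<^sub>1\<close>, control dimensions \<open>m\<^sub>\<alpha>, m\<^sub>\<beta>, m\<^sub>1\<close> and noise dimensions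
  \<open>d\<^sub>\<alpha>, d\<^sub>\<beta>\<close> are the cardinalities of the type parameters, in this order.\<close>

record ('a::finite, 'b::finite, 'c::finite, 'ma::finite, 'mb::finite, 'mc::finite,
        'da::finite, 'db::finite) dynamics =
  A\<^sub>\<alpha> :: "real ^ 'a ^ 'a"
  B\<^sub>\<alpha> :: "real ^ 'b ^ 'a"
  C\<^sub>\<alpha> :: "real ^ 'c ^ 'a"
  D\<^sub>\<alpha> :: "real ^ 'ma ^ 'a"
  A\<^sub>\<beta> :: "real ^ 'a ^ 'b"
  B\<^sub>\<beta> :: "real ^ 'b ^ 'b"
  C\<^sub>\<beta> :: "real ^ 'c ^ 'b"
  D\<^sub>\<beta> :: "real ^ 'mb ^ 'b"
  A\<^sub>1 :: "real ^ 'c ^ 'c"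
  B\<^sub>1 :: "real ^ 'c ^ 'c"
  C\<^sub>1 :: "real ^ 'a ^ 'c"
  D\<^sub>1 :: "real ^ 'b ^ 'c"
  E\<^sub>1 :: "real ^ 'mc ^ 'c"
  R\<^sub>\<alpha> :: "real ^ 'ma ^ 'ma"
  R\<^sub>\<beta> :: "real ^ 'mb ^ 'mb"
  R\<^sub>1 :: "real ^ 'mc ^ 'mc"
  \<sigma>\<^sub>\<alpha> :: "real ^ 'da ^ 'a"
  \<sigma>\<^sub>\<beta> :: "real ^ 'db ^ 'b"

text \<open>State weights. They occur twice: as running weights \<open>Q, F, G, H, M\<close> and as terminal
  (barred) weights.\<close>

record ('a::finite, 'b::finite, 'c::finite) weights =
  Q\<^sub>\<alpha> :: "real ^ 'a ^ 'a"
  Q\<^sub>\<beta> :: "real ^ 'b ^ 'b"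
  Q\<^sub>1 :: "real ^ 'c ^ 'c"
  F\<^sub>\<alpha> :: "real ^ 'c ^ 'a"
  F\<^sub>\<beta> :: "real ^ 'c ^ 'b"
  F\<^sub>1 :: "real ^ 'c ^ 'c"
  G\<^sub>\<alpha> :: "real ^ 'b ^ 'a"
  G\<^sub>\<beta> :: "real ^ 'a ^ 'b"
  G\<^sub>1 :: "real ^ 'a ^ 'c"
  H\<^sub>1 :: "real ^ 'b ^ 'c"
  M\<^sub>\<alpha> :: "real ^ 'a"
  M\<^sub>\<beta> :: "real ^ 'b"
  M\<^sub>1 :: "real ^ 'c"

text \<open>Index types of sizes \<open>\<ell>\<^sub>P = 3n\<^sub>1 + n\<^sub>\<alpha> + n\<^sub>\<beta>\<close> and \<open>\<ell>\<^sub>N = 3n\<^sub>1 + 2(n\<^sub>\<alpha> + n\<^sub>\<beta>)\<close>. The seven blocks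
  of an N-vector are grouped as five plus two, so that they extend the five blocks of a P-vector.\<close>

type_synonym ('a, 'b, 'c) idxP = "'a + 'b + 'c + 'c + 'c"
type_synonym ('a, 'b, 'c) idxN = "('a, 'b, 'c) idxP + ('b + 'a)"

definition matA :: "('a::finite, 'b::finite, 'c::finite, 'ma::finite, 'mb::finite, 'mc::finite,
    'da::finite, 'db::finite) dynamics \<Rightarrow> real ^ ('a, 'b, 'c) idxP ^ ('a, 'b, 'c) idxP" where
  "matA c =
    ((A\<^sub>\<alpha> c ||| B\<^sub>\<alpha> c ||| C\<^sub>\<alpha> c ||| 0 ||| 0) ===
     (A\<^sub>\<beta> c ||| B\<^sub>\<beta> c ||| C\<^sub>\<beta> c ||| 0 ||| 0) ===
     (C\<^sub>1 c ||| D\<^sub>1 c ||| A\<^sub>1 c + B\<^sub>1 c ||| 0 ||| 0) ===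
     (0 ||| 0 ||| 0 ||| A\<^sub>1 c ||| 0) ===
     (0 ||| 0 ||| 0 ||| 0 ||| A\<^sub>1 c))"

definition matBN :: "('a::finite, 'b::finite, 'c::finite, 'ma::finite, 'mb::finite, 'mc::finite,
    'da::finite, 'db::finite) dynamics \<Rightarrow> real ^ ('a, 'b, 'c) idxN ^ ('a, 'b, 'c) idxP" where
  "matBN c =
    (let Sa = D\<^sub>\<alpha> c ** matrix_inv (R\<^sub>\<alpha> c) ** (D\<^sub>\<alpha> c)\<^sup>T;
         Sb = D\<^sub>\<beta> c ** matrix_inv (R\<^sub>\<beta> c) ** (D\<^sub>\<beta> c)\<^sup>T;
         S1 = E\<^sub>1 c ** matrix_inv (R\<^sub>1 c) ** (E\<^sub>1 c)\<^sup>T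
     in
     ((Sa ||| 0 ||| 0 ||| 0 ||| 0) ||| (0 ||| 0)) ===
     ((0 ||| Sb ||| 0 ||| 0 ||| 0) ||| (0 ||| 0)) ===
     ((0 ||| 0 ||| S1 ||| 0 ||| 0) ||| (0 ||| 0)) ===
     ((0 ||| 0 ||| 0 ||| S1 ||| 0) ||| (0 ||| 0)) ===
     ((0 ||| 0 ||| 0 ||| 0 ||| S1) ||| (0 ||| 0)))"

definition matCN :: "('a::finite, 'b::finite, 'c::finite, 'ma::finite, 'mb::finite, 'mc::finite,
    'da::finite, 'db::finite) dynamics \<Rightarrow> real ^ ('a, 'b, 'c) idxN ^ ('a, 'b, 'c) idxN" where
  "matCN c =
    ((((A\<^sub>\<alpha> c)\<^sup>T ||| 0 ||| 0 ||| (C\<^sub>1 c)\<^sup>T ||| 0) ||| ((A\<^sub>\<beta> c)\<^sup>T ||| 0)) ===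
     ((0 ||| (B\<^sub>\<beta> c)\<^sup>T ||| 0 ||| 0 ||| (D\<^sub>1 c)\<^sup>T) ||| (0 ||| (B\<^sub>\<alpha> c)\<^sup>T)) ===
     ((0 ||| 0 ||| (A\<^sub>1 c)\<^sup>T ||| 0 ||| 0) ||| (0 ||| 0)) ===
     (((C\<^sub>\<alpha> c)\<^sup>T ||| 0 ||| 0 ||| (A\<^sub>1 c + B\<^sub>1 c)\<^sup>T ||| 0) ||| ((C\<^sub>\<beta> c)\<^sup>T ||| 0)) ===
     ((0 ||| (C\<^sub>\<beta> c)\<^sup>T ||| 0 ||| 0 ||| (A\<^sub>1 c + B\<^sub>1 c)\<^sup>T) ||| (0 ||| (C\<^sub>\<alpha> c)\<^sup>T))) ===
    ((((B\<^sub>\<alpha> c)\<^sup>T ||| 0 ||| 0 ||| (D\<^sub>1 c)\<^sup>T ||| 0) ||| ((B\<^sub>\<beta> c)\<^sup>T ||| 0)) ===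
     ((0 ||| (A\<^sub>\<beta> c)\<^sup>T ||| 0 ||| 0 ||| (C\<^sub>1 c)\<^sup>T) ||| (0 ||| (A\<^sub>\<alpha> c)\<^sup>T)))"

text \<open>The running weights give \<open>\<^bold>D\<^sup>N\<close> and \<open>\<^bold>M\<^sup>N\<close>, the terminal weights give \<open>\<^bold>E\<^sup>N\<close> and \<open>\<^bold>h\<^sup>N\<close>.\<close>

definition weight_matN :: "('a::finite, 'b::finite, 'c::finite) weights
    \<Rightarrow> real ^ ('a, 'b, 'c) idxP ^ ('a, 'b, 'c) idxN" where
  "weight_matN w =
    (let QFa = (Q\<^sub>\<alpha> w ** F\<^sub>\<alpha> w)\<^sup>T; QFb = (Q\<^sub>\<beta> w ** F\<^sub>\<beta> w)\<^sup>T;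
         QGa = (Q\<^sub>\<alpha> w ** G\<^sub>\<alpha> w)\<^sup>T; QGb = (Q\<^sub>\<beta> w ** G\<^sub>\<beta> w)\<^sup>T;
         QG1 = (Q\<^sub>1 w ** G\<^sub>1 w)\<^sup>T; QH1 = (Q\<^sub>1 w ** H\<^sub>1 w)\<^sup>T;
         K = Q\<^sub>1 w ** (mat 1 - F\<^sub>1 w)
     in
    ((Q\<^sub>\<alpha> w ||| - (Q\<^sub>\<alpha> w ** G\<^sub>\<alpha> w) ||| - (Q\<^sub>\<alpha> w ** F\<^sub>\<alpha> w) ||| - QG1 ||| 0) ===
     (- (Q\<^sub>\<beta> w ** G\<^sub>\<beta> w) ||| Q\<^sub>\<beta> w ||| - (Q\<^sub>\<beta> w ** F\<^sub>\<beta> w) ||| 0 ||| - QH1) ===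
     (- (Q\<^sub>1 w ** G\<^sub>1 w) ||| - (Q\<^sub>1 w ** H\<^sub>1 w) ||| K ||| 0 ||| 0) ===
     (- QFa ||| QFa ** G\<^sub>\<alpha> w ||| QFa ** F\<^sub>\<alpha> w ||| K\<^sup>T ||| 0) ===
     (QFb ** G\<^sub>\<beta> w ||| - QFb ||| QFb ** F\<^sub>\<beta> w ||| 0 ||| K\<^sup>T)) ===
    ((- QGa ||| QGa ** G\<^sub>\<alpha> w ||| QGa ** F\<^sub>\<alpha> w ||| - QH1 ||| 0) ===
     (QGb ** G\<^sub>\<beta> w ||| - QGb ||| QGb ** F\<^sub>\<beta> w ||| 0 ||| - QG1)))"

definition weight_vecN :: "('a::finite, 'b::finite, 'c::finite) weights
    \<Rightarrow> real ^ ('a, 'b, 'c) idxN" where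
  "weight_vecN w =
    ((- (Q\<^sub>\<alpha> w *v M\<^sub>\<alpha> w)) ===
     (- (Q\<^sub>\<beta> w *v M\<^sub>\<beta> w)) ===
     (- (Q\<^sub>1 w *v M\<^sub>1 w)) ===
     ((Q\<^sub>\<alpha> w ** F\<^sub>\<alpha> w)\<^sup>T *v M\<^sub>\<alpha> w) ===
     ((Q\<^sub>\<beta> w ** F\<^sub>\<beta> w)\<^sup>T *v M\<^sub>\<beta> w)) ===
    (((Q\<^sub>\<alpha> w ** G\<^sub>\<alpha> w)\<^sup>T *v M\<^sub>\<alpha> w) ===
     ((Q\<^sub>\<beta> w ** G\<^sub>\<beta> w)\<^sup>T *v M\<^sub>\<beta> w))"

definition matSigma :: "('a::finite, 'b::finite, 'c::finite, 'ma::finite, 'mb::finite, 'mc::finite,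
    'da::finite, 'db::finite) dynamics \<Rightarrow> real ^ ('da + 'db) ^ ('a, 'b, 'c) idxP" where
  "matSigma c =
    ((\<sigma>\<^sub>\<alpha> c ||| 0) ===
     (0 ||| \<sigma>\<^sub>\<beta> c) ===
     (0 ||| 0) ===
     (0 ||| 0) ===
     (0 ||| 0))"

definition matI1 :: "real ^ ('a::finite, 'b::finite, 'c::finite) idxN ^ ('a, 'b, 'c) idxP" where
  "matI1 =
    (((mat 1 ||| 0 ||| 0 ||| 0 ||| 0) ||| (0 ||| mat 1)) ===
     ((0 ||| mat 1 ||| 0 ||| 0 ||| 0) ||| (mat 1 ||| 0)) ===
     ((0 ||| 0 ||| mat 1 ||| 0 ||| 0) ||| (0 ||| 0)) ===
     ((0 ||| 0 ||| 0 ||| mat 1 ||| 0) ||| (0 ||| 0)) ===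
     ((0 ||| 0 ||| 0 ||| 0 ||| mat 1) ||| (0 ||| 0)))"

definition matI2 :: "real ^ ('a::finite, 'b::finite, 'c::finite) idxP ^ ('a, 'b, 'c) idxN" where
  "matI2 =
    ((mat 1 ||| 0 ||| 0 ||| 0 ||| 0) ===
     (0 ||| mat 1 ||| 0 ||| 0 ||| 0) ===
     (0 ||| 0 ||| mat 1 ||| 0 ||| 0) ===
     (0 ||| 0 ||| 0 ||| mat 1 ||| 0) ===
     (0 ||| 0 ||| 0 ||| 0 ||| mat 1)) ===
    ((0 ||| 0 ||| 0 ||| 0 ||| 0) ===
     (0 ||| 0 ||| 0 ||| 0 ||| 0))"

text \<open>The data of one linear FBSDE with state in \<open>\<real>\<^sup>p\<close>, adjoint state in \<open>\<real>\<^sup>q\<close> and noise in \<open>\<real>\<^sup>d\<close>.\<close>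

record ('p::finite, 'q::finite, 'd::finite) linear_system =
  sysA :: "real ^ 'p ^ 'p"
  sysB :: "real ^ 'q ^ 'p"
  sysC :: "real ^ 'q ^ 'q"
  sysD :: "real ^ 'p ^ 'q"
  sysE :: "real ^ 'p ^ 'q"
  sysM :: "real ^ 'q"
  sysh :: "real ^ 'q"
  sysSigma :: "real ^ 'd ^ 'p"

definition systemN ::
  "('a::finite, 'b::finite, 'c::finite, 'ma::finite, 'mb::finite, 'mc::finite, 'da::finite, 'db::finite)
     dynamics \<Rightarrow> ('a, 'b, 'c) weights \<Rightarrow> ('a, 'b, 'c) weights
   \<Rightarrow> (('a, 'b, 'c) idxP, ('a, 'b, 'c) idxN, 'da + 'db) linear_system" where
  "systemN c run ter =
    \<lparr> sysA = matA c, sysB = matBN c, sysC = matCN c,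
      sysD = weight_matN run, sysE = weight_matN ter,
      sysM = weight_vecN run, sysh = weight_vecN ter, sysSigma = matSigma c \<rparr>"

definition systemP ::
  "('a::finite, 'b::finite, 'c::finite, 'ma::finite, 'mb::finite, 'mc::finite, 'da::finite, 'db::finite)
     dynamics \<Rightarrow> ('a, 'b, 'c) weights \<Rightarrow> ('a, 'b, 'c) weights
   \<Rightarrow> (('a, 'b, 'c) idxP, ('a, 'b, 'c) idxP, 'da + 'db) linear_system" where
  "systemP c run ter =
    \<lparr> sysA = matA c, sysB = matBN c ** matI2, sysC = matI1 ** matCN c ** matI2,
      sysD = matI1 ** weight_matN run, sysE = matI1 ** weight_matN ter,
      sysM = matI1 *v weight_vecN run, sysh = matI1 *v weight_vecN ter, sysSigma = matSigma c \<rparr>"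


section \<open>Conditions 2A and 2B\<close>

definition monotonicity_matrix ::
  "real ^ 'p ^ 'p \<Rightarrow> real ^ 'q ^ 'p \<Rightarrow> real ^ 'p ^ 'p \<Rightarrow> real ^ 'q ^ 'p \<Rightarrow> real ^ 'q ^ 'q \<Rightarrow> real ^ 'p ^ 'q
   \<Rightarrow> real ^ ('p::finite + 'q::finite) ^ ('p + 'q)" where
  "monotonicity_matrix P1 P2 A B C D =
    ((- P1 ** A + P2 ** D ||| P1 ** B - A\<^sup>T ** P2 + P2 ** C) ===
     (0 ||| B\<^sup>T ** P2))"

definition monotonicity_condition ::
  "real ^ 'p ^ 'p \<Rightarrow> real ^ 'q ^ 'p \<Rightarrow> real ^ 'q ^ 'q \<Rightarrow> real ^ 'p ^ 'q \<Rightarrow> real ^ 'p ^ 'q \<Rightarrow> bool" where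
  "monotonicity_condition A B C D E \<longleftrightarrow>
    (\<exists>P1 P2. P1\<^sup>T = P1 \<and>
       (let L = monotonicity_matrix P1 P2 A B C D in 0 \<le> lambda_min (L + L\<^sup>T)) \<and>
       0 < lambda_min (P1 + P2 ** E + E\<^sup>T ** P2\<^sup>T))"

definition condition_2A :: "('p::finite, 'q::finite, 'd::finite) linear_system \<Rightarrow> bool" where
  "condition_2A S \<longleftrightarrow> monotonicity_condition (sysA S) (sysB S) (sysC S) (sysD S) (sysE S)"

text \<open>Condition 2B asks for the monotonicity condition of the N-system after enlarging the state from
  \<open>\<real>\<^sup>P\<close> to \<open>\<real>\<^sup>N\<close> by an auxiliary component of dimension \<open>n\<^sub>\<alpha> + n\<^sub>\<beta>\<close>.\<close>

definition condition_2B ::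
  "('a::finite, 'b::finite, 'c::finite, 'ma::finite, 'mb::finite, 'mc::finite, 'da::finite, 'db::finite)
     dynamics \<Rightarrow> ('a, 'b, 'c) weights \<Rightarrow> ('a, 'b, 'c) weights \<Rightarrow> bool" where
  "condition_2B c run ter \<longleftrightarrow>
    (\<exists>(Ahat :: real ^ ('b + 'a) ^ ('b + 'a)) (Bhat :: real ^ ('a, 'b, 'c) idxN ^ ('b + 'a)).
       monotonicity_condition
         ((matA c ||| 0) === (0 ||| Ahat)) (matBN c === Bhat) (matCN c)
         (weight_matN run ||| 0) (weight_matN ter ||| 0))"


section \<open>Riccati equation and offset equation\<close>

definition riccati_solution ::
  "real \<Rightarrow> ('p::finite, 'q::finite, 'd::finite) linear_system \<Rightarrow> (real \<Rightarrow> real ^ 'p ^ 'q) \<Rightarrow> bool" where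
  "riccati_solution T S \<Gamma> \<longleftrightarrow>
    (\<forall>t\<in>{0..T}. (\<Gamma> has_vector_derivative
        - (\<Gamma> t ** sysA S + sysC S ** \<Gamma> t - \<Gamma> t ** sysB S ** \<Gamma> t + sysD S)) (at t within {0..T})) \<and>
    \<Gamma> T = sysE S"

definition offset_solution ::
  "real \<Rightarrow> ('p::finite, 'q::finite, 'd::finite) linear_system \<Rightarrow> (real \<Rightarrow> real ^ 'p ^ 'q)
   \<Rightarrow> (real \<Rightarrow> real ^ 'q) \<Rightarrow> bool" where
  "offset_solution T S \<Gamma> g \<longleftrightarrow>
    (\<forall>t\<in>{0..T}. (g has_vector_derivative
        - ((sysC S - \<Gamma> t ** sysB S) *v g t + sysM S)) (at t within {0..T})) \<and>
    g T = sysh S"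


section \<open>Wiener processes and information\<close>

definition events_of :: "'w measure \<Rightarrow> ('w \<Rightarrow> 'v::topological_space) \<Rightarrow> 'w set set" where
  "events_of M X = {X -` A \<inter> space M | A. A \<in> sets borel}"

definition path_events ::
  "'w measure \<Rightarrow> (real \<Rightarrow> 'w \<Rightarrow> 'v::topological_space) \<Rightarrow> real \<Rightarrow> 'w set set" where
  "path_events M W t = sigma_sets (space M) (\<Union>s\<in>{0..t}. events_of M (W s))"

text \<open>The \<open>\<sigma>\<close>-algebra \<open>\<F>\<^sub>t\<close> generated by an initial value and a path up to time \<open>t\<close>; it is not
  augmented by null sets.\<close>

definition history ::
  "'w measure \<Rightarrow> ('w \<Rightarrow> 'u::topological_space) \<Rightarrow> (real \<Rightarrow> 'w \<Rightarrow> 'v::topological_space) \<Rightarrow> real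
   \<Rightarrow> 'w measure" where
  "history M \<eta> W t = sigma (space M) (events_of M \<eta> \<union> (\<Union>s\<in>{0..t}. events_of M (W s)))"

definition join_filtration ::
  "'w measure \<Rightarrow> (real \<Rightarrow> 'w measure) \<Rightarrow> (real \<Rightarrow> 'w measure) \<Rightarrow> real \<Rightarrow> 'w measure" where
  "join_filtration M F G t = sigma (space M) (sets (F t) \<union> sets (G t))"

definition wiener_process :: "'w measure \<Rightarrow> real \<Rightarrow> (real \<Rightarrow> 'w \<Rightarrow> real ^ 'd) \<Rightarrow> bool" where
  "wiener_process M T W \<longleftrightarrow>
    (\<forall>t\<in>{0..T}. W t \<in> borel_measurable M) \<and>
    (AE \<omega> in M. W 0 \<omega> = 0) \<and>
    (\<forall>\<omega>\<in>space M. continuous_on {0..T} (\<lambda>t. W t \<omega>)) \<and>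
    (\<forall>s t. 0 \<le> s \<and> s < t \<and> t \<le> T \<longrightarrow>
       (\<forall>i. distributed M lborel (\<lambda>\<omega>. (W t \<omega> - W s \<omega>) $ i) (normal_density 0 (sqrt (t - s)))) \<and>
       prob_space.indep_vars M (\<lambda>_. borel) (\<lambda>i \<omega>. (W t \<omega> - W s \<omega>) $ i) UNIV \<and>
       prob_space.indep_set M (path_events M W s) (events_of M (\<lambda>\<omega>. W t \<omega> - W s \<omega>)))"


section \<open>It\^o integral\<close>

abbreviation time_prod :: "'w measure \<Rightarrow> real \<Rightarrow> (real \<times> 'w) measure" where
  "time_prod M T \<equiv> restrict_space lborel {0..T} \<Otimes>\<^sub>M M"

definition L2_adapted ::
  "'w measure \<Rightarrow> (real \<Rightarrow> 'w measure) \<Rightarrow> real \<Rightarrow> (real \<Rightarrow> 'w \<Rightarrow> 'v::euclidean_space) \<Rightarrow> bool" where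
  "L2_adapted M F T X \<longleftrightarrow>
    (\<lambda>(t, \<omega>). X t \<omega>) \<in> borel_measurable (time_prod M T) \<and>
    (\<forall>t\<in>{0..T}. X t \<in> borel_measurable (F t)) \<and>
    integrable (time_prod M T) (\<lambda>(t, \<omega>). (norm (X t \<omega>))\<^sup>2)"

text \<open>A step process is given by a partition \<open>0 = \<tau> 0 \<le> \<dots> \<le> \<tau> N = T\<close> and its bounded value \<open>\<xi> i\<close>
  on \<open>(\<tau> i, \<tau> (i+1)]\<close>, which is known at time \<open>\<tau> i\<close>.\<close>

definition step_process ::
  "'w measure \<Rightarrow> (real \<Rightarrow> 'w measure) \<Rightarrow> real \<Rightarrow> nat \<Rightarrow> (nat \<Rightarrow> real) \<Rightarrow> (nat \<Rightarrow> 'w \<Rightarrow> real ^ 'd ^ 'k)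
   \<Rightarrow> bool" where
  "step_process M F T N \<tau> \<xi> \<longleftrightarrow>
    \<tau> 0 = 0 \<and> \<tau> N = T \<and>
    (\<forall>i<N. \<tau> i \<le> \<tau> (Suc i) \<and> \<xi> i \<in> borel_measurable (F (\<tau> i)) \<and>
           (\<exists>K. \<forall>\<omega>\<in>space M. norm (\<xi> i \<omega>) \<le> K))"

definition step_value ::
  "nat \<Rightarrow> (nat \<Rightarrow> real) \<Rightarrow> (nat \<Rightarrow> 'w \<Rightarrow> real ^ 'd ^ 'k) \<Rightarrow> real \<Rightarrow> 'w \<Rightarrow> real ^ 'd ^ 'k" where
  "step_value N \<tau> \<xi> t \<omega> = (\<Sum>i<N. indicator {\<tau> i<..\<tau> (Suc i)} t *\<^sub>R \<xi> i \<omega>)"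

definition step_integral ::
  "(real \<Rightarrow> 'w \<Rightarrow> real ^ 'd) \<Rightarrow> nat \<Rightarrow> (nat \<Rightarrow> real) \<Rightarrow> (nat \<Rightarrow> 'w \<Rightarrow> real ^ 'd ^ 'k) \<Rightarrow> real \<Rightarrow> 'w
   \<Rightarrow> real ^ 'k" where
  "step_integral W N \<tau> \<xi> t \<omega> =
    (\<Sum>i<N. \<xi> i \<omega> *v (W (min t (\<tau> (Suc i))) \<omega> - W (min t (\<tau> i)) \<omega>))"

text \<open>\<open>J\<close> is (a version of) \<open>\<integral>\<^sub>0\<^sup>t Z dW\<close>: it is the \<open>L\<^sup>2\<close>-limit of the integrals of step processes
  that converge to \<open>Z\<close> in \<open>L\<^sup>2([0,T] \<times> \<Omega>)\<close>.\<close>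

definition has_ito_integral ::
  "'w measure \<Rightarrow> (real \<Rightarrow> 'w measure) \<Rightarrow> real \<Rightarrow> (real \<Rightarrow> 'w \<Rightarrow> real ^ 'd)
   \<Rightarrow> (real \<Rightarrow> 'w \<Rightarrow> real ^ 'd ^ 'k) \<Rightarrow> real \<Rightarrow> ('w \<Rightarrow> real ^ 'k) \<Rightarrow> bool" where
  "has_ito_integral M F T W Z t J \<longleftrightarrow>
    L2_adapted M F T Z \<and> J \<in> borel_measurable M \<and>
    (\<exists>N \<tau> \<xi>.
       (\<forall>k. step_process M F T (N k) (\<tau> k) (\<xi> k)) \<and>
       (\<lambda>k. \<integral>\<^sup>+ (s, \<omega>). ennreal ((norm (Z s \<omega> - step_value (N k) (\<tau> k) (\<xi> k) s \<omega>))\<^sup>2) \<partial>time_prod M T)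
         \<longlonglongrightarrow> 0 \<and>
       (\<lambda>k. \<integral>\<^sup>+ \<omega>. ennreal ((norm (J \<omega> - step_integral W (N k) (\<tau> k) (\<xi> k) t \<omega>))\<^sup>2) \<partial>M)
         \<longlonglongrightarrow> 0)"

text \<open>\<open>dX = b dt + Z dW\<close> on \<open>[0,T]\<close>.\<close>

definition has_stoch_differential ::
  "'w measure \<Rightarrow> (real \<Rightarrow> 'w measure) \<Rightarrow> real \<Rightarrow> (real \<Rightarrow> 'w \<Rightarrow> real ^ 'd)
   \<Rightarrow> (real \<Rightarrow> 'w \<Rightarrow> real ^ 'k) \<Rightarrow> (real \<Rightarrow> 'w \<Rightarrow> real ^ 'k) \<Rightarrow> (real \<Rightarrow> 'w \<Rightarrow> real ^ 'd ^ 'k) \<Rightarrow> bool" where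
  "has_stoch_differential M F T W X b Z \<longleftrightarrow>
    (AE \<omega> in M. set_integrable lborel {0..T} (\<lambda>s. b s \<omega>)) \<and>
    (\<forall>t\<in>{0..T}. \<exists>J. has_ito_integral M F T W Z t J \<and>
       (AE \<omega> in M. X t \<omega> = X 0 \<omega> + (LINT s:{0..t}|lborel. b s \<omega>) + J \<omega>))"


section \<open>The FBSDE\<close>

definition fbsde_solution ::
  "'w measure \<Rightarrow> (real \<Rightarrow> 'w measure) \<Rightarrow> real \<Rightarrow> (real \<Rightarrow> 'w \<Rightarrow> real ^ 'd)
   \<Rightarrow> ('p::finite, 'q::finite, 'd::finite) linear_system \<Rightarrow> ('w \<Rightarrow> real ^ 'p)
   \<Rightarrow> (real \<Rightarrow> 'w \<Rightarrow> real ^ 'p) \<Rightarrow> (real \<Rightarrow> 'w \<Rightarrow> real ^ 'q) \<Rightarrow> (real \<Rightarrow> 'w \<Rightarrow> real ^ 'd ^ 'q) \<Rightarrow> bool" where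
  "fbsde_solution M F T W S x0 x p Z \<longleftrightarrow>
    L2_adapted M F T x \<and> L2_adapted M F T p \<and> L2_adapted M F T Z \<and>
    (AE \<omega> in M. continuous_on {0..T} (\<lambda>t. x t \<omega>) \<and> continuous_on {0..T} (\<lambda>t. p t \<omega>)) \<and>
    has_stoch_differential M F T W x (\<lambda>t \<omega>. sysA S *v x t \<omega> - sysB S *v p t \<omega>) (\<lambda>t \<omega>. sysSigma S) \<and>
    has_stoch_differential M F T W p (\<lambda>t \<omega>. - (sysC S *v p t \<omega> + sysD S *v x t \<omega> + sysM S)) Z \<and>
    (AE \<omega> in M. x 0 \<omega> = x0 \<omega>) \<and>
    (AE \<omega> in M. p T \<omega> = sysE S *v x T \<omega> + sysh S)"

text \<open>Uniqueness is up to indistinguishability for \<open>x\<close> and \<open>p\<close>, and up to \<open>dt \<otimes> dP\<close>-null sets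
  for \<open>Z\<close>.\<close>

definition fbsde_uniquely_solvable ::
  "'w measure \<Rightarrow> (real \<Rightarrow> 'w measure) \<Rightarrow> real \<Rightarrow> (real \<Rightarrow> 'w \<Rightarrow> real ^ 'd)
   \<Rightarrow> ('p::finite, 'q::finite, 'd::finite) linear_system \<Rightarrow> ('w \<Rightarrow> real ^ 'p) \<Rightarrow> bool" where
  "fbsde_uniquely_solvable M F T W S x0 \<longleftrightarrow>
    (\<exists>x p Z. fbsde_solution M F T W S x0 x p Z \<and>
       (\<forall>x' p' Z'. fbsde_solution M F T W S x0 x' p' Z' \<longrightarrow>
          (AE \<omega> in M. \<forall>t\<in>{0..T}. x' t \<omega> = x t \<omega> \<and> p' t \<omega> = p t \<omega>) \<and>
          (AE (t, \<omega>) in time_prod M T. Z' t \<omega> = Z t \<omega>)))"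

end

theory Submission
  imports Defs
begin

text \<open>
  Along a solution of the Hamiltonian system \<open>x' = A x - B p\<close>, \<open>p' = - (C p + D x)\<close> with
  \<open>p T = E x T\<close>, Condition 2A makes \<open>V = x \<bullet> \<Pi>\<^sub>1 x + 2 (x \<bullet> \<Pi>\<^sub>2 p)\<close> nonincreasing and positive at \<open>T\<close> unless
  \<open>x T = 0\<close>. Hence \<open>x\<close> cannot vanish before \<open>T\<close>, the matrix solution \<open>(X, P)\<close> with terminal value \<open>(I, E)\<close> has
  invertible \<open>X\<close>, and \<open>\<Gamma> = P X\<inverse>\<close> solves the Riccati equation. Under Condition 2B the same argument applies to
  \<open>(x, y)\<close>, where \<open>y\<close> solves the auxiliary linear equation and starts at \<open>0\<close> together with \<open>x\<close>.

  The decoupled forward equation has additive noise, so variation of constants with the fundamental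
  matrix \<open>X\<close> and integration by parts express its solution pathwise in terms of \<open>W\<close>; the martingale part of
  \<open>p = \<Gamma> x + g\<close> is the It\^o integral of the deterministic function \<open>\<Gamma> \<Sigma>\<close>.

  For uniqueness, the difference \<open>(\<delta>x, \<delta>p, \<delta>Z)\<close> of two solutions has no noise in \<open>\<delta>x\<close>, and \<open>q = \<delta>p - \<Gamma> \<delta>x\<close>
  satisfies a linear backward equation with \<open>q T = 0\<close>. Orthogonality of \<open>q t\<close> to the increments of the
  It\^o integral after \<open>t\<close> bounds \<open>E |q t|\<^sup>2\<close> by a multiple of the integral of \<open>E |q s|\<^sup>2\<close> over \<open>[t, T]\<close>, whence \<open>q = 0\<close>,
  \<open>\<delta>x = 0\<close> and, by the isometry, \<open>\<delta>Z = 0\<close>.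
\<close>

section \<open>Quadratic forms and block matrices\<close>

text \<open>The Riccati equation is quadratic, so going backwards from \<open>T\<close> its solution
  might blow up. Passing to the pair (X, P) trades blow-up for singularity of X. A kernel vector of
  X at t0 gives a Hamiltonian trajectory whose state is 0 at t0, and there V = 0 whatever the
  adjoint is, because both terms of V contain the state. Conditions 2A and 2B act only through this
  exclusion, stated as \<open>no_conjugate_point\<close>; what follows it is common to both systems
  and both alternatives.

  Two features of the setting shape the stochastic part. The filtration is not augmented, so the
  solution is built path by path, with identities for every \<omega> and adaptedness at every time.
  The Ito integral is specified at each time separately, through some approximating sequence, so the
  limit has to be shown to be the same along every such sequence before integrals at two times can
  be compared. All product rules are classical: integrands in the existence part are differentiable
  functions of time, and in the uniqueness part the state difference is differentiable along almost
  every path.\<close>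

lemma quadratic_form_transpose:
  fixes X :: "real ^ 'n ^ 'n"
  shows "v \<bullet> ((X + X\<^sup>T) *v v) = 2 * (v \<bullet> (X *v v))"
  by (simp add: matrix_vector_mult_add_rdistrib inner_add_right)
     (metis dot_lmul_matrix inner_commute transpose_matrix_vector)

lemma symmetric_inner:
  fixes X :: "real ^ 'n ^ 'n"
  assumes "X\<^sup>T = X"
  shows "(X *v v) \<bullet> w = v \<bullet> (X *v w)"
  by (metis assms dot_lmul_matrix transpose_matrix_vector)

text \<open>With z = Y v, the form at v - e z has no constant term and linear coefficient -2 |z|^2
  in e. Nonnegativity for small e > 0 therefore forces z = 0.\<close>

lemma psd_form_eq_0D:
  fixes Y :: "real ^ 'n ^ 'n"
  assumes sym: "Y\<^sup>T = Y" and psd: "\<And>v. 0 \<le> v \<bullet> (Y *v v)" and v: "v \<bullet> (Y *v v) = 0"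
  shows "Y *v v = 0"
proof -
  define z where "z = Y *v v"
  have expand: "(v - e *\<^sub>R z) \<bullet> (Y *v (v - e *\<^sub>R z)) = - 2 * e * (z \<bullet> z) + e\<^sup>2 * (z \<bullet> (Y *v z))" for e
    using v symmetric_inner[OF sym, of v z]
    by (simp add: z_def matrix_vector_mult_diff_distrib matrix_vector_mult_scaleR inner_diff_left
        inner_diff_right power2_eq_square algebra_simps inner_commute)
  have bound: "2 * (z \<bullet> z) \<le> e * (z \<bullet> (Y *v z))" if "e > 0" for e
  proof -
    have "0 \<le> e * (- 2 * (z \<bullet> z) + e * (z \<bullet> (Y *v z)))"
      using psd[of "v - e *\<^sub>R z"] unfolding expand by (simp add: power2_eq_square algebra_simps)
    then show ?thesis
      using that by (simp add: zero_le_mult_iff)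
  qed
  have "z \<bullet> z \<le> 0"
  proof (rule ccontr)
    assume "\<not> z \<bullet> z \<le> 0"
    then have pos: "z \<bullet> z > 0" by linarith
    define K where "K = z \<bullet> (Y *v z)"
    have "K \<ge> 0" using psd K_def by simp
    \<comment> \<open>The choice e = (z \<bullet> z) / (K + 1) keeps e K below z \<bullet> z,
      against the factor 2 on the left; the summand 1 covers K = 0.\<close>
    have "2 * (z \<bullet> z) \<le> (z \<bullet> z) / (K + 1) * K"
      unfolding K_def by (rule bound) (use pos \<open>K \<ge> 0\<close> in \<open>simp add: K_def\<close>)
    also have "\<dots> \<le> z \<bullet> z"
      using pos \<open>K \<ge> 0\<close> by (simp add: field_simps)
    finally show False using pos by simp
  qed
  then show ?thesis
    by (metis inner_gt_zero_iff linorder_not_less z_def)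
qed

text \<open>Eigenvectors of distinct eigenvalues are orthogonal, hence independent, so there are
  finitely many. This gives \<open>Min\<close> in \<open>lambda_min\<close> its meaning.\<close>

lemma finite_eigenvalues_symmetric:
  fixes X :: "real ^ 'n ^ 'n"
  assumes sym: "X\<^sup>T = X"
  shows "finite (eigenvalues X)"
proof -
  have "\<forall>l\<in>eigenvalues X. \<exists>v. v \<noteq> 0 \<and> X *v v = l *\<^sub>R v"
    by (simp add: eigenvalues_def)
  then obtain e where e: "\<And>l. l \<in> eigenvalues X \<Longrightarrow> e l \<noteq> 0 \<and> X *v e l = l *\<^sub>R e l"
    by metis
  have orth: "e l \<bullet> e k = 0" if "l \<in> eigenvalues X" "k \<in> eigenvalues X" "l \<noteq> k" for l k
    using symmetric_inner[OF sym, of "e l" "e k"] e[OF that(1)] e[OF that(2)] that(3) by simp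
  have inj: "inj_on e (eigenvalues X)"
  proof (rule inj_onI)
    fix l k assume *: "l \<in> eigenvalues X" "k \<in> eigenvalues X" "e l = e k"
    show "l = k"
      using orth[of l k] * e[of l] by (metis inner_eq_zero_iff)
  qed
  have "pairwise orthogonal (e ` eigenvalues X)"
    unfolding pairwise_def orthogonal_def using orth by (metis imageE)
  moreover have "0 \<notin> e ` eigenvalues X"
    using e by auto
  ultimately have "finite (e ` eigenvalues X)"
    using pairwise_orthogonal_independent independent_imp_finite by blast
  then show ?thesis
    using inj by (simp add: finite_image_iff)
qed

text \<open>The minimum m of the form on the unit sphere is an eigenvalue: X - m I is positive
  semidefinite and its form vanishes at the minimiser, so \<open>psd_form_eq_0D\<close> makes the
  minimiser an eigenvector. Hence \<open>lambda_min X\<close> is at most m.\<close>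

lemma lambda_min_le_quadratic_form:
  fixes X :: "real ^ 'n ^ 'n"
  assumes sym: "X\<^sup>T = X"
  shows "lambda_min X * (v \<bullet> v) \<le> v \<bullet> (X *v v)"
proof -
  have "\<exists>u\<in>sphere 0 1. \<forall>w\<in>sphere 0 1. u \<bullet> (X *v u) \<le> w \<bullet> (X *v w)"
  proof (rule continuous_attains_inf)
    show "continuous_on (sphere 0 1) (\<lambda>u. u \<bullet> (X *v u))"
      by (intro continuous_on_inner continuous_on_id linear_continuous_on matrix_vector_mul_bounded_linear)
  qed auto
  then obtain u where u: "norm u = 1" and least: "\<And>w. norm w = 1 \<Longrightarrow> u \<bullet> (X *v u) \<le> w \<bullet> (X *v w)"
    by auto
  define m where "m = u \<bullet> (X *v u)"
  have form: "m * (w \<bullet> w) \<le> w \<bullet> (X *v w)" for w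
  proof (cases "w = 0")
    case False
    have "m \<le> (w /\<^sub>R norm w) \<bullet> (X *v (w /\<^sub>R norm w))"
      unfolding m_def by (rule least) (simp add: False)
    also have "\<dots> = (w \<bullet> (X *v w)) / (norm w)\<^sup>2"
      by (simp add: matrix_vector_mult_scaleR power2_eq_square divide_simps)
    finally show ?thesis
      using False by (simp add: field_simps dot_square_norm)
  qed simp
  have "(X - m *\<^sub>R mat 1) *v u = 0"
  proof (rule psd_form_eq_0D)
    show "(X - m *\<^sub>R mat 1)\<^sup>T = X - m *\<^sub>R mat 1"
      using sym by (simp add: vec_eq_iff transpose_def mat_def)
    show "0 \<le> w \<bullet> ((X - m *\<^sub>R mat 1) *v w)" for w
      using form[of w] by (simp add: matrix_vector_mult_diff_rdistrib scaleR_matrix_vector_assoc[symmetric] inner_diff_right)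
    show "u \<bullet> ((X - m *\<^sub>R mat 1) *v u) = 0"
      using u by (simp add: matrix_vector_mult_diff_rdistrib scaleR_matrix_vector_assoc[symmetric] inner_diff_right m_def dot_square_norm)
  qed
  then have "m \<in> eigenvalues X"
    using u by (auto simp: eigenvalues_def matrix_vector_mult_diff_rdistrib scaleR_matrix_vector_assoc[symmetric] intro!: exI[of _ u])
  then have "lambda_min X \<le> m"
    unfolding lambda_min_def using finite_eigenvalues_symmetric[OF sym] by simp
  then show ?thesis
    using form[of v] mult_right_mono[of "lambda_min X" m "v \<bullet> v"] by simp
qed

section \<open>Block vectors and the quadratic form of the monotonicity matrix\<close>

lemma vcat_nth [simp]: "(u === v) $ Inl i = u $ i" "(u === v) $ Inr j = v $ j"
  by (simp_all add: vcat_def)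

lemma vcat_eqI: "(\<And>i. w $ Inl i = u $ i) \<Longrightarrow> (\<And>j. w $ Inr j = v $ j) \<Longrightarrow> w = u === v"
  by (simp add: vec_eq_iff split_sum_all)

lemma sum_UNIV_Plus:
  "(\<Sum>i\<in>UNIV. f i) = (\<Sum>i\<in>UNIV. f (Inl i)) + (\<Sum>j\<in>UNIV. f (Inr j))"
  for f :: "'m::finite + 'n::finite \<Rightarrow> 'x::comm_monoid_add"
  by (subst UNIV_Plus_UNIV[symmetric], subst sum.Plus) (auto simp: comp_def)

lemma inner_vcat: "(u === v) \<bullet> (u' === v') = u \<bullet> u' + v \<bullet> (v' :: real ^ 'n)"
  by (simp add: inner_vec_def sum_UNIV_Plus)

lemma norm_vcat_power2: "(norm (u === v))\<^sup>2 = (norm u)\<^sup>2 + (norm (v :: real ^ 'n))\<^sup>2"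
  by (simp only: power2_norm_eq_inner inner_vcat)

lemma vcat_mult_vec: "(X === Y) *v u = (X *v u) === (Y *v u)"
  by (rule vcat_eqI) (simp_all add: matrix_vector_mult_def)

lemma hcat_mult_vec: "(X ||| Y) *v (u === v) = X *v u + Y *v v"
  by (simp add: vec_eq_iff matrix_vector_mult_def hcat_def sum_UNIV_Plus)

lemma matrix_vector_mult_uminus: "(- X) *v v = - (X *v v)" for X :: "real ^ 'n ^ 'm"
  by (simp add: vec_eq_iff matrix_vector_mult_def sum_negf)

text \<open>For symmetric \<open>P1\<close> the right-hand side is minus one half of the derivative
  of x \<bullet> P1 x + 2 (x \<bullet> P2 p) along x' = A x - B p, p' = - (C p + D x). This is where
  the entries of the matrix come from.\<close>

lemma monotonicity_form:
  "(x === p) \<bullet> (monotonicity_matrix P1 P2 A B C D *v (x === p)) =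
     - (x \<bullet> (P1 *v (A *v x - B *v p))) - (A *v x - B *v p) \<bullet> (P2 *v p)
     + x \<bullet> (P2 *v (C *v p + D *v x))"
proof -
  have "x \<bullet> ((A\<^sup>T ** P2) *v p) = (A *v x) \<bullet> (P2 *v p)" for x p
    by (metis dot_lmul_matrix matrix_vector_mul_assoc inner_commute transpose_matrix_vector)
  moreover have "p \<bullet> ((B\<^sup>T ** P2) *v p) = (B *v p) \<bullet> (P2 *v p)"
    by (metis dot_lmul_matrix matrix_vector_mul_assoc inner_commute transpose_matrix_vector)
  ultimately show ?thesis
    by (simp add: monotonicity_matrix_def vcat_mult_vec hcat_mult_vec inner_vcat
        matrix_vector_mult_add_rdistrib matrix_vector_mult_diff_rdistrib
        matrix_vector_mul_assoc[symmetric] inner_diff_left inner_diff_right inner_add_right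
        matrix_vector_right_distrib matrix_vector_mult_diff_distrib matrix_vector_mult_uminus)
qed

text \<open>Adding the transpose doubles a quadratic form, so the two eigenvalue bounds become a
  sign for the derivative of V along the Hamiltonian system and positivity of V on the terminal
  relation p = E x.\<close>

lemma monotonicity_conditionE:
  assumes "monotonicity_condition A B C D E"
  obtains P1 P2 where "P1\<^sup>T = P1"
    and "\<And>x p. (x \<bullet> (P1 *v (A *v x - B *v p))) + (A *v x - B *v p) \<bullet> (P2 *v p)
          - x \<bullet> (P2 *v (C *v p + D *v x)) \<le> 0"
    and "\<And>x. x \<noteq> 0 \<Longrightarrow> 0 < x \<bullet> (P1 *v x) + 2 * (x \<bullet> (P2 *v (E *v x)))"
proof -
  obtain P1 P2 where sym: "P1\<^sup>T = P1"
    and run: "0 \<le> lambda_min (monotonicity_matrix P1 P2 A B C D + (monotonicity_matrix P1 P2 A B C D)\<^sup>T)"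
    and ter: "0 < lambda_min (P1 + P2 ** E + E\<^sup>T ** P2\<^sup>T)"
    using assms by (auto simp: monotonicity_condition_def Let_def)
  have sym_run: "(L + L\<^sup>T)\<^sup>T = L + L\<^sup>T" for L :: "real ^ 'n ^ 'n"
    by (simp add: vec_eq_iff transpose_def)
  have eq_ter: "E\<^sup>T ** P2\<^sup>T = (P2 ** E)\<^sup>T"
    by (simp add: matrix_transpose_mul)
  have sym_ter: "(P1 + P2 ** E + E\<^sup>T ** P2\<^sup>T)\<^sup>T = P1 + P2 ** E + E\<^sup>T ** P2\<^sup>T"
    unfolding eq_ter using sym by (simp add: vec_eq_iff transpose_def)
  show thesis
  proof
    show "P1\<^sup>T = P1" by fact
    show "(x \<bullet> (P1 *v (A *v x - B *v p))) + (A *v x - B *v p) \<bullet> (P2 *v p)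
          - x \<bullet> (P2 *v (C *v p + D *v x)) \<le> 0" for x p
      using order_trans[OF mult_nonneg_nonneg[OF run inner_ge_zero] lambda_min_le_quadratic_form[OF sym_run, of _ "x === p"]]
      unfolding quadratic_form_transpose monotonicity_form by simp
    show "0 < x \<bullet> (P1 *v x) + 2 * (x \<bullet> (P2 *v (E *v x)))" if "x \<noteq> 0" for x
    proof -
      have "0 < lambda_min (P1 + P2 ** E + E\<^sup>T ** P2\<^sup>T) * (x \<bullet> x)"
        using ter that by simp
      also have "\<dots> \<le> x \<bullet> ((P1 + P2 ** E + E\<^sup>T ** P2\<^sup>T) *v x)"
        by (rule lambda_min_le_quadratic_form[OF sym_ter])
      also have "\<dots> = x \<bullet> (P1 *v x) + x \<bullet> (((P2 ** E) + (P2 ** E)\<^sup>T) *v x)"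
        unfolding eq_ter by (simp add: matrix_vector_mult_add_rdistrib inner_add_right)
      finally show ?thesis
        by (simp add: quadratic_form_transpose matrix_vector_mul_assoc)
    qed
  qed
qed

section \<open>Linear ordinary differential equations and Riccati equations\<close>

lemma bounded_bilinear_matrix_mult:
  "bounded_bilinear ((**) :: real ^ 'm ^ 'n \<Rightarrow> real ^ 'k ^ 'm \<Rightarrow> real ^ 'k ^ 'n)"
  unfolding bilinear_conv_bounded_bilinear[symmetric] bilinear_def linear_iff
  by (auto simp: vec_eq_iff matrix_matrix_mult_def algebra_simps sum.distrib sum_distrib_left)

lemma bounded_bilinear_matrix_vector_mult:
  "bounded_bilinear ((*v) :: real ^ 'm ^ 'n \<Rightarrow> real ^ 'm \<Rightarrow> real ^ 'n)"
  unfolding bilinear_conv_bounded_bilinear[symmetric] bilinear_def linear_iff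
  by (auto simp: vec_eq_iff matrix_vector_mult_def algebra_simps sum.distrib sum_distrib_left)

lemmas continuous_on_matrix_mult [continuous_intros] =
    bounded_bilinear.continuous_on[OF bounded_bilinear_matrix_mult]
  and continuous_on_matrix_vector_mult [continuous_intros] =
    bounded_bilinear.continuous_on[OF bounded_bilinear_matrix_vector_mult]

text \<open>As a limit of slopes, the derivative of a product whose first factor vanishes at the
  point is a product of limits, and continuity of the second factor is enough.\<close>

lemma has_vector_derivative_iff_slope:
  fixes f :: "real \<Rightarrow> 'x::real_normed_vector"
  shows "(f has_vector_derivative D) (at x within S) \<longleftrightarrow>
    ((\<lambda>y. (f y - f x) /\<^sub>R (y - x)) \<longlongrightarrow> D) (at x within S)"
proof -
  have "norm ((f y - f x) - (y - x) *\<^sub>R D) / norm (y - x) = norm ((f y - f x) /\<^sub>R (y - x) - D)"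
    if "y \<noteq> x" for y
  proof -
    have "(f y - f x) /\<^sub>R (y - x) - D = ((f y - f x) - (y - x) *\<^sub>R D) /\<^sub>R (y - x)"
      using that by (simp add: scaleR_diff_right)
    then show ?thesis
      by (simp add: divide_inverse_commute abs_inverse)
  qed
  then have "((\<lambda>y. norm ((f y - f x) - (y - x) *\<^sub>R D) / norm (y - x)) \<longlongrightarrow> 0) (at x within S) \<longleftrightarrow>
      ((\<lambda>y. norm ((f y - f x) /\<^sub>R (y - x) - D)) \<longlongrightarrow> 0) (at x within S)"
    by (intro tendsto_cong) (auto simp: eventually_at_filter)
  then show ?thesis
    unfolding has_vector_derivative_def has_derivative_iff_norm
    by (simp add: bounded_linear_scaleR_left tendsto_norm_zero_iff LIM_zero_iff)
qed

text \<open>Applied to \<open>R = P - \<Gamma> t ** X\<close> and \<open>Y = X\<inverse>\<close>, this differentiates \<open>\<Gamma> = P ** X\<inverse>\<close> at \<open>t\<close> although \<open>X\<inverse>\<close> is only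
  known to be continuous.\<close>

lemma has_vector_derivative_vanishing_matrix_mult:
  fixes R :: "real \<Rightarrow> real ^ 'm ^ 'n" and Y :: "real \<Rightarrow> real ^ 'k ^ 'm"
  assumes R: "(R has_vector_derivative R') (at t within S)" "R t = 0"
    and Y: "continuous (at t within S) Y"
  shows "((\<lambda>s. R s ** Y s) has_vector_derivative R' ** Y t) (at t within S)"
proof -
  interpret mm: bounded_bilinear "(**) :: real ^ 'm ^ 'n \<Rightarrow> real ^ 'k ^ 'm \<Rightarrow> _"
    by (rule bounded_bilinear_matrix_mult)
  have "((\<lambda>s. ((R s - R t) /\<^sub>R (s - t)) ** Y s) \<longlongrightarrow> R' ** Y t) (at t within S)"
    using R(1) Y unfolding has_vector_derivative_iff_slope continuous_within
    by (rule mm.tendsto)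
  then show ?thesis
    using R(2) by (simp add: has_vector_derivative_iff_slope mm.scaleR_left mm.zero_left)
qed

section \<open>Uniqueness and Picard iteration for initial and terminal value problems\<close>

lemma has_vector_derivative_reverse:
  assumes u: "\<And>t. t \<in> {a..b} \<Longrightarrow> (u has_vector_derivative u' t) (at t within {a..b})" and t: "t \<in> {a..b}"
  shows "((\<lambda>t. u (a + b - t)) has_vector_derivative - u' (a + b - t)) (at t within {a..b})"
proof -
  have img: "(\<lambda>t. a + b - t) ` {a..b} = {a..b}"
    by (force simp: image_iff intro: bexI[of _ "a + b - x" for x])
  have "((\<lambda>t. a + b - t) has_vector_derivative - 1) (at t within {a..b})"
    by (auto intro!: derivative_eq_intros)
  moreover have "(u has_vector_derivative u' (a + b - t)) (at (a + b - t) within (\<lambda>t. a + b - t) ` {a..b})"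
    unfolding img using u t by auto
  ultimately show ?thesis
    using vector_diff_chain_within by (force simp: o_def)
qed

text \<open>Gronwall in differential form: the weight exp (- 2 k t) turns the bound on u' into
  monotonicity of the weighted |u|^2, which starts at 0.\<close>

lemma ode_zero_forward:
  fixes u :: "real \<Rightarrow> 'x::real_inner"
  assumes u: "\<And>t. t \<in> {a..b} \<Longrightarrow> (u has_vector_derivative u' t) (at t within {a..b})"
    and bound: "\<And>t. t \<in> {a..b} \<Longrightarrow> norm (u' t) \<le> k * norm (u t)"
    and "u a = 0" and t: "t \<in> {a..b}"
  shows "u t = 0"
proof -
  define \<phi> where "\<phi> t = (u t \<bullet> u t) * exp (- 2 * k * t)" for t
  have deriv: "(\<phi> has_real_derivative (2 * (u s \<bullet> u' s) - 2 * k * (u s \<bullet> u s)) * exp (- 2 * k * s)) (at s within {a..b})"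
    if "s \<in> {a..b}" for s
  proof -
    have "((\<lambda>s. u s \<bullet> u s) has_vector_derivative (u s \<bullet> u' s + u' s \<bullet> u s)) (at s within {a..b})"
      by (rule bounded_bilinear.has_vector_derivative[OF bounded_bilinear_inner]) (use u that in auto)
    then have "((\<lambda>s. u s \<bullet> u s) has_real_derivative 2 * (u s \<bullet> u' s)) (at s within {a..b})"
      by (simp add: has_real_derivative_iff_has_vector_derivative inner_commute)
    then show ?thesis
      unfolding \<phi>_def by (auto intro!: derivative_eq_intros simp: algebra_simps)
  qed
  have "\<phi> t \<le> \<phi> a"
  proof (rule DERIV_nonpos_imp_decreasing_open[of a t \<phi>])
    show "a \<le> t" using t by simp
    show "continuous_on {a..t} \<phi>"
      using deriv t by (intro continuous_on_subset[where t = "{a..t}" and s="{a..b}"] DERIV_continuous_on) auto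
    fix s assume s: "a < s" "s < t"
    then have "(\<phi> has_real_derivative (2 * (u s \<bullet> u' s) - 2 * k * (u s \<bullet> u s)) * exp (- 2 * k * s)) (at s)"
      using deriv[of s] t at_within_interior[of s "{a..b}"] by simp
    moreover have "u s \<bullet> u' s \<le> k * (u s \<bullet> u s)"
    proof -
      have "u s \<bullet> u' s \<le> norm (u s) * norm (u' s)"
        by (rule norm_cauchy_schwarz)
      also have "\<dots> \<le> norm (u s) * (k * norm (u s))"
        by (rule mult_left_mono[OF bound]) (use s t in auto)
      finally show ?thesis
        by (simp add: dot_square_norm power2_eq_square mult_ac)
    qed
    ultimately show "\<exists>y. (\<phi> has_real_derivative y) (at s) \<and> y \<le> 0"
      by (intro exI conjI) (auto simp: mult_le_0_iff)
  qed
  then have "u t \<bullet> u t \<le> 0"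
    using \<open>u a = 0\<close> by (simp add: \<phi>_def mult_le_0_iff)
  then show ?thesis
    by (metis inner_gt_zero_iff linorder_not_less)
qed

lemma ode_zero_backward:
  fixes u :: "real \<Rightarrow> 'x::real_inner"
  assumes u: "\<And>t. t \<in> {a..b} \<Longrightarrow> (u has_vector_derivative u' t) (at t within {a..b})"
    and bound: "\<And>t. t \<in> {a..b} \<Longrightarrow> norm (u' t) \<le> k * norm (u t)"
    and "u b = 0" and t: "t \<in> {a..b}"
  shows "u t = 0"
proof -
  have "u (a + b - (a + b - t)) = 0"
    by (rule ode_zero_forward[where u = "\<lambda>t. u (a + b - t)" and a = a and b = b
          and u' = "\<lambda>t. - u' (a + b - t)" and k = k])
       (use has_vector_derivative_reverse[of a b u u'] u t \<open>u b = 0\<close> bound[of "a + b - s" for s] in auto)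
  then show ?thesis by simp
qed

text \<open>The factorial in the bound for successive iterates makes the increments uniformly
  summable on an interval of any length, so a single iteration covers [a, b]. Continuity is asked of
  s \<mapsto> f s (u s) for continuous u, which is the form in which the iteration meets f.\<close>

lemma picard_forward:
  fixes f :: "real \<Rightarrow> 'x::banach \<Rightarrow> 'x"
  assumes ab: "a \<le> b"
    and cont: "\<And>u. continuous_on {a..b} u \<Longrightarrow> continuous_on {a..b} (\<lambda>s. f s (u s))"
    and lip: "\<And>s x y. s \<in> {a..b} \<Longrightarrow> norm (f s x - f s y) \<le> k * norm (x - y)"
  obtains y where "y a = y0" "\<And>t. t \<in> {a..b} \<Longrightarrow> (y has_vector_derivative f t (y t)) (at t within {a..b})"
proof -
  define u where "u = rec_nat (\<lambda>_. y0) (\<lambda>_ v t. y0 + integral {a..t} (\<lambda>s. f s (v s)))"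
  have u_0: "u 0 = (\<lambda>_. y0)" and u_Suc: "u (Suc n) = (\<lambda>t. y0 + integral {a..t} (\<lambda>s. f s (u n s)))" for n
    by (simp_all add: u_def)
  have k: "0 \<le> k * norm (x - y)" for x y :: 'x
    using lip[of a x y] ab by (meson atLeastAtMost_iff norm_ge_zero order_refl order_trans)
  have cont_u: "continuous_on {a..b} (u n)" for n
  proof (induction n)
    case (Suc n)
    have "continuous_on {a..b} (\<lambda>t. integral {a..t} (\<lambda>s. f s (u n s)))"
      by (rule indefinite_integral_continuous_1) (intro integrable_continuous_real cont Suc)
    then show ?case
      unfolding u_Suc by (intro continuous_intros)
  qed (simp add: u_0)
  have int: "(\<lambda>s. f s (u n s)) integrable_on {a..t}" if "t \<in> {a..b}" for n t
    by (rule integrable_on_subinterval[OF integrable_continuous_real[OF cont[OF cont_u]]]) (use that in auto)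
  have "bounded ((\<lambda>t. u 1 t - u 0 t) ` {a..b})"
    by (intro compact_imp_bounded compact_continuous_image continuous_intros cont_u) simp
  then obtain C where C: "\<And>t. t \<in> {a..b} \<Longrightarrow> norm (u 1 t - u 0 t) \<le> C"
    unfolding bounded_iff by (meson imageI)
  have step: "norm (u (Suc n) t - u n t) \<le> C * (\<bar>k\<bar> * (t - a)) ^ n / fact n" if "t \<in> {a..b}" for n t
    using that
  proof (induction n arbitrary: t)
    case 0
    then show ?case using C[of t] by simp
  next
    case (Suc n)
    \<comment> \<open>\<open>h\<close> is the bound claimed for the next index. Its derivative is
      |k| times the present bound, so integrating the Lipschitz estimate reproduces it. The absolute
      value appears because the sign of k is not prescribed.\<close>
    define h where "h s = C * (\<bar>k\<bar> * (s - a)) ^ Suc n / fact (Suc n)" for s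
    have deriv: "(h has_real_derivative \<bar>k\<bar> * (C * (\<bar>k\<bar> * (s - a)) ^ n / fact n)) (at s within A)" for s A
      unfolding h_def
      by (rule derivative_eq_intros refl | simp)+
    have hI: "((\<lambda>s. \<bar>k\<bar> * (C * (\<bar>k\<bar> * (s - a)) ^ n / fact n)) has_integral h t - h a) {a..t}"
      using Suc.prems by (intro fundamental_theorem_of_calculus
          deriv[unfolded has_real_derivative_iff_has_vector_derivative]) auto
    have "u (Suc (Suc n)) t - u (Suc n) t = integral {a..t} (\<lambda>s. f s (u (Suc n) s) - f s (u n s))"
      using fun_cong[OF u_Suc[of "Suc n"], of t] fun_cong[OF u_Suc[of n], of t]
        Henstock_Kurzweil_Integration.integral_diff[OF int[OF Suc.prems, of "Suc n"] int[OF Suc.prems, of n]]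
      by (metis add_diff_cancel_left)
    also have "norm \<dots> \<le> integral {a..t} (\<lambda>s. \<bar>k\<bar> * (C * (\<bar>k\<bar> * (s - a)) ^ n / fact n))"
    proof (rule integral_norm_bound_integral)
      show "(\<lambda>s. f s (u (Suc n) s) - f s (u n s)) integrable_on {a..t}"
        using Suc.prems by (intro integrable_diff int)
      show "(\<lambda>s. \<bar>k\<bar> * (C * (\<bar>k\<bar> * (s - a)) ^ n / fact n)) integrable_on {a..t}"
        using hI by blast
      fix s assume s: "s \<in> {a..t}"
      have "norm (f s (u (Suc n) s) - f s (u n s)) \<le> k * norm (u (Suc n) s - u n s)"
        by (rule lip) (use s Suc.prems in auto)
      also have "\<dots> \<le> \<bar>k\<bar> * norm (u (Suc n) s - u n s)"
        by (simp add: mult_right_mono)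
      also have "\<dots> \<le> \<bar>k\<bar> * (C * (\<bar>k\<bar> * (s - a)) ^ n / fact n)"
        by (intro mult_left_mono Suc.IH) (use s Suc.prems in auto)
      finally show "norm (f s (u (Suc n) s) - f s (u n s)) \<le> \<bar>k\<bar> * (C * (\<bar>k\<bar> * (s - a)) ^ n / fact n)" .
    qed
    also have "\<dots> = h t"
      unfolding integral_unique[OF hI] by (simp add: h_def)
    finally show ?case
      by (simp add: h_def)
  qed
  have "C \<ge> 0"
    using C[of a] ab norm_ge_zero order_trans by (metis atLeastAtMost_iff order_refl)
  have "uniform_limit {a..b} (\<lambda>n t. \<Sum>i<n. u (Suc i) t - u i t) (\<lambda>t. suminf (\<lambda>i. u (Suc i) t - u i t)) sequentially"
  proof (rule Weierstrass_m_test)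
    show "norm (u (Suc n) t - u n t) \<le> C * ((\<bar>k\<bar> * (b - a)) ^ n /\<^sub>R fact n)" if "t \<in> {a..b}" for n t
    proof -
      have "C * ((\<bar>k\<bar> * (t - a)) ^ n / fact n) \<le> C * ((\<bar>k\<bar> * (b - a)) ^ n / fact n)"
        using that \<open>C \<ge> 0\<close> by (intro mult_left_mono divide_right_mono power_mono mult_left_mono) auto
      then show ?thesis
        using step[OF that, of n] by (simp add: divide_inverse_commute mult_ac)
    qed
    show "summable (\<lambda>n. C * ((\<bar>k\<bar> * (b - a)) ^ n /\<^sub>R fact n))"
      by (intro summable_mult summable_exp_generic)
  qed
  then have lim_diff: "uniform_limit {a..b} (\<lambda>n t. u n t - y0) (\<lambda>t. suminf (\<lambda>i. u (Suc i) t - u i t)) sequentially"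
    by (simp add: sum_lessThan_telescope[of "\<lambda>i. u i t" for t] u_0)
  define y where "y t = y0 + suminf (\<lambda>i. u (Suc i) t - u i t)" for t
  have lim: "uniform_limit {a..b} u y sequentially"
  proof -
    have "uniform_limit {a..b} (\<lambda>n t. y0 + (u n t - y0)) y sequentially"
      unfolding y_def by (intro uniform_limit_intros lim_diff)
    then show ?thesis by simp
  qed
  have cont_y: "continuous_on {a..b} y"
    by (rule uniform_limit_theorem[OF always_eventually lim]) (simp_all add: cont_u)
  have lim_f: "uniform_limit {a..b} (\<lambda>n s. f s (u n s)) (\<lambda>s. f s (y s)) sequentially"
  proof (rule uniform_limitI)
    fix e :: real assume "e > 0"
    have "\<forall>\<^sub>F n in sequentially. \<forall>s\<in>{a..b}. dist (u n s) (y s) < e / (\<bar>k\<bar> + 1)"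
      by (rule uniform_limitD[OF lim]) (use \<open>e > 0\<close> in simp)
    then show "\<forall>\<^sub>F n in sequentially. \<forall>s\<in>{a..b}. dist (f s (u n s)) (f s (y s)) < e"
    proof eventually_elim
      case (elim n)
      show ?case
      proof
        fix s assume s: "s \<in> {a..b}"
        have "dist (f s (u n s)) (f s (y s)) \<le> \<bar>k\<bar> * dist (u n s) (y s)"
          unfolding dist_norm using lip[OF s, of "u n s" "y s"]
          by (meson abs_ge_self mult_right_mono norm_ge_zero order_trans)
        also have "\<dots> \<le> \<bar>k\<bar> * (e / (\<bar>k\<bar> + 1))"
          using elim s by (intro mult_left_mono) (auto intro: less_imp_le)
        also have "\<dots> < e"
          using \<open>e > 0\<close> by (simp add: field_simps)
        finally show "dist (f s (u n s)) (f s (y s)) < e" .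
      qed
    qed
  qed
  have y_eq: "y t = y0 + integral {a..t} (\<lambda>s. f s (y s))" if t: "t \<in> {a..b}" for t
  proof -
    have sub: "{a..t} \<subseteq> {a..b}" using t by auto
    obtain I J where IJ: "\<And>n. ((\<lambda>s. f s (u n s)) has_integral I n) {a..t}"
      "((\<lambda>s. f s (y s)) has_integral J) {a..t}" "(I \<longlongrightarrow> J) sequentially"
      by (rule uniform_limit_integral[OF uniform_limit_on_subset[OF lim_f sub]])
         (auto intro: continuous_on_subset[OF cont[OF cont_u] sub])
    have "(\<lambda>n. u (Suc n) t) \<longlonglongrightarrow> y0 + J"
      unfolding u_Suc integral_unique[OF IJ(1)] by (intro tendsto_intros IJ(3))
    moreover have "(\<lambda>n. u (Suc n) t) \<longlonglongrightarrow> y t"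
      using tendsto_uniform_limitI[OF lim t] by (rule LIMSEQ_Suc)
    ultimately show ?thesis
      using IJ(2) LIMSEQ_unique by (auto simp: integral_unique)
  qed
  show thesis
  proof
    show "y a = y0" using y_eq[of a] ab by simp
    fix t assume t: "t \<in> {a..b}"
    have "((\<lambda>t. y0 + integral {a..t} (\<lambda>s. f s (y s))) has_vector_derivative 0 + f t (y t)) (at t within {a..b})"
      by (intro has_vector_derivative_add has_vector_derivative_const integral_has_vector_derivative cont cont_y t)
    then have "((\<lambda>t. y0 + integral {a..t} (\<lambda>s. f s (y s))) has_vector_derivative f t (y t)) (at t within {a..b})"
      by simp
    then show "(y has_vector_derivative f t (y t)) (at t within {a..b})"
      by (rule has_vector_derivative_transform[OF t, rotated]) (simp add: y_eq)
  qed
qed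

lemma picard_backward:
  fixes f :: "real \<Rightarrow> 'x::banach \<Rightarrow> 'x"
  assumes ab: "a \<le> b"
    and cont: "\<And>u. continuous_on {a..b} u \<Longrightarrow> continuous_on {a..b} (\<lambda>s. f s (u s))"
    and lip: "\<And>s x y. s \<in> {a..b} \<Longrightarrow> norm (f s x - f s y) \<le> k * norm (x - y)"
  obtains y where "y b = y1" "\<And>t. t \<in> {a..b} \<Longrightarrow> (y has_vector_derivative f t (y t)) (at t within {a..b})"
proof -
  have rev: "continuous_on {a..b} (\<lambda>s. u (a + b - s))" if "continuous_on {a..b} u" for u :: "real \<Rightarrow> 'x"
    by (rule continuous_on_compose2[OF that]) (auto intro!: continuous_intros)
  obtain z where z: "z a = y1"
    "\<And>t. t \<in> {a..b} \<Longrightarrow> (z has_vector_derivative - f (a + b - t) (z t)) (at t within {a..b})"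
  proof (rule picard_forward[OF ab, of "\<lambda>s x. - f (a + b - s) x" k])
    fix u :: "real \<Rightarrow> 'x" assume "continuous_on {a..b} u"
    from rev[OF cont[OF rev[OF this]]]
    show "continuous_on {a..b} (\<lambda>s. - f (a + b - s) (u s))"
      by (simp add: continuous_on_minus)
  next
    fix s x y assume "s \<in> {a..b}"
    then show "norm (- f (a + b - s) x - - f (a + b - s) y) \<le> k * norm (x - y)"
      using lip[of "a + b - s" y x] by (simp add: norm_minus_commute)
  qed blast
  show thesis
  proof (rule that[of "\<lambda>t. z (a + b - t)"])
    show "z (a + b - b) = y1" using z by simp
    show "((\<lambda>t. z (a + b - t)) has_vector_derivative f t (z (a + b - t))) (at t within {a..b})" if "t \<in> {a..b}" for t
      using has_vector_derivative_reverse[of a b z "\<lambda>t. - f (a + b - t) (z t)"] z(2) that by simp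
  qed
qed

lemma linear_ode_lipschitz:
  fixes G :: "real \<Rightarrow> real ^ 'n ^ 'n"
  assumes G: "continuous_on {a..b} G"
  obtains k where "\<And>s x y. s \<in> {a..b} \<Longrightarrow> norm (G s *v x - G s *v y) \<le> k * norm (x - y)"
    "\<And>s x. s \<in> {a..b} \<Longrightarrow> norm (G s *v x) \<le> k * norm x"
proof -
  obtain K where K: "K > 0" "\<And>(X :: real ^ 'n ^ 'n) v. norm (X *v v) \<le> norm X * norm v * K"
    using bounded_bilinear.pos_bounded[OF bounded_bilinear_matrix_vector_mult] by blast
  have "bounded (G ` {a..b})"
    by (intro compact_imp_bounded compact_continuous_image G) simp
  then obtain C where C: "\<And>s. s \<in> {a..b} \<Longrightarrow> norm (G s) \<le> C"
    unfolding bounded_iff by (meson imageI)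
  have *: "norm (G s *v x) \<le> C * K * norm x" if "s \<in> {a..b}" for s x
  proof -
    have "norm (G s *v x) \<le> norm (G s) * norm x * K" by (rule K(2))
    also have "\<dots> \<le> C * norm x * K"
      using C[OF that] K(1) by (intro mult_right_mono) auto
    finally show ?thesis by (simp add: mult_ac)
  qed
  show thesis
    by (rule that[of "C * K"]) (use * in \<open>auto simp: matrix_vector_mult_diff_distrib[symmetric]\<close>)
qed

lemma linear_ode_forward:
  fixes G :: "real \<Rightarrow> real ^ 'n ^ 'n"
  assumes "a \<le> b" "continuous_on {a..b} G" "continuous_on {a..b} h"
  obtains y where "y a = y0" "\<And>t. t \<in> {a..b} \<Longrightarrow> (y has_vector_derivative G t *v y t + h t) (at t within {a..b})"
proof -
  obtain k where k: "\<And>s x y. s \<in> {a..b} \<Longrightarrow> norm (G s *v x - G s *v y) \<le> k * norm (x - y)"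
    using linear_ode_lipschitz[OF assms(2)] by metis
  show thesis
    by (rule picard_forward[OF assms(1), of "\<lambda>t y. G t *v y + h t" k y0])
       (use assms k that in \<open>auto intro!: continuous_intros\<close>)
qed

lemma linear_ode_backward:
  fixes G :: "real \<Rightarrow> real ^ 'n ^ 'n"
  assumes "a \<le> b" "continuous_on {a..b} G" "continuous_on {a..b} h"
  obtains y where "y b = y1" "\<And>t. t \<in> {a..b} \<Longrightarrow> (y has_vector_derivative G t *v y t + h t) (at t within {a..b})"
proof -
  obtain k where k: "\<And>s x y. s \<in> {a..b} \<Longrightarrow> norm (G s *v x - G s *v y) \<le> k * norm (x - y)"
    using linear_ode_lipschitz[OF assms(2)] by metis
  show thesis
    by (rule picard_backward[OF assms(1), of "\<lambda>t y. G t *v y + h t" k y1])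
       (use assms k that in \<open>auto intro!: continuous_intros\<close>)
qed


section \<open>The Riccati equation through its linear Hamiltonian system\<close>

lemma matrix_inv_inverse:
  fixes X :: "real ^ 'n ^ 'n"
  assumes "invertible X"
  shows "X ** matrix_inv X = mat 1 \<and> matrix_inv X ** X = mat 1"
  using assms unfolding matrix_inv_def invertible_def by (rule someI_ex)

text \<open>By Cramer's rule every entry of the inverse is a quotient of determinants, and these are
  polynomials in the entries of \<open>X\<close>.\<close>

lemma continuous_on_matrix_inv:
  fixes X :: "real \<Rightarrow> real ^ 'n ^ 'n"
  assumes X: "continuous_on S X" and inv: "\<And>t. t \<in> S \<Longrightarrow> invertible (X t)"
  shows "continuous_on S (\<lambda>t. matrix_inv (X t))"
proof -
  have cont_det: "continuous_on S (\<lambda>t. det (Z t))" if "\<And>i j. continuous_on S (\<lambda>t. Z t $ i $ j)"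
    for Z :: "real \<Rightarrow> real ^ 'n ^ 'n"
    unfolding det_def by (intro continuous_intros that)
  have comp: "continuous_on S (\<lambda>t. if l = k then c else X t $ i $ j)" for l k :: 'n and c i j
    by (cases "l = k") (auto intro!: continuous_intros X)
  have cont_X: "continuous_on S (\<lambda>t. X t $ i $ j)" for i j
    by (intro continuous_intros X)
  have "matrix_inv (X t) = (\<chi> k j. det (\<chi> i l. if l = k then axis j 1 $ i else X t $ i $ l) / det (X t))"
    if "t \<in> S" for t
  proof -
    have "X t ** matrix_inv (X t) = mat 1"
      using inv[OF that] by (simp add: matrix_inv_inverse)
    then have "X t *v column j (matrix_inv (X t)) = axis j 1" for j
      by (metis matrix_vector_mul_assoc matrix_vector_mul_lid matrix_vector_mult_basis)
    then have "column j (matrix_inv (X t)) = (\<chi> k. det (\<chi> i l. if l = k then axis j 1 $ i else X t $ i $ l) / det (X t))" for j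
      using cramer inv[OF that] invertible_det_nz by blast
    then show ?thesis
      by (simp add: column_def vec_eq_iff)
  qed
  moreover have "continuous_on S (\<lambda>t. (\<chi> k j. det (\<chi> i l. if l = k then axis j 1 $ i else X t $ i $ l) / det (X t)) :: real ^ 'n ^ 'n)"
    by (intro continuous_on_vec_lambda continuous_intros cont_det)
       (use inv invertible_det_nz X cont_X comp in auto)
  ultimately show ?thesis
    by (metis (no_types, lifting) continuous_on_cong)
qed

text \<open>The conclusion \<open>x T = 0\<close> says that the trajectory is trivial: it makes
  \<open>p T\<close> vanish as well, and the linear system then gives zero on all of [t0, T].
  Derivatives are taken within [t0, T], so the trajectory need not be defined as a solution before
  t0.\<close>

definition no_conjugate_point :: "real \<Rightarrow> ('p::finite, 'q::finite, 'd::finite) linear_system \<Rightarrow> bool" where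
  "no_conjugate_point T S \<longleftrightarrow>
    (\<forall>x p. \<forall>t0\<in>{0..T}. x t0 = 0 \<and> p T = sysE S *v x T \<and>
       (\<forall>t\<in>{t0..T}. (x has_vector_derivative sysA S *v x t - sysB S *v p t) (at t within {t0..T})) \<and>
       (\<forall>t\<in>{t0..T}. (p has_vector_derivative - (sysC S *v p t + sysD S *v x t)) (at t within {t0..T}))
     \<longrightarrow> x T = 0)"

lemma no_conjugate_pointD:
  assumes "no_conjugate_point T S" "t0 \<in> {0..T}" "x t0 = 0" "p T = sysE S *v x T"
    and "\<And>t. t \<in> {t0..T} \<Longrightarrow> (x has_vector_derivative sysA S *v x t - sysB S *v p t) (at t within {t0..T})"
    and "\<And>t. t \<in> {t0..T} \<Longrightarrow> (p has_vector_derivative - (sysC S *v p t + sysD S *v x t)) (at t within {t0..T})"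
  shows "x T = 0"
  using assms unfolding no_conjugate_point_def by blast

text \<open>Radon's linearisation. Since P = \<Gamma> X, the state block satisfies X' = (A - B
  \<Gamma>) X, so X is also a fundamental matrix of the closed-loop equation. It is returned
  together with its inverse for the variation of constants formula of the forward equation.\<close>

lemma riccati_exists:
  fixes S :: "('p::finite, 'q::finite, 'd::finite) linear_system"
  assumes T: "0 < T"
    and no_conjugate: "no_conjugate_point T S"
  obtains \<Gamma> and X Y :: "real \<Rightarrow> real ^ 'p ^ 'p" where "riccati_solution T S \<Gamma>"
    "\<And>t. t \<in> {0..T} \<Longrightarrow> (X has_vector_derivative (sysA S - sysB S ** \<Gamma> t) ** X t) (at t within {0..T})"
    "\<And>t. t \<in> {0..T} \<Longrightarrow> X t ** Y t = mat 1"
    "continuous_on {0..T} Y"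
proof -
  interpret mm: bounded_bilinear "(**) :: real ^ 'm ^ 'n \<Rightarrow> real ^ 'k ^ 'm \<Rightarrow> real ^ 'k ^ 'n"
    by (rule bounded_bilinear_matrix_mult)
  let ?A = "sysA S" and ?B = "sysB S" and ?C = "sysC S" and ?D = "sysD S" and ?E = "sysE S"
  \<comment> \<open>The Hamiltonian system on pairs of matrices. As a bounded linear map it is
    globally Lipschitz, so the terminal value problem is solvable on the whole interval.\<close>
  define L where "L Z = (?A ** fst Z - ?B ** snd Z, - (?C ** snd Z + ?D ** fst Z))"
    for Z :: "(real ^ 'p ^ 'p) \<times> (real ^ 'p ^ 'q)"
  have "bounded_linear L"
    unfolding L_def
    by (intro bounded_linear_intros bounded_linear_Pair bounded_linear_sub bounded_linear_minus bounded_linear_add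
        bounded_linear_compose[OF bounded_bilinear.bounded_linear_right[OF bounded_bilinear_matrix_mult]])
  then interpret L: bounded_linear L .
  obtain k where k: "\<And>Z. norm (L Z) \<le> norm Z * k"
    using L.bounded by blast
  obtain Z where Z: "Z T = (mat 1, ?E)"
    "\<And>t. t \<in> {0..T} \<Longrightarrow> (Z has_vector_derivative L (Z t)) (at t within {0..T})"
  proof (rule picard_backward[of 0 T "\<lambda>_. L" k "(mat 1, ?E)"])
    show "norm (L x - L y) \<le> k * norm (x - y)" for x y
      using k[of "x - y"] by (simp add: L.diff mult.commute)
  qed (use T in \<open>auto intro!: L.continuous_on\<close>)
  define X P where "X t = fst (Z t)" and "P t = snd (Z t)" for t
  have X_T: "X T = mat 1" and P_T: "P T = ?E"
    by (simp_all add: X_def P_def Z)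
  have X: "(X has_vector_derivative ?A ** X t - ?B ** P t) (at t within {0..T})"
    and P: "(P has_vector_derivative - (?C ** P t + ?D ** X t)) (at t within {0..T})" if "t \<in> {0..T}" for t
    using bounded_linear.has_vector_derivative[OF bounded_linear_fst Z(2)[OF that]]
      bounded_linear.has_vector_derivative[OF bounded_linear_snd Z(2)[OF that]]
    by (simp_all add: L_def X_def[abs_def] P_def[abs_def])
  have inv: "invertible (X t0)" if t0: "t0 \<in> {0..T}" for t0
  proof (rule ccontr)
    assume "\<not> invertible (X t0)"
    then obtain v where v: "X t0 *v v = 0" "v \<noteq> 0"
      by (metis invertible_left_inverse matrix_left_invertible_ker)
    have sub: "{t0..T} \<subseteq> {0..T}" using t0 by auto
    note mv = bounded_linear.has_vector_derivative[OF
        bounded_bilinear.bounded_linear_left[OF bounded_bilinear_matrix_vector_mult]]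
    \<comment> \<open>Applying the matrix solution to \<open>v\<close> gives a vector trajectory
      with state 0 at \<open>t0\<close>; its terminal relation holds because \<open>P T\<close> is E
      and \<open>X T\<close> is the identity. The latter also turns the conclusion into v =
      0.\<close>
    have "X T *v v = 0"
    proof (rule no_conjugate_pointD[OF no_conjugate, of t0 "\<lambda>t. X t *v v" "\<lambda>t. P t *v v"])
      fix t assume t: "t \<in> {t0..T}"
      then have t': "t \<in> {0..T}" using sub by blast
      have "((\<lambda>t. X t *v v) has_vector_derivative (?A ** X t - ?B ** P t) *v v) (at t within {t0..T})"
        by (rule mv[OF has_vector_derivative_within_subset[OF X[OF t'] sub]])
      then show "((\<lambda>t. X t *v v) has_vector_derivative ?A *v (X t *v v) - ?B *v (P t *v v)) (at t within {t0..T})"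
        by (simp add: matrix_vector_mult_diff_rdistrib matrix_vector_mul_assoc)
      have "((\<lambda>t. P t *v v) has_vector_derivative (- (?C ** P t + ?D ** X t)) *v v) (at t within {t0..T})"
        by (rule mv[OF has_vector_derivative_within_subset[OF P[OF t'] sub]])
      then show "((\<lambda>t. P t *v v) has_vector_derivative - (?C *v (P t *v v) + ?D *v (X t *v v))) (at t within {t0..T})"
        by (simp add: matrix_vector_mult_add_rdistrib matrix_vector_mult_diff_rdistrib matrix_vector_mult_uminus matrix_vector_mul_assoc)
    qed (use t0 v P_T X_T in \<open>auto simp: matrix_vector_mul_assoc\<close>)
    then show False
      using v X_T by simp
  qed
  define Y \<Gamma> where "Y t = matrix_inv (X t)" and "\<Gamma> t = P t ** Y t" for t
  have XY: "X t ** Y t = mat 1" "Y t ** X t = mat 1" if "t \<in> {0..T}" for t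
    using inv[OF that] by (simp_all add: Y_def matrix_inv_inverse)
  have cont_Y: "continuous_on {0..T} Y"
    unfolding Y_def[abs_def]
    by (rule continuous_on_matrix_inv[OF _ inv]) (auto intro: continuous_on_vector_derivative X)
  have \<Gamma>X: "\<Gamma> t ** X t = P t" if "t \<in> {0..T}" for t
    using XY[OF that] by (simp add: \<Gamma>_def matrix_mul_assoc[symmetric])
  have ric: "riccati_solution T S \<Gamma>"
    unfolding riccati_solution_def
  proof (intro conjI ballI)
    show "\<Gamma> T = ?E"
      using XY(1)[of T] T by (simp add: \<Gamma>_def P_T X_T)
    fix t assume t: "t \<in> {0..T}"
    define R where "R s = P s - \<Gamma> t ** X s" for s
    define R' where "R' = - (?C ** P t + ?D ** X t) - \<Gamma> t ** (?A ** X t - ?B ** P t)"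
    have R: "(R has_vector_derivative R') (at t within {0..T})"
      unfolding R_def R'_def
      by (intro has_vector_derivative_diff P t bounded_linear.has_vector_derivative[OF mm.bounded_linear_right] X)
    have "((\<lambda>s. R s ** Y s) has_vector_derivative R' ** Y t) (at t within {0..T})"
      by (rule has_vector_derivative_vanishing_matrix_mult[OF R])
         (use t cont_Y in \<open>auto simp: R_def \<Gamma>X continuous_on_eq_continuous_within\<close>)
    moreover have "R s ** Y s = \<Gamma> s - \<Gamma> t" if "s \<in> {0..T}" for s
      using XY[OF that] by (simp add: R_def mm.diff_left \<Gamma>_def[of s] matrix_mul_assoc[symmetric])
    ultimately have "((\<lambda>s. \<Gamma> s - \<Gamma> t) has_vector_derivative R' ** Y t) (at t within {0..T})"
      using t by (metis (no_types, lifting) has_vector_derivative_transform)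
    from has_vector_derivative_add[OF this has_vector_derivative_const[of "\<Gamma> t"]]
    have "(\<Gamma> has_vector_derivative R' ** Y t) (at t within {0..T})"
      by simp
    moreover have "R' ** Y t = - (\<Gamma> t ** ?A + ?C ** \<Gamma> t - \<Gamma> t ** ?B ** \<Gamma> t + ?D)"
    proof -
      have "R' ** Y t = - (?C ** (P t ** Y t) + ?D ** (X t ** Y t)) - \<Gamma> t ** (?A ** (X t ** Y t) - ?B ** (P t ** Y t))"
        by (simp add: R'_def mm.diff_left mm.add_left mm.minus_left mm.diff_right matrix_mul_assoc)
      then show ?thesis
        by (simp add: XY[OF t] \<Gamma>_def[symmetric] mm.diff_right matrix_mul_assoc)
    qed
    ultimately show "(\<Gamma> has_vector_derivative - (\<Gamma> t ** ?A + ?C ** \<Gamma> t - \<Gamma> t ** ?B ** \<Gamma> t + ?D)) (at t within {0..T})"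
      by simp
  qed
  show thesis
  proof (rule that[of \<Gamma> X Y, OF ric])
    show "X t ** Y t = mat 1" if "t \<in> {0..T}" for t by (rule XY(1)[OF that])
    show "continuous_on {0..T} Y" by (rule cont_Y)
    fix t assume t: "t \<in> {0..T}"
    show "(X has_vector_derivative (?A - ?B ** \<Gamma> t) ** X t) (at t within {0..T})"
      using X[OF t] by (simp add: mm.diff_left matrix_mul_assoc[symmetric] \<Gamma>X[OF t])
  qed
qed

lemma riccati_solution_continuous_on: "riccati_solution T S \<Gamma> \<Longrightarrow> continuous_on {0..T} \<Gamma>"
  unfolding riccati_solution_def by (intro continuous_on_vector_derivative) blast

text \<open>The splitting \<Gamma>1 B \<Gamma>1 - \<Gamma>2 B \<Gamma>2 = \<delta> (B \<Gamma>1) +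
  (\<Gamma>2 B) \<delta> makes the equation for the difference \<delta> linear. Its coefficients are
  bounded because both solutions are continuous on a compact interval, so backward uniqueness
  applies.\<close>

lemma riccati_unique:
  fixes S :: "('p::finite, 'q::finite, 'd::finite) linear_system"
  assumes G1: "riccati_solution T S \<Gamma>1" and G2: "riccati_solution T S \<Gamma>2" and t: "t \<in> {0..T}"
  shows "\<Gamma>1 t = \<Gamma>2 t"
proof -
  interpret mm: bounded_bilinear "(**) :: real ^ 'm ^ 'n \<Rightarrow> real ^ 'k ^ 'm \<Rightarrow> real ^ 'k ^ 'n"
    by (rule bounded_bilinear_matrix_mult)
  let ?A = "sysA S" and ?B = "sysB S" and ?C = "sysC S" and ?D = "sysD S"
  define \<delta> where "\<delta> t = \<Gamma>1 t - \<Gamma>2 t" for t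
  define \<delta>' where "\<delta>' t = - (\<delta> t ** ?A + ?C ** \<delta> t - (\<delta> t ** (?B ** \<Gamma>1 t) + (\<Gamma>2 t ** ?B) ** \<delta> t))" for t
  have deriv: "(\<delta> has_vector_derivative \<delta>' t) (at t within {0..T})" if "t \<in> {0..T}" for t
  proof -
    have "(\<delta> has_vector_derivative - (\<Gamma>1 t ** ?A + ?C ** \<Gamma>1 t - \<Gamma>1 t ** ?B ** \<Gamma>1 t + ?D)
        - - (\<Gamma>2 t ** ?A + ?C ** \<Gamma>2 t - \<Gamma>2 t ** ?B ** \<Gamma>2 t + ?D)) (at t within {0..T})"
      unfolding \<delta>_def by (intro has_vector_derivative_diff) (use G1 G2 that in \<open>auto simp: riccati_solution_def\<close>)
    also have "- (\<Gamma>1 t ** ?A + ?C ** \<Gamma>1 t - \<Gamma>1 t ** ?B ** \<Gamma>1 t + ?D)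
        - - (\<Gamma>2 t ** ?A + ?C ** \<Gamma>2 t - \<Gamma>2 t ** ?B ** \<Gamma>2 t + ?D) = \<delta>' t"
      by (simp add: \<delta>'_def \<delta>_def mm.diff_left mm.diff_right matrix_mul_assoc algebra_simps)
    finally show ?thesis .
  qed
  have "bounded ((\<lambda>t. ?B ** \<Gamma>1 t) ` {0..T})" "bounded ((\<lambda>t. \<Gamma>2 t ** ?B) ` {0..T})"
    using riccati_solution_continuous_on[OF G1] riccati_solution_continuous_on[OF G2]
    by (auto intro!: compact_imp_bounded compact_continuous_image continuous_intros)
  then obtain c1 c2 where c: "\<And>t. t \<in> {0..T} \<Longrightarrow> norm (?B ** \<Gamma>1 t) \<le> c1" "\<And>t. t \<in> {0..T} \<Longrightarrow> norm (\<Gamma>2 t ** ?B) \<le> c2"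
    unfolding bounded_iff by (meson imageI)
  obtain K1 where K1: "K1 > 0" "\<And>(U :: real ^ 'p ^ 'q) (V :: real ^ 'p ^ 'p). norm (U ** V) \<le> norm U * norm V * K1"
    using bounded_bilinear.pos_bounded[OF bounded_bilinear_matrix_mult] by blast
  obtain K2 where K2: "K2 > 0" "\<And>(U :: real ^ 'q ^ 'q) (V :: real ^ 'p ^ 'q). norm (U ** V) \<le> norm U * norm V * K2"
    using bounded_bilinear.pos_bounded[OF bounded_bilinear_matrix_mult] by blast
  have "\<delta> t = 0"
  proof (rule ode_zero_backward[OF deriv _ _ t])
    show "\<delta> T = 0" using G1 G2 by (simp add: \<delta>_def riccati_solution_def)
    fix t assume t: "t \<in> {0..T}"
    have "norm (\<delta>' t) \<le> norm (\<delta> t ** ?A + ?C ** \<delta> t) + norm (\<delta> t ** (?B ** \<Gamma>1 t) + (\<Gamma>2 t ** ?B) ** \<delta> t)"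
      unfolding \<delta>'_def norm_minus_cancel by (rule norm_triangle_ineq4)
    also have "\<dots> \<le> (norm (\<delta> t ** ?A) + norm (?C ** \<delta> t)) + (norm (\<delta> t ** (?B ** \<Gamma>1 t)) + norm ((\<Gamma>2 t ** ?B) ** \<delta> t))"
      by (intro add_mono norm_triangle_ineq)
    also have "\<dots> \<le> (norm (\<delta> t) * norm ?A * K1 + norm ?C * norm (\<delta> t) * K2)
        + (norm (\<delta> t) * norm (?B ** \<Gamma>1 t) * K1 + norm (\<Gamma>2 t ** ?B) * norm (\<delta> t) * K2)"
      by (intro add_mono K1 K2)
    also have "\<dots> \<le> (norm (\<delta> t) * norm ?A * K1 + norm ?C * norm (\<delta> t) * K2)
        + (norm (\<delta> t) * c1 * K1 + c2 * norm (\<delta> t) * K2)"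
      using c[OF t] K1(1) K2(1) by (intro add_mono mult_right_mono mult_left_mono) auto
    also have "\<dots> = ((norm ?A + c1) * K1 + (norm ?C + c2) * K2) * norm (\<delta> t)"
      by (simp add: algebra_simps)
    finally show "norm (\<delta>' t) \<le> ((norm ?A + c1) * K1 + (norm ?C + c2) * K2) * norm (\<delta> t)" .
  qed
  then show ?thesis by (simp add: \<delta>_def)
qed

lemma offset_exists_unique:
  fixes S :: "('p::finite, 'q::finite, 'd::finite) linear_system"
  assumes T: "0 < T" and \<Gamma>: "riccati_solution T S \<Gamma>"
  obtains g where "offset_solution T S \<Gamma> g"
    "\<And>g' t. offset_solution T S \<Gamma> g' \<Longrightarrow> t \<in> {0..T} \<Longrightarrow> g' t = g t"
proof -
  let ?G = "\<lambda>t. - (sysC S - \<Gamma> t ** sysB S)"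
  have cont: "continuous_on {0..T} ?G"
    using riccati_solution_continuous_on[OF \<Gamma>] by (auto intro!: continuous_intros)
  obtain g where g: "g T = sysh S"
    "\<And>t. t \<in> {0..T} \<Longrightarrow> (g has_vector_derivative ?G t *v g t + - sysM S) (at t within {0..T})"
    using linear_ode_backward[of 0 T ?G "\<lambda>_. - sysM S" "sysh S"] T cont by auto
  obtain k where k: "\<And>s x. s \<in> {0..T} \<Longrightarrow> norm (?G s *v x) \<le> k * norm x"
    using linear_ode_lipschitz[OF cont] by metis
  show thesis
  proof
    show "offset_solution T S \<Gamma> g"
      using g unfolding offset_solution_def by (simp add: matrix_vector_mult_diff_rdistrib)
    fix g' t assume g': "offset_solution T S \<Gamma> g'" and t: "t \<in> {0..T}"
    have "g' t - g t = 0"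
    proof (rule ode_zero_backward[OF _ _ _ t])
      show "g' T - g T = 0" using g(1) g' by (simp add: offset_solution_def)
      fix t assume t: "t \<in> {0..T}"
      have "(g' has_vector_derivative ?G t *v g' t + - sysM S) (at t within {0..T})"
        using g' t by (simp add: offset_solution_def matrix_vector_mult_diff_rdistrib)
      from has_vector_derivative_diff[OF this g(2)[OF t]]
      show "((\<lambda>t. g' t - g t) has_vector_derivative ?G t *v (g' t - g t)) (at t within {0..T})"
        by (simp add: matrix_vector_mult_diff_distrib)
      show "norm (?G t *v (g' t - g t)) \<le> k * norm (g' t - g t)"
        by (rule k[OF t])
    qed
    then show "g' t = g t" by simp
  qed
qed

text \<open>Formulated for matrices and not for a \<open>linear_system\<close>, so that the enlarged
  state of Condition 2B is covered by the same proof.\<close>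

lemma monotone_no_conjugate_point:
  fixes x :: "real \<Rightarrow> real ^ 'p" and p :: "real \<Rightarrow> real ^ 'q"
  assumes mono: "monotonicity_condition A B C D E"
    and t0: "t0 \<le> T" and x_t0: "x t0 = 0" and p_T: "p T = E *v x T"
    and x: "\<And>t. t \<in> {t0..T} \<Longrightarrow> (x has_vector_derivative A *v x t - B *v p t) (at t within {t0..T})"
    and p: "\<And>t. t \<in> {t0..T} \<Longrightarrow> (p has_vector_derivative - (C *v p t + D *v x t)) (at t within {t0..T})"
  shows "x T = 0"
proof (rule ccontr)
  assume "x T \<noteq> 0"
  obtain P1 P2 where P: "P1\<^sup>T = P1"
    and run: "\<And>x p. (x \<bullet> (P1 *v (A *v x - B *v p))) + (A *v x - B *v p) \<bullet> (P2 *v p)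
          - x \<bullet> (P2 *v (C *v p + D *v x)) \<le> 0"
    and ter: "\<And>x. x \<noteq> 0 \<Longrightarrow> 0 < x \<bullet> (P1 *v x) + 2 * (x \<bullet> (P2 *v (E *v x)))"
    using monotonicity_conditionE[OF mono] by metis
  define V where "V t = x t \<bullet> (P1 *v x t) + 2 * (x t \<bullet> (P2 *v p t))" for t
  define V' where "V' t = 2 * (x t \<bullet> (P1 *v (A *v x t - B *v p t)) + (A *v x t - B *v p t) \<bullet> (P2 *v p t)
          - x t \<bullet> (P2 *v (C *v p t + D *v x t)))" for t
  note mv = bounded_linear.has_vector_derivative[OF matrix_vector_mul_bounded_linear]
  have arith: "a + b + 2 * (d + f) = 2 * (a + f - e)" if "b = a" "d = - e" for a b d e f :: real
    using that by simp
  have deriv: "(V has_real_derivative V' t) (at t within {t0..T})" if t: "t \<in> {t0..T}" for t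
  proof -
    have "((\<lambda>t. x t \<bullet> (P1 *v x t)) has_real_derivative
        (x t \<bullet> (P1 *v (A *v x t - B *v p t)) + (A *v x t - B *v p t) \<bullet> (P1 *v x t))) (at t within {t0..T})"
      unfolding has_real_derivative_iff_has_vector_derivative
      by (intro bounded_bilinear.has_vector_derivative[OF bounded_bilinear_inner] mv x t)
    moreover have "((\<lambda>t. x t \<bullet> (P2 *v p t)) has_real_derivative
        (x t \<bullet> (P2 *v (- (C *v p t + D *v x t))) + (A *v x t - B *v p t) \<bullet> (P2 *v p t))) (at t within {t0..T})"
      unfolding has_real_derivative_iff_has_vector_derivative
      by (intro bounded_bilinear.has_vector_derivative[OF bounded_bilinear_inner] mv x p t)
    ultimately have "(V has_real_derivative (x t \<bullet> (P1 *v (A *v x t - B *v p t)) + (A *v x t - B *v p t) \<bullet> (P1 *v x t))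
        + 2 * (x t \<bullet> (P2 *v (- (C *v p t + D *v x t))) + (A *v x t - B *v p t) \<bullet> (P2 *v p t))) (at t within {t0..T})"
      unfolding V_def by (intro DERIV_add DERIV_cmult)
    moreover have "(A *v x t - B *v p t) \<bullet> (P1 *v x t) = x t \<bullet> (P1 *v (A *v x t - B *v p t))"
      by (metis P inner_commute symmetric_inner)
    moreover have "x t \<bullet> (P2 *v (- (C *v p t + D *v x t))) = - (x t \<bullet> (P2 *v (C *v p t + D *v x t)))"
      by (metis matrix_vector_mul_linear linear_neg inner_minus_right)
    ultimately show ?thesis
      unfolding V'_def by (elim DERIV_cong) (rule arith)
  qed
  have "V T \<le> V t0"
  proof (rule DERIV_nonpos_imp_decreasing_open[of t0 T V])
    show "continuous_on {t0..T} V"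
      using deriv by (rule DERIV_continuous_on)
    fix t assume t: "t0 < t" "t < T"
    then have "(V has_real_derivative V' t) (at t)"
      using deriv[of t] at_within_interior[of t "{t0..T}"] by simp
    moreover have "V' t \<le> 0"
      using run[of "x t" "p t"] by (simp add: V'_def)
    ultimately show "\<exists>y. (V has_real_derivative y) (at t) \<and> y \<le> 0" by blast
  qed (rule t0)
  moreover have "V t0 = 0"
    by (simp add: V_def x_t0)
  moreover have "0 < V T"
    using ter[OF \<open>x T \<noteq> 0\<close>] by (simp add: V_def p_T)
  ultimately show False by simp
qed

lemma condition_2A_no_conjugate_point:
  assumes "condition_2A S"
  shows "no_conjugate_point T S"
  unfolding no_conjugate_point_def
proof (intro allI ballI impI, elim conjE)
  fix x p t0
  assume *: "t0 \<in> {0..T}" "x t0 = 0" "p T = sysE S *v x T"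
    "\<forall>t\<in>{t0..T}. (x has_vector_derivative sysA S *v x t - sysB S *v p t) (at t within {t0..T})"
    "\<forall>t\<in>{t0..T}. (p has_vector_derivative - (sysC S *v p t + sysD S *v x t)) (at t within {t0..T})"
  show "x T = 0"
    by (rule monotone_no_conjugate_point[OF assms[unfolded condition_2A_def] _ *(2,3) *(4,5)[rule_format]])
       (use *(1) in simp_all)
qed

section \<open>Filtrations and Wiener processes\<close>

lemma bounded_linear_vcat:
  "bounded_linear (\<lambda>z :: (real ^ 'm::finite) \<times> (real ^ 'n::finite). fst z === snd z)"
  unfolding linear_conv_bounded_linear[symmetric]
  by (rule linearI) (simp_all add: vec_eq_iff split_sum_all)

lemma continuous_on_vcat:
  fixes f :: "'x::topological_space \<Rightarrow> real ^ 'm::finite" and g :: "'x \<Rightarrow> real ^ 'n::finite"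
  shows "continuous_on A f \<Longrightarrow> continuous_on A g \<Longrightarrow> continuous_on A (\<lambda>x. f x === g x)"
  using bounded_linear.continuous_on[OF bounded_linear_vcat continuous_on_Pair, of A f g] by simp

lemma borel_measurable_vcat:
  fixes f :: "'x \<Rightarrow> real ^ 'm::finite" and g :: "'x \<Rightarrow> real ^ 'n::finite"
  shows "f \<in> borel_measurable N \<Longrightarrow> g \<in> borel_measurable N \<Longrightarrow> (\<lambda>x. f x === g x) \<in> borel_measurable N"
  using borel_measurable_continuous_on[OF linear_continuous_on[OF bounded_linear_vcat] borel_measurable_Pair, of f N g]
  by simp

lemma vcat_diff: "(u === v) - (u' === v') = (u - u') === (v - (v' :: real ^ 'n))"
  by (rule vcat_eqI) simp_all

lemma borel_measurable_vec_nth [measurable (raw)]: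
  fixes f :: "'x \<Rightarrow> 'v::topological_space ^ 'n"
  shows "f \<in> borel_measurable N \<Longrightarrow> (\<lambda>x. f x $ i) \<in> borel_measurable N"
  by (rule borel_measurable_continuous_on[where f = "\<lambda>v. v $ i"]) (intro continuous_intros)

lemma events_ofI: "A \<in> sets borel \<Longrightarrow> X -` A \<inter> space M \<in> events_of M X"
  by (auto simp: events_of_def)

lemma space_in_events_of: "space M \<in> events_of M X"
  using events_ofI[of UNIV X M] by simp

lemma events_of_subset_iff: "events_of M X \<subseteq> sets N \<longleftrightarrow> X \<in> borel_measurable N" if "space N = space M"
  using that by (auto simp: events_of_def measurable_def)

lemma Int_stable_events_of: "Int_stable (events_of M X)"
proof (rule Int_stableI)
  fix a b assume "a \<in> events_of M X" "b \<in> events_of M X"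
  then obtain A B where "a = X -` A \<inter> space M" "b = X -` B \<inter> space M" "A \<in> sets borel" "B \<in> sets borel"
    by (auto simp: events_of_def)
  then show "a \<inter> b \<in> events_of M X"
    unfolding events_of_def by (auto intro!: exI[of _ "A \<inter> B"])
qed

lemma path_events_generators: "(\<Union>s\<in>{0..t}. events_of M (W s)) \<subseteq> Pow (space M)"
  by (auto simp: events_of_def)

lemma sigma_algebra_path_events: "sigma_algebra (space M) (path_events M W t)"
  unfolding path_events_def by (rule sigma_algebra_sigma_sets[OF path_events_generators])

lemma path_events_Int:
  assumes "a \<in> path_events M W t" "b \<in> path_events M W t"
  shows "a \<inter> b \<in> path_events M W t"
proof -
  interpret sigma_algebra "space M" "path_events M W t"
    by (rule sigma_algebra_path_events)
  show ?thesis using assms by (rule Int)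
qed

lemma Int_stable_path_events: "Int_stable (path_events M W t)"
  by (rule Int_stableI) (rule path_events_Int)

lemma space_in_path_events: "space M \<in> path_events M W t"
  unfolding path_events_def by (rule sigma_sets_top)

lemma path_events_mono: "s \<le> t \<Longrightarrow> path_events M W s \<subseteq> path_events M W t"
  unfolding path_events_def by (rule sigma_sets_mono') force

text \<open>Independence is assumed for path events up to \<open>T\<close>; increments inherit it
  because they are measurable functions of the path.\<close>

lemma events_of_increment_path_events:
  fixes W :: "real \<Rightarrow> 'w \<Rightarrow> real ^ 'd"
  assumes "0 \<le> s" "s \<le> t" "t \<le> T"
  shows "events_of M (\<lambda>\<omega>. W t \<omega> - W s \<omega>) \<subseteq> path_events M W T"
proof -
  define N where "N = sigma (space M) (\<Union>s\<in>{0..T}. events_of M (W s))"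
  have N: "space N = space M" "sets N = path_events M W T"
    using path_events_generators[where M = M and W = W and t = T]
    by (simp_all add: N_def path_events_def)
  have "W u \<in> borel_measurable N" if "u \<in> {0..T}" for u
    unfolding events_of_subset_iff[OF N(1), symmetric] N(2) path_events_def using that by blast
  then have "W t \<in> borel_measurable N" "W s \<in> borel_measurable N"
    using assms by auto
  then show ?thesis
    unfolding N(2)[symmetric] events_of_subset_iff[OF N(1)] by simp
qed

lemma space_history [simp]: "space (history M \<eta> W t) = space M"
  unfolding history_def by (rule space_measure_of) (auto simp: events_of_def)

lemma sets_history: "sets (history M \<eta> W t) = sigma_sets (space M) (events_of M \<eta> \<union> (\<Union>s\<in>{0..t}. events_of M (W s)))"
  unfolding history_def by (rule sets_measure_of) (auto simp: events_of_def)

lemma space_join_filtration [simp]: "space (join_filtration M F G t) = space M"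
  if "space (F t) = space M" "space (G t) = space M"
  unfolding join_filtration_def using sets.space_closed[of "F t"] sets.space_closed[of "G t"] that
  by (intro space_measure_of) auto

lemma sets_join_filtration:
  "sets (join_filtration M F G t) = sigma_sets (space M) (sets (F t) \<union> sets (G t))"
  if "space (F t) = space M" "space (G t) = space M"
  unfolding join_filtration_def using sets.space_closed[of "F t"] sets.space_closed[of "G t"] that
  by (intro sets_measure_of) auto

lemma history_mono: "s \<le> t \<Longrightarrow> sets (history M \<eta> W s) \<subseteq> sets (history M \<eta> W t)"
  unfolding sets_history by (rule sigma_sets_mono') force

text \<open>The interface for the L2 theory. Independence from the past is stated for real test
  functions, \<open>X\<close> of the past and \<open>Y\<close> of the increment, as needed to
  factorise expectations of products. The Gaussian law is recorded through first and second moments.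
  The strict inequality s < t reflects that the increment has a density only then, so degenerate
  increments are treated apart below.\<close>

locale filtered_wiener = prob_space M
  for M :: "'w measure" and F :: "real \<Rightarrow> 'w measure" and T :: real and W :: "real \<Rightarrow> 'w \<Rightarrow> real ^ 'd" +
  assumes T: "0 < T"
    and space_F: "t \<in> {0..T} \<Longrightarrow> space (F t) = space M"
    and F_mono: "0 \<le> s \<Longrightarrow> s \<le> t \<Longrightarrow> t \<le> T \<Longrightarrow> sets (F s) \<subseteq> sets (F t)"
    and F_sub: "t \<in> {0..T} \<Longrightarrow> sets (F t) \<subseteq> sets M"
    and W_adapted: "t \<in> {0..T} \<Longrightarrow> W t \<in> borel_measurable (F t)"
    and W_continuous: "\<omega> \<in> space M \<Longrightarrow> continuous_on {0..T} (\<lambda>t. W t \<omega>)"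
    and W_indep: "0 \<le> s \<Longrightarrow> s < t \<Longrightarrow> t \<le> T \<Longrightarrow> X \<in> borel_measurable (F s) \<Longrightarrow> Y \<in> borel_measurable borel \<Longrightarrow>
      indep_var borel (X :: 'w \<Rightarrow> real) borel (\<lambda>\<omega>. Y (W t \<omega> - W s \<omega>) :: real)"
    and W_mean: "0 \<le> s \<Longrightarrow> s < t \<Longrightarrow> t \<le> T \<Longrightarrow>
      integrable M (\<lambda>\<omega>. (W t \<omega> - W s \<omega>) $ i) \<and> expectation (\<lambda>\<omega>. (W t \<omega> - W s \<omega>) $ i) = 0"
    and W_covariance: "0 \<le> s \<Longrightarrow> s < t \<Longrightarrow> t \<le> T \<Longrightarrow>
      integrable M (\<lambda>\<omega>. (W t \<omega> - W s \<omega>) $ i * (W t \<omega> - W s \<omega>) $ j) \<and>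
      expectation (\<lambda>\<omega>. (W t \<omega> - W s \<omega>) $ i * (W t \<omega> - W s \<omega>) $ j) = (if i = j then t - s else 0)"

context prob_space
begin

lemma wiener_increment_moments:
  assumes W: "wiener_process M T W" and st: "0 \<le> s" "s < t" "t \<le> T"
  shows "integrable M (\<lambda>\<omega>. (W t \<omega> - W s \<omega>) $ i)"
    and "expectation (\<lambda>\<omega>. (W t \<omega> - W s \<omega>) $ i) = 0"
    and "integrable M (\<lambda>\<omega>. (W t \<omega> - W s \<omega>) $ i * (W t \<omega> - W s \<omega>) $ j)"
    and "expectation (\<lambda>\<omega>. (W t \<omega> - W s \<omega>) $ i * (W t \<omega> - W s \<omega>) $ j) = (if i = j then t - s else 0)"
proof -
  have normal: "distributed M lborel (\<lambda>\<omega>. (W t \<omega> - W s \<omega>) $ i) (normal_density 0 (sqrt (t - s)))"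
    and ind: "indep_vars (\<lambda>_. borel) (\<lambda>i \<omega>. (W t \<omega> - W s \<omega>) $ i) UNIV" for i
    using W st by (auto simp: wiener_process_def)
  have pos: "0 < sqrt (t - s)" using st by simp
  show int: "integrable M (\<lambda>\<omega>. (W t \<omega> - W s \<omega>) $ i)" for i
    using distributed_integrable[OF normal[of i], of "\<lambda>x. x"] integrable_normal_moment[OF pos, of 0 1] by simp
  show mean: "expectation (\<lambda>\<omega>. (W t \<omega> - W s \<omega>) $ i) = 0" for i
    by (rule normal_distributed_expectation[OF pos normal])
  show "integrable M (\<lambda>\<omega>. (W t \<omega> - W s \<omega>) $ i * (W t \<omega> - W s \<omega>) $ j)"
    and "expectation (\<lambda>\<omega>. (W t \<omega> - W s \<omega>) $ i * (W t \<omega> - W s \<omega>) $ j) = (if i = j then t - s else 0)"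
  proof (atomize (full), cases "i = j")
    case True
    show "integrable M (\<lambda>\<omega>. (W t \<omega> - W s \<omega>) $ i * (W t \<omega> - W s \<omega>) $ j) \<and>
      expectation (\<lambda>\<omega>. (W t \<omega> - W s \<omega>) $ i * (W t \<omega> - W s \<omega>) $ j) = (if i = j then t - s else 0)"
      using distributed_integrable[OF normal[of i], of "\<lambda>x. x\<^sup>2"] integrable_normal_moment[OF pos, of 0 2]
        normal_distributed_variance[OF pos normal[of i]] st
      unfolding mean True by (simp add: power2_eq_square)
  next
    case False
    have "indep_var borel (\<lambda>\<omega>. (W t \<omega> - W s \<omega>) $ i) borel (\<lambda>\<omega>. (W t \<omega> - W s \<omega>) $ j)"
      using indep_vars_prod[of "{j}" i "\<lambda>i \<omega>. (W t \<omega> - W s \<omega>) $ i"] indep_vars_subset[OF ind, of "{i, j}"] False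
      by simp
    from indep_var_integrable[OF this int int] indep_var_lebesgue_integral[OF this int int]
    show "integrable M (\<lambda>\<omega>. (W t \<omega> - W s \<omega>) $ i * (W t \<omega> - W s \<omega>) $ j) \<and>
      expectation (\<lambda>\<omega>. (W t \<omega> - W s \<omega>) $ i * (W t \<omega> - W s \<omega>) $ j) = (if i = j then t - s else 0)"
      using False mean by simp
  qed
qed

lemma indep_var_if_indep_set:
  assumes "indep_set G H" and sets: "sets N1 \<subseteq> G" "sets N2 \<subseteq> H" and sp: "space N1 = space M" "space N2 = space M"
    and X: "X \<in> measurable N1 S1" and Y: "Y \<in> measurable N2 S2"
  shows "indep_var S1 X S2 Y"
proof -
  have G: "sets N1 \<subseteq> events" "sets N2 \<subseteq> events"
    using indep_setD_ev1[OF assms(1)] indep_setD_ev2[OF assms(1)] sets by auto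
  have "sigma_sets (space M) {X -` A \<inter> space M |A. A \<in> sets S1} \<subseteq> sets N1"
    using X sp by (intro sets.sigma_sets_subset[of _ N1, unfolded sp]) (auto simp: measurable_def)
  moreover have "sigma_sets (space M) {Y -` A \<inter> space M |A. A \<in> sets S2} \<subseteq> sets N2"
    using Y sp by (intro sets.sigma_sets_subset[of _ N2, unfolded sp]) (auto simp: measurable_def)
  ultimately have "indep_set (sigma_sets (space M) {X -` A \<inter> space M |A. A \<in> sets S1})
      (sigma_sets (space M) {Y -` A \<inter> space M |A. A \<in> sets S2})"
    using assms(1) sets unfolding indep_set_def
    by (elim indep_sets_mono_sets) (auto split: bool.split)
  moreover have "X \<in> measurable M S1" "Y \<in> measurable M S2"
    using X Y G sp by (auto simp: measurable_def)
  ultimately show ?thesis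
    unfolding indep_var_eq by simp
qed

text \<open>The stacked increment must be independent of the joint information, while the Wiener
  property relates each process only to its own past. Each path is therefore split at s into past
  and increment: the Wiener property factorises within one process, the joint hypothesis factorises
  across the processes and initial values.\<close>

lemma filtered_wiener_join:
  fixes Wa :: "real \<Rightarrow> 'a \<Rightarrow> real ^ 'da::finite" and Wb :: "real \<Rightarrow> 'a \<Rightarrow> real ^ 'db::finite"
    and eta_a :: "'a \<Rightarrow> 'u::topological_space" and eta_b :: "'a \<Rightarrow> 'v::topological_space"
  assumes T: "0 < T" and Wa: "wiener_process M T Wa" and Wb: "wiener_process M T Wb"
    and eta: "eta_a \<in> borel_measurable M" "eta_b \<in> borel_measurable M"
    and indep: "indep_sets (\<lambda>k. [path_events M Wa T, path_events M Wb T,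
            events_of M eta_a, events_of M eta_b, events_of M eta_1] ! k) {..<5}"
  shows "filtered_wiener M (join_filtration M (history M eta_a Wa) (history M eta_b Wb)) T (\<lambda>t \<omega>. Wa t \<omega> === Wb t \<omega>)"
proof -
  define Fa Fb where "Fa = history M eta_a Wa" and "Fb = history M eta_b Wb"
  define F where "F = join_filtration M Fa Fb"
  have space_F: "space (F t) = space M" for t
    by (simp add: F_def Fa_def Fb_def)
  have sets_F: "sets (F t) = sigma_sets (space M) (sets (Fa t) \<union> sets (Fb t))" for t
    unfolding F_def by (rule sets_join_filtration) (simp_all add: Fa_def Fb_def)
  have Wa_meas: "Wa t \<in> borel_measurable M" and Wb_meas: "Wb t \<in> borel_measurable M" if "t \<in> {0..T}" for t
    using Wa Wb that by (auto simp: wiener_process_def)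
  have sub: "sets (Fa t) \<subseteq> sets M" "sets (Fb t) \<subseteq> sets M" if "t \<in> {0..T}" for t
  proof -
    show "sets (Fa t) \<subseteq> sets M"
      unfolding Fa_def sets_history using eta Wa_meas that
      by (intro sets.sigma_sets_subset Un_least UN_least) (auto simp: events_of_subset_iff)
    show "sets (Fb t) \<subseteq> sets M"
      unfolding Fb_def sets_history using eta Wb_meas that
      by (intro sets.sigma_sets_subset Un_least UN_least) (auto simp: events_of_subset_iff)
  qed
  have sub_F: "sets (Fa t) \<subseteq> sets (F t)" "sets (Fb t) \<subseteq> sets (F t)" for t
    unfolding sets_F by auto
  have W_meas: "(\<lambda>\<omega>. Wa t \<omega> === Wb t \<omega>) \<in> borel_measurable (F t)" if "t \<in> {0..T}" for t
  proof (rule borel_measurable_vcat)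
    have "events_of M (Wa t) \<subseteq> sets (Fa t)" "events_of M (Wb t) \<subseteq> sets (Fb t)"
      unfolding Fa_def Fb_def sets_history using that
      by (intro subset_trans[OF _ sigma_sets_superset_generator] le_supI2 UN_upper; simp)+
    then have "events_of M (Wa t) \<subseteq> sets (F t)" "events_of M (Wb t) \<subseteq> sets (F t)"
      using sub_F by (meson order_trans)+
    then show "Wa t \<in> borel_measurable (F t)" "Wb t \<in> borel_measurable (F t)"
      by (simp_all only: events_of_subset_iff[OF space_F])
  qed
  have indep_inc: "indep_set (sets (F s)) (sigma_sets (space M)
      (events_of M (\<lambda>\<omega>. Wa t \<omega> - Wa s \<omega>) \<union> events_of M (\<lambda>\<omega>. Wb t \<omega> - Wb s \<omega>)))"
    if st: "0 \<le> s" "s < t" "t \<le> T" for s t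
  proof -
    define da db where "da = events_of M (\<lambda>\<omega>. Wa t \<omega> - Wa s \<omega>)" and "db = events_of M (\<lambda>\<omega>. Wb t \<omega> - Wb s \<omega>)"
    \<comment> \<open>Indices 0 to 3 generate the information at time s; 4 and 5 are the increments
      of the two processes.\<close>
    define E where "E k = [path_events M Wa s, path_events M Wb s, events_of M eta_a, events_of M eta_b, da, db] ! k" for k
    have less_6: "{..<6} = {0, 1, 2, 3, 4, 5::nat}"
      and less_5: "{..<5} = {0, 1, 2, 3, 4::nat}" by auto
    have E_simps [simp]: "E 0 = path_events M Wa s" "E (Suc 0) = path_events M Wb s" "E 2 = events_of M eta_a"
      "E 3 = events_of M eta_b" "E 4 = da" "E 5 = db"
      by (simp_all add: E_def numeral_eq_Suc)
    have incr: "da \<subseteq> path_events M Wa T" "db \<subseteq> path_events M Wb T"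
      unfolding da_def db_def using st by (simp_all add: events_of_increment_path_events)
    have past: "path_events M Wa s \<subseteq> path_events M Wa T" "path_events M Wb s \<subseteq> path_events M Wb T"
      using st by (simp_all add: path_events_mono)
    have ev: "path_events M Wa T \<subseteq> events" "path_events M Wb T \<subseteq> events" "events_of M eta_a \<subseteq> events" "events_of M eta_b \<subseteq> events"
      using indep unfolding indep_sets_def less_5 by simp_all
    have "indep_sets E {..<6}"
    proof (subst indep_sets_finite)
      show "E i \<subseteq> events" if "i \<in> {..<6}" for i
        using that ev incr past unfolding less_6 by auto
      show "space M \<in> E i" if "i \<in> {..<6}" for i
        using that unfolding less_6 by (auto simp: da_def db_def space_in_path_events space_in_events_of)
      show "\<forall>A\<in>Pi {..<6} E. prob (\<Inter>j\<in>{..<6}. A j) = (\<Prod>j\<in>{..<6}. prob (A j))"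
      proof
        fix A assume "A \<in> Pi {..<6} E"
        then have A: "A 0 \<in> path_events M Wa s" "A 1 \<in> path_events M Wb s" "A 2 \<in> events_of M eta_a"
          "A 3 \<in> events_of M eta_b" "A 4 \<in> da" "A 5 \<in> db"
          unfolding less_6 by auto
        \<comment> \<open>A past event and an increment event of the same process merge into one
          path event up to \<open>T\<close>. The joint hypothesis then applies to four factors, and
          the merged ones are split afterwards.\<close>
        have in_path: "A 0 \<inter> A 4 \<in> path_events M Wa T" "A 1 \<inter> A 5 \<in> path_events M Wb T"
          using A incr past by (auto intro!: path_events_Int)
        have "prob (\<Inter>j\<in>{..<4}. [A 0 \<inter> A 4, A 1 \<inter> A 5, A 2, A 3] ! j) = (\<Prod>j\<in>{..<4}. prob ([A 0 \<inter> A 4, A 1 \<inter> A 5, A 2, A 3] ! j))"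
          by (rule indep_setsD[OF indep]) (use A in_path in \<open>auto simp: numeral_eq_Suc less_Suc_eq\<close>)
        then have "prob (A 0 \<inter> A 4 \<inter> (A 1 \<inter> A 5) \<inter> A 2 \<inter> A 3) = prob (A 0 \<inter> A 4) * prob (A 1 \<inter> A 5) * prob (A 2) * prob (A 3)"
          by (simp add: numeral_eq_Suc lessThan_Suc Int_ac mult_ac)
        moreover have "prob (A 0 \<inter> A 4) = prob (A 0) * prob (A 4)"
          by (rule indep_setD[where A = "path_events M Wa s" and B = da])
             (use Wa st A in \<open>auto simp: wiener_process_def da_def\<close>)
        moreover have "prob (A 1 \<inter> A 5) = prob (A 1) * prob (A 5)"
          by (rule indep_setD[where A = "path_events M Wb s" and B = db])
             (use Wb st A in \<open>auto simp: wiener_process_def db_def\<close>)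
        moreover have "(\<Inter>j\<in>{..<6}. A j) = A 0 \<inter> A 4 \<inter> (A 1 \<inter> A 5) \<inter> A 2 \<inter> A 3"
          unfolding less_6 by auto
        ultimately show "prob (\<Inter>j\<in>{..<6}. A j) = (\<Prod>j\<in>{..<6}. prob (A j))"
          unfolding less_6 by simp
      qed
    qed (auto simp: less_6)
    \<comment> \<open>Past against increments. All six families are closed under intersection, so
      independence passes to the \<sigma>-algebras generated by the two groups.\<close>
    then have "indep_sets E (\<Union>j\<in>UNIV. case_bool {0, 1, 2, 3} {4, 5} j)"
      by (rule indep_sets_mono_index[rotated]) (auto split: bool.split_asm)
    moreover have "Int_stable (E i)" if "i \<in> case_bool {0, 1, 2, 3} {4, 5} j" for i j
      using that by (auto split: bool.split_asm simp: Int_stable_events_of Int_stable_path_events da_def db_def)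
    moreover have "disjoint_family_on (case_bool {0, 1, 2, 3} {4, 5::nat}) UNIV"
      by (auto simp: disjoint_family_on_def split: bool.splits)
    ultimately have "indep_sets (\<lambda>j. sigma_sets (space M) (\<Union>i\<in>case_bool {0, 1, 2, 3} {4, 5} j. E i)) UNIV"
      by (rule indep_sets_collect_sigma)
    then show ?thesis
      unfolding indep_set_def
    proof (rule indep_sets_mono_sets)
      have "sets (F s) \<subseteq> sigma_sets (space M) (\<Union>i\<in>{0, 1, 2, 3}. E i)"
      proof -
        let ?G = "sigma_sets (space M) (\<Union>i\<in>{0, 1, 2, 3}. E i)"
        have "sets (Fa s) \<subseteq> ?G" unfolding Fa_def sets_history
          by (intro sigma_sets_mono subset_trans[OF _ sigma_sets_superset_generator])
             (auto simp: path_events_def intro: sigma_sets.Basic)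
        moreover have "sets (Fb s) \<subseteq> ?G" unfolding Fb_def sets_history
          by (intro sigma_sets_mono subset_trans[OF _ sigma_sets_superset_generator])
             (auto simp: path_events_def intro: sigma_sets.Basic)
        ultimately show ?thesis
          unfolding sets_F by (intro sigma_sets_mono) auto
      qed
      then show "case_bool (sets (F s)) (sigma_sets (space M)
      (events_of M (\<lambda>\<omega>. Wa t \<omega> - Wa s \<omega>) \<union> events_of M (\<lambda>\<omega>. Wb t \<omega> - Wb s \<omega>))) i
         \<subseteq> sigma_sets (space M) (\<Union>i\<in>case_bool {0, 1, 2, 3} {4, 5} i. E i)" for i
        by (auto split: bool.split simp: da_def[symmetric] db_def[symmetric])
    qed
  qed
  \<comment> \<open>This serves the mixed second moments: increments of different processes are
    uncorrelated because the whole paths are independent and the increments have mean zero.\<close>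
  have indep_ab: "indep_set (path_events M Wa T) (path_events M Wb T)"
  proof (rule indep_setI)
    have less_5: "{..<5} = {0, 1, 2, 3, 4::nat}" by auto
    show "path_events M Wa T \<subseteq> events" "path_events M Wb T \<subseteq> events"
      using indep unfolding indep_sets_def less_5 by simp_all
    fix a b assume "a \<in> path_events M Wa T" "b \<in> path_events M Wb T"
    then have "prob (\<Inter>j\<in>{0, 1}. [a, b] ! j) = (\<Prod>j\<in>{0, 1}. prob ([a, b] ! j))"
      by (intro indep_setsD[OF indep]) auto
    then show "prob (a \<inter> b) = prob a * prob b"
      by simp
  qed
  show ?thesis
    unfolding Fa_def[symmetric] Fb_def[symmetric] F_def[symmetric]
  proof unfold_locales
    show "0 < T" by fact
    show "space (F t) = space M" for t by (rule space_F)
    show "sets (F s) \<subseteq> sets (F t)" if "s \<le> t" for s t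
      unfolding sets_F Fa_def Fb_def by (intro sigma_sets_mono' Un_mono history_mono that)
    show "sets (F t) \<subseteq> sets M" if "t \<in> {0..T}" for t
      unfolding sets_F by (intro sets.sigma_sets_subset Un_least sub that)
    show "(\<lambda>\<omega>. Wa t \<omega> === Wb t \<omega>) \<in> borel_measurable (F t)" if "t \<in> {0..T}" for t
      by (rule W_meas[OF that])
    show "continuous_on {0..T} (\<lambda>t. Wa t \<omega> === Wb t \<omega>)" if "\<omega> \<in> space M" for \<omega>
      using Wa Wb that by (auto simp: wiener_process_def intro: continuous_on_vcat)
    fix s t :: real assume st: "0 \<le> s" "s < t" "t \<le> T"
    have da: "(\<lambda>\<omega>. Wa t \<omega> - Wa s \<omega>) \<in> borel_measurable M" and db: "(\<lambda>\<omega>. Wb t \<omega> - Wb s \<omega>) \<in> borel_measurable M"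
      using Wa_meas[of t] Wa_meas[of s] Wb_meas[of t] Wb_meas[of s] st by simp_all
    show "indep_var borel X borel (\<lambda>\<omega>. Y ((Wa t \<omega> === Wb t \<omega>) - (Wa s \<omega> === Wb s \<omega>)))"
      if X: "X \<in> borel_measurable (F s)" and Y: "Y \<in> borel_measurable borel"
      for X :: "'a \<Rightarrow> real" and Y :: "real ^ ('da + 'db) \<Rightarrow> real"
    proof -
      define G where "G = events_of M (\<lambda>\<omega>. Wa t \<omega> - Wa s \<omega>) \<union> events_of M (\<lambda>\<omega>. Wb t \<omega> - Wb s \<omega>)"
      define N where "N = sigma (space M) G"
      have "G \<subseteq> Pow (space M)" by (auto simp: G_def events_of_def)
      then have N: "space N = space M" "sets N = sigma_sets (space M) G"
        by (simp_all add: N_def)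
      have "(\<lambda>\<omega>. Wa t \<omega> - Wa s \<omega>) \<in> borel_measurable N" "(\<lambda>\<omega>. Wb t \<omega> - Wb s \<omega>) \<in> borel_measurable N"
        unfolding events_of_subset_iff[OF N(1), symmetric] N(2) by (auto simp: G_def)
      then have "(\<lambda>\<omega>. (Wa t \<omega> === Wb t \<omega>) - (Wa s \<omega> === Wb s \<omega>)) \<in> borel_measurable N"
        unfolding vcat_diff by (rule borel_measurable_vcat)
      then have "(\<lambda>\<omega>. Y ((Wa t \<omega> === Wb t \<omega>) - (Wa s \<omega> === Wb s \<omega>))) \<in> borel_measurable N"
        using Y by simp
      then show ?thesis
        using indep_var_if_indep_set[OF indep_inc[OF st] order_refl, of N X borel] X space_F[of s] N
        by (auto simp: G_def)
    qed
    show "integrable M (\<lambda>\<omega>. ((Wa t \<omega> === Wb t \<omega>) - (Wa s \<omega> === Wb s \<omega>)) $ i) \<and>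
        expectation (\<lambda>\<omega>. ((Wa t \<omega> === Wb t \<omega>) - (Wa s \<omega> === Wb s \<omega>)) $ i) = 0" for i
      unfolding vcat_diff using wiener_increment_moments(1,2)[OF Wa st] wiener_increment_moments(1,2)[OF Wb st]
      by (cases i) simp_all
    have cross: "integrable M (\<lambda>\<omega>. (Wa t \<omega> - Wa s \<omega>) $ i * (Wb t \<omega> - Wb s \<omega>) $ j)"
        "expectation (\<lambda>\<omega>. (Wa t \<omega> - Wa s \<omega>) $ i * (Wb t \<omega> - Wb s \<omega>) $ j) = 0" for i j
    proof -
      have path: "space (sigma (space M) (path_events M V T)) = space M"
        "(\<lambda>\<omega>. V t \<omega> - V s \<omega>) \<in> borel_measurable (sigma (space M) (path_events M V T))"
        "sets (sigma (space M) (path_events M V T)) = path_events M V T" for V :: "real \<Rightarrow> 'a \<Rightarrow> real ^ 'k"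
      proof -
        have "path_events M V T \<subseteq> Pow (space M)"
          using sigma_sets_into_sp[OF path_events_generators, of _ M V T] by (auto simp: path_events_def)
        then show space: "space (sigma (space M) (path_events M V T)) = space M"
          and sets: "sets (sigma (space M) (path_events M V T)) = path_events M V T"
          by (simp_all add: sigma_algebra.sigma_sets_eq[OF sigma_algebra_path_events])
        show "(\<lambda>\<omega>. V t \<omega> - V s \<omega>) \<in> borel_measurable (sigma (space M) (path_events M V T))"
          using events_of_increment_path_events[of s t T M V] st sets
          by (subst events_of_subset_iff[OF space, symmetric]) auto
      qed
      have "indep_var borel (\<lambda>\<omega>. (Wa t \<omega> - Wa s \<omega>) $ i) borel (\<lambda>\<omega>. (Wb t \<omega> - Wb s \<omega>) $ j)"
        by (rule indep_var_if_indep_set[OF indep_ab, where ?N1.0 = "sigma (space M) (path_events M Wa T)"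
              and ?N2.0 = "sigma (space M) (path_events M Wb T)"])
           (rule borel_measurable_vec_nth[OF path(2)] | simp add: path)+
      from indep_var_integrable[OF this wiener_increment_moments(1)[OF Wa st] wiener_increment_moments(1)[OF Wb st]]
        indep_var_lebesgue_integral[OF this wiener_increment_moments(1)[OF Wa st] wiener_increment_moments(1)[OF Wb st]]
      show "integrable M (\<lambda>\<omega>. (Wa t \<omega> - Wa s \<omega>) $ i * (Wb t \<omega> - Wb s \<omega>) $ j)"
        "expectation (\<lambda>\<omega>. (Wa t \<omega> - Wa s \<omega>) $ i * (Wb t \<omega> - Wb s \<omega>) $ j) = 0"
        using wiener_increment_moments(2)[OF Wa st] by simp_all
    qed
    have cross': "integrable M (\<lambda>\<omega>. (Wb t \<omega> - Wb s \<omega>) $ j * (Wa t \<omega> - Wa s \<omega>) $ i)"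
        "expectation (\<lambda>\<omega>. (Wb t \<omega> - Wb s \<omega>) $ j * (Wa t \<omega> - Wa s \<omega>) $ i) = 0" for i j
      using cross[of i j] by (simp_all only: mult.commute)
    show "integrable M (\<lambda>\<omega>. ((Wa t \<omega> === Wb t \<omega>) - (Wa s \<omega> === Wb s \<omega>)) $ i * ((Wa t \<omega> === Wb t \<omega>) - (Wa s \<omega> === Wb s \<omega>)) $ j) \<and>
        expectation (\<lambda>\<omega>. ((Wa t \<omega> === Wb t \<omega>) - (Wa s \<omega> === Wb s \<omega>)) $ i * ((Wa t \<omega> === Wb t \<omega>) - (Wa s \<omega> === Wb s \<omega>)) $ j)
          = (if i = j then t - s else 0)" for i j
      unfolding vcat_diff
      using wiener_increment_moments(3,4)[OF Wa st] wiener_increment_moments(3,4)[OF Wb st] cross cross'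
      by (cases i; cases j) simp_all
  qed
qed

end

section \<open>Joint measurability and square-integrable integrals\<close>

lemma norm_add_power2_le: "(norm (a + b))\<^sup>2 \<le> 2 * (norm a)\<^sup>2 + 2 * (norm (b :: 'v::real_normed_vector))\<^sup>2"
proof -
  have "(norm (a + b))\<^sup>2 \<le> (norm a + norm b)\<^sup>2"
    by (intro power_mono norm_triangle_ineq) simp
  also have "\<dots> \<le> 2 * (norm a)\<^sup>2 + 2 * (norm b)\<^sup>2"
    using sum_squares_bound[of "norm a" "norm b"] by (simp add: power2_sum)
  finally show ?thesis .
qed

lemma nn_integral_norm_add_power2_le:
  fixes f g :: "'x \<Rightarrow> 'v::{real_normed_vector, second_countable_topology}"
  assumes [measurable]: "f \<in> borel_measurable N" "g \<in> borel_measurable N"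
  shows "(\<integral>\<^sup>+x. ennreal ((norm (f x + g x))\<^sup>2) \<partial>N) \<le>
    2 * (\<integral>\<^sup>+x. ennreal ((norm (f x))\<^sup>2) \<partial>N) + 2 * (\<integral>\<^sup>+x. ennreal ((norm (g x))\<^sup>2) \<partial>N)"
proof -
  have "(\<integral>\<^sup>+x. ennreal ((norm (f x + g x))\<^sup>2) \<partial>N) \<le> (\<integral>\<^sup>+x. 2 * ennreal ((norm (f x))\<^sup>2) + 2 * ennreal ((norm (g x))\<^sup>2) \<partial>N)"
  proof (intro nn_integral_mono)
    fix x
    have "ennreal ((norm (f x + g x))\<^sup>2) \<le> ennreal (2 * (norm (f x))\<^sup>2 + 2 * (norm (g x))\<^sup>2)"
      by (intro ennreal_leI norm_add_power2_le)
    then show "ennreal ((norm (f x + g x))\<^sup>2) \<le> 2 * ennreal ((norm (f x))\<^sup>2) + 2 * ennreal ((norm (g x))\<^sup>2)"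
      by (simp add: ennreal_plus ennreal_mult)
  qed
  also have "\<dots> = 2 * (\<integral>\<^sup>+x. ennreal ((norm (f x))\<^sup>2) \<partial>N) + 2 * (\<integral>\<^sup>+x. ennreal ((norm (g x))\<^sup>2) \<partial>N)"
    by (simp add: nn_integral_add nn_integral_cmult)
  finally show ?thesis .
qed

text \<open>The triangle inequality for squared L2 distances, through an intermediate function
  \<open>g\<close>. With values in \<open>ennreal\<close> it holds before any integrability is
  known, and it carries the limit arguments below.\<close>

lemma nn_integral_norm_diff_power2_le:
  fixes f g h :: "'x \<Rightarrow> 'v::{real_normed_vector, second_countable_topology}"
  assumes [measurable]: "f \<in> borel_measurable N" "g \<in> borel_measurable N" "h \<in> borel_measurable N"
  shows "(\<integral>\<^sup>+x. ennreal ((norm (f x - h x))\<^sup>2) \<partial>N) \<le>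
    2 * (\<integral>\<^sup>+x. ennreal ((norm (f x - g x))\<^sup>2) \<partial>N) + 2 * (\<integral>\<^sup>+x. ennreal ((norm (h x - g x))\<^sup>2) \<partial>N)"
proof -
  have "norm (h x - g x) = norm (g x - h x)" and "f x - h x = (f x - g x) + (g x - h x)" for x
    by (simp_all add: norm_minus_commute)
  then show ?thesis
    using nn_integral_norm_add_power2_le[of "\<lambda>x. f x - g x" N "\<lambda>x. g x - h x"] by simp
qed

lemma fst_measurable_time [measurable]: "fst \<in> borel_measurable (restrict_space lborel S \<Otimes>\<^sub>M N)"
proof -
  have "(\<lambda>x. x) \<in> borel_measurable (restrict_space lborel S)"
    by (intro measurable_restrict_space1) simp
  from measurable_compose[OF measurable_fst this] show ?thesis .
qed

text \<open>Rounding t down to a grid makes the process a countable composition of measurable maps.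
  By continuity of the paths these approximations converge pointwise to the process as the mesh
  tends to 0.\<close>

lemma continuous_paths_jointly_measurable:
  fixes h :: "real \<Rightarrow> 'w \<Rightarrow> 'v::metric_space"
  assumes ab: "a \<le> b" and meas: "\<And>t. t \<in> {a..b} \<Longrightarrow> h t \<in> borel_measurable N"
    and cont: "\<And>\<omega>. \<omega> \<in> space N \<Longrightarrow> continuous_on {a..b} (\<lambda>t. h t \<omega>)"
  shows "(\<lambda>(t, \<omega>). h t \<omega>) \<in> borel_measurable (restrict_space lborel {a..b} \<Otimes>\<^sub>M N)"
proof -
  \<comment> \<open>Grid points of mesh 1 / (n + 1), clamped to [a, b], where \<open>h\<close> is
    measurable and continuous.\<close>
  define r where "r n i = max a (min b (of_int i / real (Suc n)))" for n :: nat and i :: int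
  have r: "r n i \<in> {a..b}" for n i
    using ab by (auto simp: r_def)
  define f where "f n z = h (r n \<lfloor>real (Suc n) * fst z\<rfloor>) (snd z)" for n and z :: "real \<times> 'w"
  have "f n \<in> borel_measurable (restrict_space lborel {a..b} \<Otimes>\<^sub>M N)" for n
    unfolding f_def
  proof (rule measurable_compose_countable[where g = "\<lambda>z. \<lfloor>real (Suc n) * fst z\<rfloor>"])
    show "(\<lambda>z. h (r n i) (snd z)) \<in> borel_measurable (restrict_space lborel {a..b} \<Otimes>\<^sub>M N)" for i
      by (rule measurable_compose[OF measurable_snd meas[OF r]])
    have "(\<lambda>z. real (Suc n) * fst z) \<in> borel_measurable (restrict_space lborel {a..b} \<Otimes>\<^sub>M N)"
      by measurable
    then show "(\<lambda>z. \<lfloor>real (Suc n) * fst z\<rfloor>) \<in> (restrict_space lborel {a..b} \<Otimes>\<^sub>M N) \<rightarrow>\<^sub>M count_space UNIV"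
      by measurable
  qed
  moreover have "(\<lambda>n. f n z) \<longlonglongrightarrow> (\<lambda>(t, \<omega>). h t \<omega>) z" if z: "z \<in> space (restrict_space lborel {a..b} \<Otimes>\<^sub>M N)" for z
  proof -
    obtain t \<omega> where z_eq: "z = (t, \<omega>)" and t: "t \<in> {a..b}" and \<omega>: "\<omega> \<in> space N"
      using z by (auto simp: space_pair_measure space_restrict_space)
    have bound: "\<bar>r n \<lfloor>real (Suc n) * t\<rfloor> - t\<bar> \<le> 1 / real (Suc n)" for n
    proof -
      have "of_int \<lfloor>real (Suc n) * t\<rfloor> / real (Suc n) \<le> t"
        by (simp add: field_simps flip: of_nat_Suc)
      moreover have "t \<le> of_int \<lfloor>real (Suc n) * t\<rfloor> / real (Suc n) + 1 / real (Suc n)"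
        using real_of_int_floor_add_one_ge[of "real (Suc n) * t"]
        by (simp add: field_simps del: of_nat_Suc)
      ultimately show ?thesis
        using t by (auto simp: r_def)
    qed
    have "(\<lambda>n. r n \<lfloor>real (Suc n) * t\<rfloor>) \<longlonglongrightarrow> t"
    proof (rule LIM_zero_cancel, rule Lim_null_comparison)
      show "\<forall>\<^sub>F n in sequentially. norm (r n \<lfloor>real (Suc n) * t\<rfloor> - t) \<le> 1 / real (Suc n)"
        using bound by simp
      show "(\<lambda>n. 1 / real (Suc n)) \<longlonglongrightarrow> 0"
        by (rule LIMSEQ_Suc) (rule lim_1_over_n)
    qed
    then have "(\<lambda>n. h (r n \<lfloor>real (Suc n) * t\<rfloor>) \<omega>) \<longlonglongrightarrow> h t \<omega>"
      using cont[OF \<omega>] r t unfolding continuous_on_sequentially by (auto simp: o_def)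
    then show ?thesis
      by (simp add: f_def z_eq)
  qed
  ultimately show ?thesis
    by (rule borel_measurable_LIMSEQ_metric)
qed

section \<open>Time integrals of random functions in L2\<close>

lemma set_integral_eq_restrict_space:
  fixes h :: "real \<Rightarrow> 'v::{banach, second_countable_topology}"
  shows "(LINT s:{a..b}|lborel. h s) = (\<integral>s. h s \<partial>restrict_space lborel {a..b})"
  unfolding set_lebesgue_integral_def by (rule integral_restrict_space[symmetric]) simp

lemma borel_measurable_set_integral_paths:
  fixes h :: "real \<Rightarrow> 'w \<Rightarrow> 'v::euclidean_space"
  assumes "(\<lambda>(t, \<omega>). h t \<omega>) \<in> borel_measurable (restrict_space lborel {a..b} \<Otimes>\<^sub>M N)"
  shows "(\<lambda>\<omega>. LINT s:{a..b}|lborel. h s \<omega>) \<in> borel_measurable N"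
proof -
  interpret sigma_finite_measure "restrict_space lborel {a..b}"
    by (rule sigma_finite_measure_restrict_space) (auto intro: sigma_finite_lborel)
  show ?thesis
    unfolding set_integral_eq_restrict_space
    using measurable_pair_swap[OF assms] by (intro borel_measurable_lebesgue_integral) simp
qed

text \<open>Cauchy-Schwarz against the constant 1. For a nonintegrable \<open>h\<close> the Bochner
  integral is 0 by default and the bound holds trivially.\<close>

lemma norm_set_integral_power2_le:
  fixes h :: "real \<Rightarrow> 'v::euclidean_space"
  assumes "a \<le> b" and [measurable]: "h \<in> borel_measurable (restrict_space lborel {a..b})"
  shows "ennreal ((norm (LINT s:{a..b}|lborel. h s))\<^sup>2) \<le>
    ennreal (b - a) * (\<integral>\<^sup>+s. ennreal ((norm (h s))\<^sup>2) \<partial>restrict_space lborel {a..b})"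
proof -
  let ?R = "restrict_space lborel {a..b}"
  have "ennreal (norm (\<integral>s. h s \<partial>?R)) \<le> (\<integral>\<^sup>+s. ennreal (norm (h s)) \<partial>?R)"
    by (cases "integrable ?R h") (auto simp: integral_norm_bound_ennreal not_integrable_integral_eq)
  then have "(ennreal (norm (\<integral>s. h s \<partial>?R)))\<^sup>2 \<le> (\<integral>\<^sup>+s. 1 * ennreal (norm (h s)) \<partial>?R)\<^sup>2"
    by (simp add: power_mono)
  also have "\<dots> \<le> (\<integral>\<^sup>+s. 1\<^sup>2 \<partial>?R) * (\<integral>\<^sup>+s. (ennreal (norm (h s)))\<^sup>2 \<partial>?R)"
    by (rule Cauchy_Schwarz_nn_integral) measurable
  also have "(\<integral>\<^sup>+s. 1\<^sup>2 \<partial>?R) = ennreal (b - a)"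
    using assms by (simp add: emeasure_restrict_space space_restrict_space)
  finally show ?thesis
    unfolding set_integral_eq_restrict_space by (simp add: ennreal_power)
qed

lemma (in prob_space) nn_integral_time_prod:
  "f \<in> borel_measurable (restrict_space lborel S \<Otimes>\<^sub>M M) \<Longrightarrow>
    (\<integral>\<^sup>+z. f z \<partial>(restrict_space lborel S \<Otimes>\<^sub>M M)) = (\<integral>\<^sup>+s. \<integral>\<^sup>+\<omega>. f (s, \<omega>) \<partial>M \<partial>restrict_space lborel S)"
  by (rule nn_integral_fst[symmetric])

lemma (in prob_space) nn_integral_set_integral_power2_le:
  fixes h :: "real \<Rightarrow> 'a \<Rightarrow> 'v::euclidean_space"
  assumes ab: "a \<le> b" and h [measurable]: "(\<lambda>(t, \<omega>). h t \<omega>) \<in> borel_measurable (restrict_space lborel {a..b} \<Otimes>\<^sub>M M)"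
  shows "(\<integral>\<^sup>+\<omega>. ennreal ((norm (LINT s:{a..b}|lborel. h s \<omega>))\<^sup>2) \<partial>M) \<le>
    ennreal (b - a) * (\<integral>\<^sup>+s. \<integral>\<^sup>+\<omega>. ennreal ((norm (h s \<omega>))\<^sup>2) \<partial>M \<partial>restrict_space lborel {a..b})"
proof -
  let ?R = "restrict_space lborel {a..b}"
  interpret R: sigma_finite_measure ?R
    by (rule sigma_finite_measure_restrict_space) (auto intro: sigma_finite_lborel)
  interpret pair_sigma_finite ?R M ..
  have sections: "(\<lambda>t. h t \<omega>) \<in> borel_measurable ?R" if "\<omega> \<in> space M" for \<omega>
    using measurable_compose[OF measurable_Pair2'[OF that] h] by simp
  have "(\<integral>\<^sup>+\<omega>. ennreal ((norm (LINT s:{a..b}|lborel. h s \<omega>))\<^sup>2) \<partial>M) \<le>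
      (\<integral>\<^sup>+\<omega>. ennreal (b - a) * (\<integral>\<^sup>+s. ennreal ((norm (h s \<omega>))\<^sup>2) \<partial>?R) \<partial>M)"
    by (intro nn_integral_mono norm_set_integral_power2_le ab sections)
  also have "\<dots> = ennreal (b - a) * (\<integral>\<^sup>+\<omega>. \<integral>\<^sup>+s. ennreal ((norm (h s \<omega>))\<^sup>2) \<partial>?R \<partial>M)"
    by (intro nn_integral_cmult R.borel_measurable_nn_integral) measurable
  also have "(\<integral>\<^sup>+\<omega>. \<integral>\<^sup>+s. ennreal ((norm (h s \<omega>))\<^sup>2) \<partial>?R \<partial>M) = (\<integral>\<^sup>+s. \<integral>\<^sup>+\<omega>. ennreal ((norm (h s \<omega>))\<^sup>2) \<partial>M \<partial>?R)"
    using Fubini[of "\<lambda>(s, \<omega>). ennreal ((norm (h s \<omega>))\<^sup>2)"] by simp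
  finally show ?thesis .
qed

lemma (in prob_space) nn_integral_set_integral_power2_le_const:
  fixes h :: "real \<Rightarrow> 'a \<Rightarrow> 'v::euclidean_space"
  assumes ab: "a \<le> b" and h: "(\<lambda>(t, \<omega>). h t \<omega>) \<in> borel_measurable (restrict_space lborel {a..b} \<Otimes>\<^sub>M M)"
    and C: "\<And>s. s \<in> {a..b} \<Longrightarrow> (\<integral>\<^sup>+\<omega>. ennreal ((norm (h s \<omega>))\<^sup>2) \<partial>M) \<le> C"
  shows "(\<integral>\<^sup>+\<omega>. ennreal ((norm (LINT s:{a..b}|lborel. h s \<omega>))\<^sup>2) \<partial>M) \<le> ennreal ((b - a)\<^sup>2) * C"
proof -
  have "(\<integral>\<^sup>+s. \<integral>\<^sup>+\<omega>. ennreal ((norm (h s \<omega>))\<^sup>2) \<partial>M \<partial>restrict_space lborel {a..b})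
      \<le> (\<integral>\<^sup>+s. C \<partial>restrict_space lborel {a..b})"
    by (intro nn_integral_mono C) (simp add: space_restrict_space)
  also have "\<dots> = C * ennreal (b - a)"
    using ab by (simp add: emeasure_restrict_space space_restrict_space)
  finally have "ennreal (b - a) * (\<integral>\<^sup>+s. \<integral>\<^sup>+\<omega>. ennreal ((norm (h s \<omega>))\<^sup>2) \<partial>M \<partial>restrict_space lborel {a..b})
      \<le> ennreal (b - a) * (C * ennreal (b - a))"
    by (rule mult_left_mono) simp
  also have "\<dots> = ennreal ((b - a)\<^sup>2) * C"
    using ab by (simp add: power2_eq_square ennreal_mult mult_ac)
  finally show ?thesis
    using nn_integral_set_integral_power2_le[OF ab h] by (rule order_trans[rotated])
qed

section \<open>It\^o isometry\<close>

lemma norm_vec_power2: "(norm v)\<^sup>2 = (\<Sum>i\<in>UNIV. (v $ i)\<^sup>2)" for v :: "real ^ 'n"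
  by (simp only: power2_norm_eq_inner inner_vec_def) (simp add: power2_eq_square)

lemma norm_matrix_power2: "(norm X)\<^sup>2 = (\<Sum>i\<in>UNIV. \<Sum>j\<in>UNIV. (X $ i $ j)\<^sup>2)" for X :: "real ^ 'm ^ 'n"
  by (simp only: power2_norm_eq_inner inner_vec_def) (simp add: power2_eq_square)

lemma sum_power2_double: "(\<Sum>l\<in>A. \<Sum>i\<in>I. f l i)\<^sup>2 = (\<Sum>l\<in>A. \<Sum>l'\<in>A. \<Sum>i\<in>I. \<Sum>j\<in>I. f l i * f l' j)"
  for f :: "_ \<Rightarrow> _ \<Rightarrow> real"
  by (simp only: power2_eq_square sum_product)

text \<open>The length of (a, b] \<inter> (a', b']. It is both the Lebesgue integral of the product
  of the indicators and the covariance of equal components of the Wiener increments over the two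
  intervals; this coincidence is the isometry.\<close>

definition overlap :: "real \<Rightarrow> real \<Rightarrow> real \<Rightarrow> real \<Rightarrow> real" where
  "overlap a b a' b' = max 0 (min b b' - max a a')"

lemma has_bochner_integral_overlap:
  assumes "0 \<le> a" "b \<le> T" "0 \<le> a'" "b' \<le> T"
  shows "has_bochner_integral (restrict_space lborel {0..T})
    (\<lambda>s. indicator {a<..b} s * indicator {a'<..b'} s :: real) (overlap a b a' b')"
proof -
  have "has_bochner_integral lborel (indicator {max a a'<..min b b'} :: real \<Rightarrow> real) (measure lborel {max a a'<..min b b'})"
    by (rule has_bochner_integral_real_indicator)
       (auto intro: le_less_trans[OF emeasure_mono[of _ "{max a a'..min b b'}"]] simp: emeasure_lborel_Icc_eq)
  moreover have "measure lborel {max a a'<..min b b'} = overlap a b a' b'"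
  proof (cases "max a a' \<le> min b b'")
    case False
    then have "{max a a'<..min b b'} = {}" and "min b b' - max a a' \<le> 0"
      by (auto simp del: max.bounded_iff min.bounded_iff)
    then show ?thesis by (simp only: overlap_def measure_empty max_absorb1)
  qed (simp add: overlap_def)
  moreover have "indicator {max a a'<..min b b'} = (\<lambda>s. indicator {0..T} s *\<^sub>R (indicator {a<..b} s * indicator {a'<..b'} s) :: real)"
    using assms by (auto simp: indicator_def fun_eq_iff)
  ultimately show ?thesis
    by (subst has_bochner_integral_restrict_space) auto
qed

context filtered_wiener
begin

lemma F_measurable_mono:
  "X \<in> measurable (F s) N \<Longrightarrow> 0 \<le> s \<Longrightarrow> s \<le> t \<Longrightarrow> t \<le> T \<Longrightarrow> X \<in> measurable (F t) N"
  using F_mono[of s t] space_F[of s] space_F[of t] by (auto simp: measurable_def)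

lemma F_measurable_M: "X \<in> measurable (F t) N \<Longrightarrow> 0 \<le> t \<Longrightarrow> t \<le> T \<Longrightarrow> X \<in> measurable M N"
  using F_sub[of t] space_F[of t] by (auto simp: measurable_def)

lemma W_adapted': "0 \<le> s \<Longrightarrow> s \<le> t \<Longrightarrow> t \<le> T \<Longrightarrow> W s \<in> borel_measurable (F t)"
  by (rule F_measurable_mono[OF W_adapted]) auto

lemma increment_orthogonal:
  fixes X :: "'w \<Rightarrow> real"
  assumes "0 \<le> u" "u \<le> v" "v \<le> T" and X: "X \<in> borel_measurable (F u)" "integrable M X"
  shows "has_bochner_integral M (\<lambda>\<omega>. X \<omega> * (W v \<omega> - W u \<omega>) $ i) 0"
proof (cases "u = v")
  case False
  then have uv: "0 \<le> u" "u < v" "v \<le> T" using assms by auto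
  have ind: "indep_var borel X borel (\<lambda>\<omega>. (W v \<omega> - W u \<omega>) $ i)"
    by (rule W_indep[OF uv X(1)]) measurable
  note m = W_mean[OF uv, of i]
  show ?thesis
    using indep_var_integrable[OF ind X(2)] indep_var_lebesgue_integral[OF ind X(2)] m
    by (simp add: has_bochner_integral_iff)
qed (simp add: has_bochner_integral_zero)

lemma increment_covariance:
  fixes X :: "'w \<Rightarrow> real"
  assumes "0 \<le> u" "u \<le> v" "v \<le> T" and X: "X \<in> borel_measurable (F u)" "integrable M X"
  shows "has_bochner_integral M (\<lambda>\<omega>. X \<omega> * ((W v \<omega> - W u \<omega>) $ i * (W v \<omega> - W u \<omega>) $ j))
    (if i = j then expectation X * (v - u) else 0)"
proof (cases "u = v")
  case False
  then have uv: "0 \<le> u" "u < v" "v \<le> T" using assms by auto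
  have ind: "indep_var borel X borel (\<lambda>\<omega>. (W v \<omega> - W u \<omega>) $ i * (W v \<omega> - W u \<omega>) $ j)"
    by (rule W_indep[OF uv X(1)]) measurable
  note m = W_covariance[OF uv, of i j]
  show ?thesis
    using indep_var_integrable[OF ind X(2)] indep_var_lebesgue_integral[OF ind X(2)] m
    by (simp add: has_bochner_integral_iff)
qed (simp add: has_bochner_integral_zero)

text \<open>What the first interval contributes before a' is known at a' and so orthogonal to the
  second increment. After a' both intervals start at the same point; the products of their common
  part with what either has left over have mean zero, and only the square over the common part
  survives.\<close>

lemma increments_covariance_ordered:
  fixes X :: "'w \<Rightarrow> real"
  assumes ab: "0 \<le> a" "a \<le> b" "b \<le> T" and ab': "a \<le> a'" "a' \<le> b'" "b' \<le> T"
    and X: "X \<in> borel_measurable (F a')" and bound: "\<And>\<omega>. \<omega> \<in> space M \<Longrightarrow> \<bar>X \<omega>\<bar> \<le> K"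
  shows "has_bochner_integral M (\<lambda>\<omega>. X \<omega> * ((W b \<omega> - W a \<omega>) $ i * (W b' \<omega> - W a' \<omega>) $ j))
    (if i = j then expectation X * overlap a b a' b' else 0)"
proof -
  \<comment> \<open>The first interval is cut into [a, c], before a', and [a', d], after a', where
    one piece may have length 0; [a', m] is the part shared by [a', d] and [a', b'].\<close>
  define c d m where "c = min b a'" and "d = max b a'" and "m = min d b'"
  have a': "0 \<le> a'" "a' \<le> T" using ab ab' by auto
  have XM: "X \<in> borel_measurable M" using F_measurable_M[OF X] a' by simp
  have int: "integrable M (\<lambda>\<omega>. X \<omega> * (W v \<omega> - W u \<omega>) $ k)" if "0 \<le> u" "u \<le> v" "v \<le> T" for u v k
  proof (cases "u = v")
    case False
    then have incr: "integrable M (\<lambda>\<omega>. (W v \<omega> - W u \<omega>) $ k)"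
      using W_mean[of u v k] that by simp
    show ?thesis
    proof (rule Bochner_Integration.integrable_bound)
      show "integrable M (\<lambda>\<omega>. K * (W v \<omega> - W u \<omega>) $ k)"
        by (rule integrable_mult_right) (rule incr)
      show "(\<lambda>\<omega>. X \<omega> * (W v \<omega> - W u \<omega>) $ k) \<in> borel_measurable M"
        by (intro borel_measurable_times XM borel_measurable_integrable incr)
      show "AE \<omega> in M. norm (X \<omega> * (W v \<omega> - W u \<omega>) $ k) \<le> norm (K * (W v \<omega> - W u \<omega>) $ k)"
        unfolding real_norm_def abs_mult
        by (intro AE_I2 mult_right_mono order_trans[OF bound abs_ge_self] abs_ge_zero)
    qed
  qed simp
  have intX: "integrable M X"
    by (rule integrable_const_bound[where B = K]) (use XM bound in auto)
  have meas: "(\<lambda>\<omega>. X \<omega> * (W v \<omega> - W u \<omega>) $ k) \<in> borel_measurable (F w)"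
    if "0 \<le> u" "u \<le> w" "0 \<le> v" "v \<le> w" "a' \<le> w" "w \<le> T" for u v w k
    using that W_adapted'[of u w] W_adapted'[of v w] F_measurable_mono[OF X, of w] a' by measurable
  have t1: "has_bochner_integral M (\<lambda>\<omega>. (X \<omega> * (W c \<omega> - W a \<omega>) $ i) * (W b' \<omega> - W a' \<omega>) $ j) 0"
    by (rule increment_orthogonal) (use ab ab' a' in \<open>auto simp: c_def simp del: vector_minus_component intro!: meas int\<close>)
  have t2: "has_bochner_integral M (\<lambda>\<omega>. X \<omega> * ((W m \<omega> - W a' \<omega>) $ i * (W m \<omega> - W a' \<omega>) $ j))
      (if i = j then expectation X * (m - a') else 0)"
    by (rule increment_covariance) (use ab ab' a' X intX in \<open>auto simp: m_def d_def\<close>)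
  have t3: "has_bochner_integral M (\<lambda>\<omega>. (X \<omega> * (W m \<omega> - W a' \<omega>) $ i) * (W b' \<omega> - W m \<omega>) $ j) 0"
    by (rule increment_orthogonal) (use ab ab' a' in \<open>auto simp: m_def d_def simp del: vector_minus_component intro!: meas int\<close>)
  have t4: "has_bochner_integral M (\<lambda>\<omega>. (X \<omega> * (W m \<omega> - W a' \<omega>) $ j) * (W d \<omega> - W m \<omega>) $ i) 0"
    by (rule increment_orthogonal) (use ab ab' a' in \<open>auto simp: m_def d_def simp del: vector_minus_component intro!: meas int\<close>)
  \<comment> \<open>At least one of the two leftover increments beyond \<open>m\<close> is over a
    single point, so their product vanishes identically.\<close>
  have "m = d \<or> m = b'" and cd: "W c \<omega> - W a \<omega> + (W d \<omega> - W a' \<omega>) = W b \<omega> - W a \<omega>" for \<omega>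
    by (auto simp: m_def c_def d_def min_def max_def)
  then have zero: "(W d \<omega> - W m \<omega>) $ i * (W b' \<omega> - W m \<omega>) $ j = 0" for \<omega>
    by auto
  have "X \<omega> * ((W b \<omega> - W a \<omega>) $ i * (W b' \<omega> - W a' \<omega>) $ j) =
      (X \<omega> * (W c \<omega> - W a \<omega>) $ i) * (W b' \<omega> - W a' \<omega>) $ j
      + X \<omega> * ((W m \<omega> - W a' \<omega>) $ i * (W m \<omega> - W a' \<omega>) $ j)
      + (X \<omega> * (W m \<omega> - W a' \<omega>) $ i) * (W b' \<omega> - W m \<omega>) $ j
      + (X \<omega> * (W m \<omega> - W a' \<omega>) $ j) * (W d \<omega> - W m \<omega>) $ i" for \<omega>
  proof -
    have "X \<omega> * ((W d \<omega> - W a' \<omega>) $ i * (W b' \<omega> - W a' \<omega>) $ j) =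
      X \<omega> * (((W m \<omega> - W a' \<omega>) $ i + (W d \<omega> - W m \<omega>) $ i) * ((W m \<omega> - W a' \<omega>) $ j + (W b' \<omega> - W m \<omega>) $ j))"
      by simp
    also have "\<dots> = X \<omega> * ((W m \<omega> - W a' \<omega>) $ i * (W m \<omega> - W a' \<omega>) $ j)
      + (X \<omega> * (W m \<omega> - W a' \<omega>) $ i) * (W b' \<omega> - W m \<omega>) $ j
      + (X \<omega> * (W m \<omega> - W a' \<omega>) $ j) * (W d \<omega> - W m \<omega>) $ i
      + X \<omega> * ((W d \<omega> - W m \<omega>) $ i * (W b' \<omega> - W m \<omega>) $ j)"
      by (simp only: distrib_left distrib_right mult_ac add_ac)
    finally show ?thesis
      unfolding zero cd[symmetric] vector_add_component by (simp only: distrib_left distrib_right mult_ac)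
  qed
  moreover have "m - a' = overlap a b a' b'"
    using ab ab' by (auto simp: m_def d_def overlap_def)
  ultimately show ?thesis
    using has_bochner_integral_add[OF has_bochner_integral_add[OF has_bochner_integral_add[OF t1 t2] t3] t4]
    by (simp only: add_0_left add_0_right)
qed

text \<open>Measurability at the left end is asked only for nondegenerate intervals. Stopping a
  partition at t shrinks all later intervals to the point t, and their values are not yet known at
  that time.\<close>

lemma increments_covariance:
  fixes X X' :: "'w \<Rightarrow> real"
  assumes ab: "0 \<le> a" "a \<le> b" "b \<le> T" and ab': "0 \<le> a'" "a' \<le> b'" "b' \<le> T"
    and X: "a < b \<Longrightarrow> X \<in> borel_measurable (F a)" "\<And>\<omega>. \<omega> \<in> space M \<Longrightarrow> \<bar>X \<omega>\<bar> \<le> K"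
    and X': "a' < b' \<Longrightarrow> X' \<in> borel_measurable (F a')" "\<And>\<omega>. \<omega> \<in> space M \<Longrightarrow> \<bar>X' \<omega>\<bar> \<le> K'"
  shows "has_bochner_integral M (\<lambda>\<omega>. (X \<omega> * (W b \<omega> - W a \<omega>) $ i) * (X' \<omega> * (W b' \<omega> - W a' \<omega>) $ j))
    (if i = j then expectation (\<lambda>\<omega>. X \<omega> * X' \<omega>) * overlap a b a' b' else 0)"
proof (cases "a < b \<and> a' < b'")
  case True
  have meas: "(\<lambda>\<omega>. X \<omega> * X' \<omega>) \<in> borel_measurable (F (max a a'))"
    using F_measurable_mono[OF X(1), of "max a a'"] F_measurable_mono[OF X'(1), of "max a a'"] True ab ab'
    by (intro borel_measurable_times) auto
  have bound: "\<bar>X \<omega> * X' \<omega>\<bar> \<le> K * K'" if "\<omega> \<in> space M" for \<omega>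
    using X(2)[OF that] X'(2)[OF that] unfolding abs_mult by (intro mult_mono) auto
  show ?thesis
  proof (cases "a \<le> a'")
    case True
    then have "has_bochner_integral M (\<lambda>\<omega>. (X \<omega> * X' \<omega>) * ((W b \<omega> - W a \<omega>) $ i * (W b' \<omega> - W a' \<omega>) $ j))
      (if i = j then expectation (\<lambda>\<omega>. X \<omega> * X' \<omega>) * overlap a b a' b' else 0)"
      by (intro increments_covariance_ordered[where K = "K * K'"] ab ab' bound) (use meas in \<open>simp_all add: max_def\<close>)
    then show ?thesis by (simp only: mult_ac)
  next
    case False
    then have "has_bochner_integral M (\<lambda>\<omega>. (X \<omega> * X' \<omega>) * ((W b' \<omega> - W a' \<omega>) $ j * (W b \<omega> - W a \<omega>) $ i))
      (if j = i then expectation (\<lambda>\<omega>. X \<omega> * X' \<omega>) * overlap a' b' a b else 0)"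
      by (intro increments_covariance_ordered[where K = "K * K'"] ab ab' bound) (use meas in \<open>simp_all add: max_def\<close>)
    moreover have "overlap a' b' a b = overlap a b a' b'"
      by (simp add: overlap_def min.commute max.commute)
    ultimately show ?thesis
      by (simp only: mult_ac eq_commute[of j i])
  qed
next
  case False
  then have "a = b \<or> a' = b'" using ab ab' by auto
  then have "overlap a b a' b' = 0" "\<And>\<omega>. (X \<omega> * (W b \<omega> - W a \<omega>) $ i) * (X' \<omega> * (W b' \<omega> - W a' \<omega>) $ j) = 0"
    by (auto simp: overlap_def)
  then show ?thesis by (simp only: mult_zero_right if_cancel has_bochner_integral_zero)
qed

text \<open>The intervals may overlap. So the difference of two step processes on unrelated partitions is
  covered, and no common refinement is needed.\<close>

lemma elementary_isometry:
  fixes \<xi> :: "'i \<Rightarrow> 'w \<Rightarrow> real ^ 'd ^ 'k"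
  assumes I: "finite I"
    and ab: "\<And>i. i \<in> I \<Longrightarrow> 0 \<le> a i \<and> a i \<le> b i \<and> b i \<le> T"
    and meas: "\<And>i. i \<in> I \<Longrightarrow> \<xi> i \<in> borel_measurable M" "\<And>i. i \<in> I \<Longrightarrow> a i < b i \<Longrightarrow> \<xi> i \<in> borel_measurable (F (a i))"
    and bound: "\<And>i. i \<in> I \<Longrightarrow> \<exists>K. \<forall>\<omega>\<in>space M. norm (\<xi> i \<omega>) \<le> K"
  shows "(\<integral>\<^sup>+\<omega>. ennreal ((norm (\<Sum>i\<in>I. \<xi> i \<omega> *v (W (b i) \<omega> - W (a i) \<omega>)))\<^sup>2) \<partial>M) =
    (\<integral>\<^sup>+(s, \<omega>). ennreal ((norm (\<Sum>i\<in>I. indicator {a i<..b i} s *\<^sub>R \<xi> i \<omega>))\<^sup>2) \<partial>time_prod M T)"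
proof -
  define e where "e k l i j = expectation (\<lambda>\<omega>. \<xi> i \<omega> $ k $ l * \<xi> j \<omega> $ k $ l)" for k l i j
  \<comment> \<open>Both sides are shown to equal \<open>S\<close>: second moments of matrix entries
    for every pair of intervals, weighted by the overlap.\<close>
  define S where "S = (\<Sum>k\<in>UNIV. \<Sum>l\<in>UNIV. \<Sum>i\<in>I. \<Sum>j\<in>I. e k l i j * overlap (a i) (b i) (a j) (b j))"
  obtain K where K: "\<And>i \<omega>. i \<in> I \<Longrightarrow> \<omega> \<in> space M \<Longrightarrow> norm (\<xi> i \<omega>) \<le> K i"
    using bound by metis
  have K_comp: "\<bar>\<xi> i \<omega> $ k $ l\<bar> \<le> K i" if "i \<in> I" "\<omega> \<in> space M" for i \<omega> k l
    by (rule order_trans[OF order_trans[OF component_le_norm_cart Finite_Cartesian_Product.norm_nth_le] K[OF that]])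
  let ?J = "\<lambda>\<omega>. \<Sum>i\<in>I. \<xi> i \<omega> *v (W (b i) \<omega> - W (a i) \<omega>)"
  let ?V = "\<lambda>s \<omega>. \<Sum>i\<in>I. indicator {a i<..b i} s *\<^sub>R \<xi> i \<omega>"
  have J: "has_bochner_integral M (\<lambda>\<omega>. (norm (?J \<omega>))\<^sup>2) S"
  proof -
    have "(norm (?J \<omega>))\<^sup>2 = (\<Sum>k\<in>UNIV. \<Sum>l\<in>UNIV. \<Sum>l'\<in>UNIV. \<Sum>i\<in>I. \<Sum>j\<in>I.
        (\<xi> i \<omega> $ k $ l * (W (b i) \<omega> - W (a i) \<omega>) $ l) * (\<xi> j \<omega> $ k $ l' * (W (b j) \<omega> - W (a j) \<omega>) $ l'))" for \<omega>
      unfolding norm_vec_power2 sum_component matrix_vector_mult_def vec_lambda_beta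
      by (subst sum.swap[of _ UNIV I]) (simp only: sum_power2_double)
    moreover have "has_bochner_integral M (\<lambda>\<omega>. \<Sum>k\<in>UNIV. \<Sum>l\<in>UNIV. \<Sum>l'\<in>UNIV. \<Sum>i\<in>I. \<Sum>j\<in>I.
        (\<xi> i \<omega> $ k $ l * (W (b i) \<omega> - W (a i) \<omega>) $ l) * (\<xi> j \<omega> $ k $ l' * (W (b j) \<omega> - W (a j) \<omega>) $ l'))
        (\<Sum>k\<in>UNIV. \<Sum>l\<in>UNIV. \<Sum>l'\<in>UNIV. \<Sum>i\<in>I. \<Sum>j\<in>I. if l = l' then
          expectation (\<lambda>\<omega>. \<xi> i \<omega> $ k $ l * \<xi> j \<omega> $ k $ l') * overlap (a i) (b i) (a j) (b j) else 0)"
      by (intro has_bochner_integral_sum increments_covariance)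
         (use ab meas K_comp in \<open>auto intro!: borel_measurable_vec_nth\<close>)
    moreover have "(\<Sum>k\<in>UNIV. \<Sum>l\<in>UNIV. \<Sum>l'\<in>UNIV. \<Sum>i\<in>I. \<Sum>j\<in>I. if l = l' then
          expectation (\<lambda>\<omega>. \<xi> i \<omega> $ k $ l * \<xi> j \<omega> $ k $ l') * overlap (a i) (b i) (a j) (b j) else 0) = S"
    proof -
      have "(\<Sum>l'\<in>UNIV. \<Sum>i\<in>I. \<Sum>j\<in>I. if l = l' then
          expectation (\<lambda>\<omega>. \<xi> i \<omega> $ k $ l * \<xi> j \<omega> $ k $ l') * overlap (a i) (b i) (a j) (b j) else 0)
         = (\<Sum>l'\<in>UNIV. if l = l' then \<Sum>i\<in>I. \<Sum>j\<in>I. e k l i j * overlap (a i) (b i) (a j) (b j) else 0)" for k l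
        by (intro sum.cong refl) (auto simp: e_def)
      then show ?thesis by (simp add: S_def)
    qed
    ultimately show ?thesis by simp
  qed
  have V: "has_bochner_integral M (\<lambda>\<omega>. (norm (?V s \<omega>))\<^sup>2)
      (\<Sum>k\<in>UNIV. \<Sum>l\<in>UNIV. \<Sum>i\<in>I. \<Sum>j\<in>I. e k l i j * (indicator {a i<..b i} s * indicator {a j<..b j} s))" for s
  proof -
    have "has_bochner_integral M (\<lambda>\<omega>. \<xi> i \<omega> $ k $ l * \<xi> j \<omega> $ k $ l * (indicator {a i<..b i} s * indicator {a j<..b j} s))
        (e k l i j * (indicator {a i<..b i} s * indicator {a j<..b j} s))" if ij: "i \<in> I" "j \<in> I" for i j k l
    proof (rule has_bochner_integral_mult_left)
      have "integrable M (\<lambda>\<omega>. \<xi> i \<omega> $ k $ l * \<xi> j \<omega> $ k $ l)"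
        by (rule integrable_const_bound[where B = "K i * K j"])
           (use ij meas K_comp in \<open>auto simp: abs_mult intro!: mult_mono AE_I2 order_trans[OF abs_ge_zero K_comp]\<close>)
      then show "has_bochner_integral M (\<lambda>\<omega>. \<xi> i \<omega> $ k $ l * \<xi> j \<omega> $ k $ l) (e k l i j)"
        by (simp add: e_def has_bochner_integral_integrable)
    qed
    moreover have "(norm (?V s \<omega>))\<^sup>2 = (\<Sum>k\<in>UNIV. \<Sum>l\<in>UNIV. \<Sum>i\<in>I. \<Sum>j\<in>I.
        \<xi> i \<omega> $ k $ l * \<xi> j \<omega> $ k $ l * (indicator {a i<..b i} s * indicator {a j<..b j} s))" for \<omega>
      unfolding norm_matrix_power2 sum_component vector_scaleR_component
      by (simp only: power2_eq_square sum_product) (intro sum.cong refl, simp)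
    ultimately show ?thesis
      by (simp only:) (intro has_bochner_integral_sum)
  qed
  have time: "has_bochner_integral (restrict_space lborel {0..T}) (\<lambda>s. expectation (\<lambda>\<omega>. (norm (?V s \<omega>))\<^sup>2)) S"
    unfolding S_def has_bochner_integral_integral_eq[OF V]
    by (intro has_bochner_integral_sum has_bochner_integral_mult_right has_bochner_integral_overlap) (use ab in auto)
  have [measurable]: "(\<lambda>z. ?V (fst z) (snd z)) \<in> borel_measurable (time_prod M T)"
  proof (intro borel_measurable_sum borel_measurable_scaleR)
    fix i assume i: "i \<in> I"
    show "(\<lambda>z. \<xi> i (snd z)) \<in> borel_measurable (time_prod M T)"
      by (rule measurable_compose[OF measurable_snd meas(1)[OF i]])
    show "(\<lambda>z. indicator {a i<..b i} (fst z) :: real) \<in> borel_measurable (time_prod M T)"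
      by measurable
  qed
  have "(\<integral>\<^sup>+(s, \<omega>). ennreal ((norm (?V s \<omega>))\<^sup>2) \<partial>time_prod M T)
      = (\<integral>\<^sup>+s. \<integral>\<^sup>+\<omega>. ennreal ((norm (?V s \<omega>))\<^sup>2) \<partial>M \<partial>restrict_space lborel {0..T})"
    by (subst nn_integral_time_prod) (simp_all add: split_beta')
  also have "\<dots> = (\<integral>\<^sup>+s. ennreal (expectation (\<lambda>\<omega>. (norm (?V s \<omega>))\<^sup>2)) \<partial>restrict_space lborel {0..T})"
    by (intro nn_integral_cong nn_integral_eq_integral integrable.intros[OF V]) simp
  also have "\<dots> = ennreal S"
    using has_bochner_integral_integral_eq[OF time]
    by (subst nn_integral_eq_integral) (auto intro!: integrable.intros[OF time] AE_I2 integral_nonneg_AE)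
  also have "\<dots> = (\<integral>\<^sup>+\<omega>. ennreal ((norm (?J \<omega>))\<^sup>2) \<partial>M)"
    using has_bochner_integral_integral_eq[OF J]
    by (subst nn_integral_eq_integral) (auto intro!: integrable.intros[OF J])
  finally show ?thesis by simp
qed

section \<open>Integrals of step processes and independence of the approximating sequence\<close>

lemma step_process_times:
  assumes "step_process M F T N \<tau> \<xi>" "i \<le> N"
  shows "0 \<le> \<tau> i" "\<tau> i \<le> T"
proof -
  have mono: "\<tau> j \<le> \<tau> (Suc j)" if "j < N" for j
    using assms(1) that by (simp add: step_process_def)
  have ends: "\<tau> 0 = 0" "\<tau> N = T"
    using assms(1) by (simp_all add: step_process_def)
  have "\<tau> 0 \<le> \<tau> i" using assms(2)
  proof (induction i)
    case (Suc i)
    then show ?case using mono[of i] by simp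
  qed simp
  then show "0 \<le> \<tau> i" by (simp add: ends)
  have "\<tau> i \<le> \<tau> N" using assms(2)
  proof (induction rule: inc_induct)
    case (step j)
    then show ?case using mono[of j] by simp
  qed simp
  then show "\<tau> i \<le> T" by (simp add: ends)
qed

lemma step_processD:
  assumes "step_process M F T N \<tau> \<xi>" "i < N"
  shows "\<tau> i \<le> \<tau> (Suc i)" "\<xi> i \<in> borel_measurable (F (\<tau> i))" "\<xi> i \<in> borel_measurable M"
    "\<exists>K. \<forall>\<omega>\<in>space M. norm (\<xi> i \<omega>) \<le> K"
  using assms step_process_times[OF assms(1), of i] F_measurable_M[of "\<xi> i" "\<tau> i"]
  by (auto simp: step_process_def)

lemma step_value_measurable:
  assumes "step_process M F T N \<tau> \<xi>"
  shows "(\<lambda>z. step_value N \<tau> \<xi> (fst z) (snd z)) \<in> borel_measurable (time_prod M T)"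
  unfolding step_value_def
proof (intro borel_measurable_sum borel_measurable_scaleR)
  fix i assume "i \<in> {..<N}"
  then show "(\<lambda>z. \<xi> i (snd z)) \<in> borel_measurable (time_prod M T)"
    using measurable_compose[OF measurable_snd step_processD(3)[OF assms, of i]] by blast
  show "(\<lambda>z. indicator {\<tau> i<..\<tau> (Suc i)} (fst z) :: real) \<in> borel_measurable (time_prod M T)"
    by measurable
qed

lemma borel_measurable_matrix_vector_mult:
  fixes X :: "'x \<Rightarrow> real ^ 'm ^ 'n"
  shows "X \<in> borel_measurable N \<Longrightarrow> v \<in> borel_measurable N \<Longrightarrow> (\<lambda>x. X x *v v x) \<in> borel_measurable N"
  by (rule borel_measurable_continuous_Pair) (auto intro!: continuous_intros)

lemma step_integral_measurable:
  assumes "step_process M F T N \<tau> \<xi>" "0 \<le> t" "t \<le> T"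
  shows "step_integral W N \<tau> \<xi> t \<in> borel_measurable M"
  unfolding step_integral_def
proof (intro borel_measurable_sum borel_measurable_matrix_vector_mult borel_measurable_diff)
  fix i assume "i \<in> {..<N}"
  then show "\<xi> i \<in> borel_measurable M" "W (min t (\<tau> (Suc i))) \<in> borel_measurable M" "W (min t (\<tau> i)) \<in> borel_measurable M"
    using assms(2,3) step_processD(3)[OF assms(1), of i] step_process_times[OF assms(1), of i]
      step_process_times[OF assms(1), of "Suc i"]
    by (auto intro!: F_measurable_M[OF W_adapted])
qed

text \<open>The two partitions are joined by a disjoint sum of index sets, with the sign -1 on the
  second, so the difference of the integrals is one elementary integral. Stopping the increments at
  t corresponds to the factor \<open>indicator {..t}\<close> on the integrand.\<close>

lemma step_pair_isometry:
  assumes step: "step_process M F T N \<tau> \<xi>" "step_process M F T N' \<tau>' \<xi>'" and t: "0 \<le> t" "t \<le> T"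
  shows "(\<integral>\<^sup>+\<omega>. ennreal ((norm (step_integral W N \<tau> \<xi> t \<omega> - step_integral W N' \<tau>' \<xi>' t \<omega>))\<^sup>2) \<partial>M) =
    (\<integral>\<^sup>+(s, \<omega>). ennreal ((norm (indicator {..t} s *\<^sub>R (step_value N \<tau> \<xi> s \<omega> - step_value N' \<tau>' \<xi>' s \<omega>)))\<^sup>2) \<partial>time_prod M T)"
proof -
  define a b \<zeta> where "a = case_sum (\<lambda>i. min t (\<tau> i)) (\<lambda>i. min t (\<tau>' i))"
    and "b = case_sum (\<lambda>i. min t (\<tau> (Suc i))) (\<lambda>i. min t (\<tau>' (Suc i)))"
    and "\<zeta> = case_sum \<xi> (\<lambda>i \<omega>. - \<xi>' i \<omega>)"
  have "(\<integral>\<^sup>+\<omega>. ennreal ((norm (\<Sum>i\<in>{..<N} <+> {..<N'}. \<zeta> i \<omega> *v (W (b i) \<omega> - W (a i) \<omega>)))\<^sup>2) \<partial>M) =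
    (\<integral>\<^sup>+(s, \<omega>). ennreal ((norm (\<Sum>i\<in>{..<N} <+> {..<N'}. indicator {a i<..b i} s *\<^sub>R \<zeta> i \<omega>))\<^sup>2) \<partial>time_prod M T)"
  proof (rule elementary_isometry)
    fix i assume i: "i \<in> {..<N} <+> {..<N'}"
    then show "0 \<le> a i \<and> a i \<le> b i \<and> b i \<le> T"
      using t step_process_times[OF step(1)] step_process_times[OF step(2)] step_processD(1)[OF step(1)] step_processD(1)[OF step(2)]
      by (auto simp: a_def b_def min.coboundedI2 min.coboundedI1)
    show "\<zeta> i \<in> borel_measurable M"
      using i step_processD(3)[OF step(1)] step_processD(3)[OF step(2)] by (auto simp: \<zeta>_def)
    show "\<exists>K. \<forall>\<omega>\<in>space M. norm (\<zeta> i \<omega>) \<le> K"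
      using i step_processD(4)[OF step(1)] step_processD(4)[OF step(2)] by (auto simp: \<zeta>_def)
    \<comment> \<open>A nondegenerate stopped interval starts strictly before t, so its left end is
      still the original partition point, where the value is known.\<close>
    assume "a i < b i"
    then show "\<zeta> i \<in> borel_measurable (F (a i))"
      using i step_processD(2)[OF step(1)] step_processD(2)[OF step(2)]
      by (auto simp: a_def b_def \<zeta>_def min_def split: if_splits)
  qed simp
  moreover have "(\<Sum>i\<in>{..<N} <+> {..<N'}. \<zeta> i \<omega> *v (W (b i) \<omega> - W (a i) \<omega>)) =
      step_integral W N \<tau> \<xi> t \<omega> - step_integral W N' \<tau>' \<xi>' t \<omega>" for \<omega>
    by (simp add: sum.Plus a_def b_def \<zeta>_def step_integral_def matrix_vector_mult_uminus sum_negf)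
  moreover have "(\<Sum>i\<in>{..<N} <+> {..<N'}. indicator {a i<..b i} s *\<^sub>R \<zeta> i \<omega>) =
      indicator {..t} s *\<^sub>R (step_value N \<tau> \<xi> s \<omega> - step_value N' \<tau>' \<xi>' s \<omega>)" for s \<omega>
  proof -
    have "indicator {min t x<..min t y} s = (indicator {..t} s * indicator {x<..y} s :: real)" for x y
      by (auto simp: indicator_def)
    then show ?thesis
      by (subst sum.Plus) (simp_all only: finite_lessThan o_def a_def b_def \<zeta>_def sum.case step_value_def
          scaleR_minus_right sum_negf scaleR_diff_right scaleR_sum_right scaleR_scaleR scaleR_add_right diff_conv_add_uminus)
  qed
  ultimately show ?thesis by simp
qed

lemma step_pair_contraction:
  assumes step: "step_process M F T N \<tau> \<xi>" "step_process M F T N' \<tau>' \<xi>'" and t: "0 \<le> t" "t \<le> T"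
  shows "(\<integral>\<^sup>+\<omega>. ennreal ((norm (step_integral W N \<tau> \<xi> t \<omega> - step_integral W N' \<tau>' \<xi>' t \<omega>))\<^sup>2) \<partial>M) \<le>
    (\<integral>\<^sup>+(s, \<omega>). ennreal ((norm (step_value N \<tau> \<xi> s \<omega> - step_value N' \<tau>' \<xi>' s \<omega>))\<^sup>2) \<partial>time_prod M T)"
  unfolding step_pair_isometry[OF assms]
  by (intro nn_integral_mono) (auto simp: indicator_def)

lemma step_pair_isometry_terminal:
  assumes step: "step_process M F T N \<tau> \<xi>" "step_process M F T N' \<tau>' \<xi>'"
  shows "(\<integral>\<^sup>+\<omega>. ennreal ((norm (step_integral W N \<tau> \<xi> T \<omega> - step_integral W N' \<tau>' \<xi>' T \<omega>))\<^sup>2) \<partial>M) =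
    (\<integral>\<^sup>+(s, \<omega>). ennreal ((norm (step_value N \<tau> \<xi> s \<omega> - step_value N' \<tau>' \<xi>' s \<omega>))\<^sup>2) \<partial>time_prod M T)"
  unfolding step_pair_isometry[OF assms less_imp_le[OF T] order_refl]
  by (intro nn_integral_cong) (auto simp: indicator_def space_pair_measure space_restrict_space)

lemma tendsto_ennreal_2_2_0:
  fixes f g :: "nat \<Rightarrow> ennreal"
  assumes "f \<longlonglongrightarrow> 0" "g \<longlonglongrightarrow> 0"
  shows "(\<lambda>n. 2 * f n + 2 * g n) \<longlonglongrightarrow> 0"
  using tendsto_add[OF ennreal_tendsto_cmult[OF _ assms(1), of 2] ennreal_tendsto_cmult[OF _ assms(2), of 2]]
  by simp

text \<open>The definition supplies some approximating sequence, possibly a different one for each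
  time and each version. By the contraction property, step integrals of two sequences approximating
  \<open>Z\<close> approach each other, so the limit is the same along any prescribed
  sequence.\<close>

lemma has_ito_integral_consistent:
  fixes Z :: "real \<Rightarrow> 'w \<Rightarrow> real ^ 'd ^ 'k"
  assumes ito: "has_ito_integral M F T W Z t J" and t: "0 \<le> t" "t \<le> T"
    and step: "\<And>k. step_process M F T (N k) (\<tau> k) (\<xi> k)"
    and lim: "(\<lambda>k. \<integral>\<^sup>+(s, \<omega>). ennreal ((norm (Z s \<omega> - step_value (N k) (\<tau> k) (\<xi> k) s \<omega>))\<^sup>2) \<partial>time_prod M T) \<longlonglongrightarrow> 0"
  shows "(\<lambda>k. \<integral>\<^sup>+\<omega>. ennreal ((norm (J \<omega> - step_integral W (N k) (\<tau> k) (\<xi> k) t \<omega>))\<^sup>2) \<partial>M) \<longlonglongrightarrow> 0"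
proof -
  obtain N' \<tau>' \<xi>' where step': "\<And>k. step_process M F T (N' k) (\<tau>' k) (\<xi>' k)"
    and lim': "(\<lambda>k. \<integral>\<^sup>+(s, \<omega>). ennreal ((norm (Z s \<omega> - step_value (N' k) (\<tau>' k) (\<xi>' k) s \<omega>))\<^sup>2) \<partial>time_prod M T) \<longlonglongrightarrow> 0"
    and limJ: "(\<lambda>k. \<integral>\<^sup>+\<omega>. ennreal ((norm (J \<omega> - step_integral W (N' k) (\<tau>' k) (\<xi>' k) t \<omega>))\<^sup>2) \<partial>M) \<longlonglongrightarrow> 0"
    using ito by (auto simp: has_ito_integral_def)
  have Z: "(\<lambda>z. Z (fst z) (snd z)) \<in> borel_measurable (time_prod M T)" and J: "J \<in> borel_measurable M"
    using ito by (auto simp: has_ito_integral_def L2_adapted_def split_beta')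
  let ?S = "\<lambda>k. step_integral W (N k) (\<tau> k) (\<xi> k) t" and ?S' = "\<lambda>k. step_integral W (N' k) (\<tau>' k) (\<xi>' k) t"
  let ?V = "\<lambda>k z. step_value (N k) (\<tau> k) (\<xi> k) (fst z) (snd z)" and ?V' = "\<lambda>k z. step_value (N' k) (\<tau>' k) (\<xi>' k) (fst z) (snd z)"
  have "(\<integral>\<^sup>+\<omega>. ennreal ((norm (?S k \<omega> - ?S' k \<omega>))\<^sup>2) \<partial>M) \<le>
      2 * (\<integral>\<^sup>+(s, \<omega>). ennreal ((norm (Z s \<omega> - step_value (N k) (\<tau> k) (\<xi> k) s \<omega>))\<^sup>2) \<partial>time_prod M T)
      + 2 * (\<integral>\<^sup>+(s, \<omega>). ennreal ((norm (Z s \<omega> - step_value (N' k) (\<tau>' k) (\<xi>' k) s \<omega>))\<^sup>2) \<partial>time_prod M T)" for k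
    using order_trans[OF step_pair_contraction[OF step step' t, of k k, unfolded split_beta']
        nn_integral_norm_diff_power2_le[OF step_value_measurable[OF step] Z step_value_measurable[OF step'], of k k]]
    by (simp add: norm_minus_commute split_beta')
  then have lim_S: "(\<lambda>k. \<integral>\<^sup>+\<omega>. ennreal ((norm (?S k \<omega> - ?S' k \<omega>))\<^sup>2) \<partial>M) \<longlonglongrightarrow> 0"
    by (intro tendsto_sandwich[OF _ _ tendsto_const tendsto_ennreal_2_2_0[OF lim lim']]) auto
  have "(\<integral>\<^sup>+\<omega>. ennreal ((norm (J \<omega> - ?S k \<omega>))\<^sup>2) \<partial>M) \<le>
     2 * (\<integral>\<^sup>+\<omega>. ennreal ((norm (J \<omega> - ?S' k \<omega>))\<^sup>2) \<partial>M) + 2 * (\<integral>\<^sup>+\<omega>. ennreal ((norm (?S k \<omega> - ?S' k \<omega>))\<^sup>2) \<partial>M)" for k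
    by (rule nn_integral_norm_diff_power2_le[OF J step_integral_measurable[OF step' t] step_integral_measurable[OF step t]])
  then show ?thesis
    by (intro tendsto_sandwich[OF _ _ tendsto_const tendsto_ennreal_2_2_0[OF limJ lim_S]]) auto
qed

lemma ennreal_le_null_sequence:
  fixes x :: ennreal
  shows "(\<And>k. x \<le> f k) \<Longrightarrow> f \<longlonglongrightarrow> 0 \<Longrightarrow> x = 0"
  using LIMSEQ_le_const[of f 0 x] by auto

lemma has_ito_integral_unique:
  assumes ito: "has_ito_integral M F T W Z t J" "has_ito_integral M F T W Z t J'" and t: "0 \<le> t" "t \<le> T"
  shows "AE \<omega> in M. J \<omega> = J' \<omega>"
proof -
  obtain N \<tau> \<xi> where step: "\<And>k. step_process M F T (N k) (\<tau> k) (\<xi> k)"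
    and lim: "(\<lambda>k. \<integral>\<^sup>+(s, \<omega>). ennreal ((norm (Z s \<omega> - step_value (N k) (\<tau> k) (\<xi> k) s \<omega>))\<^sup>2) \<partial>time_prod M T) \<longlonglongrightarrow> 0"
    using ito(1) by (auto simp: has_ito_integral_def)
  have [measurable]: "J \<in> borel_measurable M" "J' \<in> borel_measurable M"
    using ito by (auto simp: has_ito_integral_def)
  have "(\<integral>\<^sup>+\<omega>. ennreal ((norm (J \<omega> - J' \<omega>))\<^sup>2) \<partial>M) = 0"
    by (rule ennreal_le_null_sequence[OF nn_integral_norm_diff_power2_le
          tendsto_ennreal_2_2_0[OF has_ito_integral_consistent[OF ito(1) t step lim] has_ito_integral_consistent[OF ito(2) t step lim]]])
       (auto intro: step_integral_measurable[OF step t])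
  then show ?thesis
    by (subst (asm) nn_integral_0_iff_AE) auto
qed

text \<open>At the terminal time the isometry is an equality without truncation, so step integrals
  approaching a common limit force the step integrands to approach each other. The chain from
  \<open>Z\<close> through both approximations to \<open>Z'\<close> then has length 0.\<close>

lemma ito_integrand_unique:
  assumes ito: "has_ito_integral M F T W Z T J" "has_ito_integral M F T W Z' T J'" and eq: "AE \<omega> in M. J \<omega> = J' \<omega>"
  shows "AE (t, \<omega>) in time_prod M T. Z t \<omega> = Z' t \<omega>"
proof -
  note T0 = less_imp_le[OF T]
  obtain N \<tau> \<xi> where step: "\<And>k. step_process M F T (N k) (\<tau> k) (\<xi> k)"
    and lim: "(\<lambda>k. \<integral>\<^sup>+(s, \<omega>). ennreal ((norm (Z s \<omega> - step_value (N k) (\<tau> k) (\<xi> k) s \<omega>))\<^sup>2) \<partial>time_prod M T) \<longlonglongrightarrow> 0"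
    and limJ: "(\<lambda>k. \<integral>\<^sup>+\<omega>. ennreal ((norm (J \<omega> - step_integral W (N k) (\<tau> k) (\<xi> k) T \<omega>))\<^sup>2) \<partial>M) \<longlonglongrightarrow> 0"
    using ito(1) by (auto simp: has_ito_integral_def)
  obtain N' \<tau>' \<xi>' where step': "\<And>k. step_process M F T (N' k) (\<tau>' k) (\<xi>' k)"
    and lim': "(\<lambda>k. \<integral>\<^sup>+(s, \<omega>). ennreal ((norm (Z' s \<omega> - step_value (N' k) (\<tau>' k) (\<xi>' k) s \<omega>))\<^sup>2) \<partial>time_prod M T) \<longlonglongrightarrow> 0"
    and limJ': "(\<lambda>k. \<integral>\<^sup>+\<omega>. ennreal ((norm (J' \<omega> - step_integral W (N' k) (\<tau>' k) (\<xi>' k) T \<omega>))\<^sup>2) \<partial>M) \<longlonglongrightarrow> 0"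
    using ito(2) by (auto simp: has_ito_integral_def)
  have Z: "(\<lambda>z. Z (fst z) (snd z)) \<in> borel_measurable (time_prod M T)" "(\<lambda>z. Z' (fst z) (snd z)) \<in> borel_measurable (time_prod M T)"
    and J: "J \<in> borel_measurable M" "J' \<in> borel_measurable M"
    using ito by (auto simp: has_ito_integral_def L2_adapted_def split_beta')
  let ?S = "\<lambda>k. step_integral W (N k) (\<tau> k) (\<xi> k) T" and ?S' = "\<lambda>k. step_integral W (N' k) (\<tau>' k) (\<xi>' k) T"
  let ?V = "\<lambda>k z. step_value (N k) (\<tau> k) (\<xi> k) (fst z) (snd z)" and ?V' = "\<lambda>k z. step_value (N' k) (\<tau>' k) (\<xi>' k) (fst z) (snd z)"
  have "(\<integral>\<^sup>+\<omega>. ennreal ((norm (J' \<omega> - ?S' k \<omega>))\<^sup>2) \<partial>M) = (\<integral>\<^sup>+\<omega>. ennreal ((norm (J \<omega> - ?S' k \<omega>))\<^sup>2) \<partial>M)" for k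
    by (rule nn_integral_cong_AE) (use eq in auto)
  with limJ' have limJ'': "(\<lambda>k. \<integral>\<^sup>+\<omega>. ennreal ((norm (J \<omega> - ?S' k \<omega>))\<^sup>2) \<partial>M) \<longlonglongrightarrow> 0"
    by simp
  have lim_V: "(\<lambda>k. \<integral>\<^sup>+z. ennreal ((norm (?V k z - ?V' k z))\<^sup>2) \<partial>time_prod M T) \<longlonglongrightarrow> 0"
  proof (rule tendsto_sandwich[OF _ _ tendsto_const tendsto_ennreal_2_2_0[OF limJ limJ'']])
    have "(\<integral>\<^sup>+z. ennreal ((norm (?V k z - ?V' k z))\<^sup>2) \<partial>time_prod M T) \<le>
        2 * (\<integral>\<^sup>+\<omega>. ennreal ((norm (J \<omega> - ?S k \<omega>))\<^sup>2) \<partial>M) + 2 * (\<integral>\<^sup>+\<omega>. ennreal ((norm (J \<omega> - ?S' k \<omega>))\<^sup>2) \<partial>M)" for k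
      using step_pair_isometry_terminal[OF step step', of k k]
        nn_integral_norm_diff_power2_le[OF step_integral_measurable[OF step T0 order_refl] J(1) step_integral_measurable[OF step' T0 order_refl], of k k]
      by (simp add: norm_minus_commute split_beta')
    then show "\<forall>\<^sub>F k in sequentially. (\<integral>\<^sup>+z. ennreal ((norm (?V k z - ?V' k z))\<^sup>2) \<partial>time_prod M T) \<le>
        2 * (\<integral>\<^sup>+\<omega>. ennreal ((norm (J \<omega> - ?S k \<omega>))\<^sup>2) \<partial>M) + 2 * (\<integral>\<^sup>+\<omega>. ennreal ((norm (J \<omega> - ?S' k \<omega>))\<^sup>2) \<partial>M)"
      by simp
  qed simp
  have lim_Z': "(\<lambda>k. \<integral>\<^sup>+z. ennreal ((norm (Z' (fst z) (snd z) - ?V k z))\<^sup>2) \<partial>time_prod M T) \<longlonglongrightarrow> 0"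
    by (rule tendsto_sandwich[OF _ always_eventually tendsto_const tendsto_ennreal_2_2_0[OF lim'[unfolded split_beta'] lim_V]])
       (auto intro!: nn_integral_norm_diff_power2_le Z step_value_measurable[OF step] step_value_measurable[OF step'])
  have "(\<integral>\<^sup>+z. ennreal ((norm (Z (fst z) (snd z) - Z' (fst z) (snd z)))\<^sup>2) \<partial>time_prod M T) = 0"
    by (rule ennreal_le_null_sequence[OF nn_integral_norm_diff_power2_le tendsto_ennreal_2_2_0[OF lim[unfolded split_beta'] lim_Z']])
       (auto intro: Z step_value_measurable[OF step])
  then show ?thesis
    using Z by (subst (asm) nn_integral_0_iff_AE) (auto simp: split_beta')
qed

end

section \<open>Orthogonality and deterministic integrands\<close>

lemma set_integral_continuous_eq_integral:
  fixes f :: "real \<Rightarrow> 'v::euclidean_space"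
  assumes "continuous_on {a..b} f"
  shows "(LINT s:{a..b}|lborel. f s) = integral {a..b} f" "set_integrable lborel {a..b} f"
proof -
  show "set_integrable lborel {a..b} f"
    using assms by (rule borel_integrable_atLeastAtMost')
  then show "(LINT s:{a..b}|lborel. f s) = integral {a..b} f"
    by (rule set_borel_integral_eq_integral)
qed

lemma indicator_partition_sum:
  fixes \<tau> :: "nat \<Rightarrow> real"
  assumes "\<And>i. i < N \<Longrightarrow> \<tau> i \<le> \<tau> (Suc i)"
  shows "\<tau> 0 \<le> \<tau> N \<and> (\<Sum>i<N. indicator {\<tau> i<..\<tau> (Suc i)} s) = (indicator {\<tau> 0<..\<tau> N} s :: real)"
  using assms
proof (induction N)
  case (Suc N)
  then have "\<tau> 0 \<le> \<tau> N" "\<tau> N \<le> \<tau> (Suc N)"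
    and sum: "(\<Sum>i<N. indicator {\<tau> i<..\<tau> (Suc i)} s) = (indicator {\<tau> 0<..\<tau> N} s :: real)"
    by auto
  then have "indicator {\<tau> 0<..\<tau> N} s + indicator {\<tau> N<..\<tau> (Suc N)} s = (indicator {\<tau> 0<..\<tau> (Suc N)} s :: real)"
    by (auto simp: indicator_def)
  with \<open>\<tau> 0 \<le> \<tau> N\<close> \<open>\<tau> N \<le> \<tau> (Suc N)\<close> show ?case
    by (intro conjI, linarith) (simp only: sum.lessThan_Suc sum)
qed simp

lemma ennreal_2_2_less_top: "a < \<infinity> \<Longrightarrow> b < \<infinity> \<Longrightarrow> 2 * a + 2 * b < (\<infinity> :: ennreal)"
  by (simp add: ennreal_mult_less_top)

lemma norm_sum_power2_le:
  "(norm (\<Sum>i\<in>I. f i))\<^sup>2 \<le> real (card I) * (\<Sum>i\<in>I. (norm (f i :: 'v::real_normed_vector))\<^sup>2)"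
proof -
  have "(norm (\<Sum>i\<in>I. f i))\<^sup>2 \<le> (\<Sum>i\<in>I. norm (f i))\<^sup>2"
    by (intro power_mono norm_sum) simp
  also have "\<dots> \<le> (\<Sum>i\<in>I. (norm (f i))\<^sup>2) * real (card I)"
    by (rule sum_squared_le_sum_of_squares)
  finally show ?thesis by (simp add: mult.commute)
qed

lemma matrix_vector_mult_norm_bound:
  fixes G :: "real \<Rightarrow> real ^ 'm ^ 'n"
  assumes "continuous_on {a..b} G"
  obtains C where "C \<ge> 0" "\<And>s v. s \<in> {a..b} \<Longrightarrow> norm (G s *v v) \<le> C * norm v"
proof -
  obtain K where K: "K > 0" "\<And>(X :: real ^ 'm ^ 'n) v. norm (X *v v) \<le> norm X * norm v * K"
    using bounded_bilinear.pos_bounded[OF bounded_bilinear_matrix_vector_mult] by blast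
  have "bounded (G ` {a..b})"
    by (intro compact_imp_bounded compact_continuous_image assms) simp
  then obtain C where C: "\<And>s. s \<in> {a..b} \<Longrightarrow> norm (G s) \<le> C"
    unfolding bounded_iff by (meson imageI)
  show thesis
  proof
    show "0 \<le> \<bar>C\<bar> * K" using K(1) by simp
    fix s v assume s: "s \<in> {a..b}"
    have "norm (G s *v v) \<le> norm (G s) * norm v * K" by (rule K(2))
    also have "\<dots> \<le> \<bar>C\<bar> * norm v * K"
      using C[OF s] K(1) by (intro mult_right_mono) auto
    finally show "norm (G s *v v) \<le> \<bar>C\<bar> * K * norm v" by (simp add: mult_ac)
  qed
qed

context filtered_wiener
begin

lemma W_measurable: "0 \<le> t \<Longrightarrow> t \<le> T \<Longrightarrow> W t \<in> borel_measurable M"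
  by (rule F_measurable_M[OF W_adapted]) auto

lemma component_integrable:
  fixes X :: "'w \<Rightarrow> real ^ 'k"
  assumes "X \<in> borel_measurable M" "integrable M (\<lambda>\<omega>. (norm (X \<omega>))\<^sup>2)"
  shows "integrable M (\<lambda>\<omega>. X \<omega> $ k)"
proof (rule Bochner_Integration.integrable_bound)
  show "integrable M (\<lambda>\<omega>. norm (X \<omega>))"
    by (rule square_integrable_imp_integrable[OF measurable_compose[OF assms(1) borel_measurable_norm] assms(2)])
  show "(\<lambda>\<omega>. X \<omega> $ k) \<in> borel_measurable M"
    using assms(1) by (rule borel_measurable_vec_nth)
  show "AE \<omega> in M. norm (X \<omega> $ k) \<le> norm (norm (X \<omega>))"
    unfolding real_norm_def abs_norm_cancel by (intro AE_I2 component_le_norm_cart)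
qed

text \<open>The integral after t runs over the partition intervals cut from below at t. The product
  of \<open>X\<close> with the i-th value is known at the left end \<open>max t (\<tau> i)\<close>
  of the cut interval and is integrable because the value is bounded, so each increment has mean
  zero against it.\<close>

lemma step_integral_orthogonal:
  fixes \<xi> :: "nat \<Rightarrow> 'w \<Rightarrow> real ^ 'd ^ 'k"
  assumes step: "step_process M F T N \<tau> \<xi>" and t: "0 \<le> t" "t \<le> T"
    and X: "X \<in> borel_measurable (F t)" "integrable M (\<lambda>\<omega>. (norm (X \<omega>))\<^sup>2)"
  shows "has_bochner_integral M (\<lambda>\<omega>. X \<omega> \<bullet> (step_integral W N \<tau> \<xi> T \<omega> - step_integral W N \<tau> \<xi> t \<omega>)) 0"
proof -
  have XM: "X \<in> borel_measurable M" by (rule F_measurable_M[OF X(1) t])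
  have "has_bochner_integral M (\<lambda>\<omega>. (X \<omega> $ k * \<xi> i \<omega> $ k $ l) * (W (max t (\<tau> (Suc i))) \<omega> - W (max t (\<tau> i)) \<omega>) $ l) 0"
    if i: "i < N" for i k l
  proof (rule increment_orthogonal)
    note times = step_process_times[OF step, of i] step_process_times[OF step, of "Suc i"]
    show "0 \<le> max t (\<tau> i)" "max t (\<tau> i) \<le> max t (\<tau> (Suc i))" "max t (\<tau> (Suc i)) \<le> T"
      using times i t step_processD(1)[OF step i] by auto
    have "X \<in> borel_measurable (F (max t (\<tau> i)))" "\<xi> i \<in> borel_measurable (F (max t (\<tau> i)))"
      using F_measurable_mono[OF X(1), of "max t (\<tau> i)"] F_measurable_mono[OF step_processD(2)[OF step i], of "max t (\<tau> i)"] times i t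
      by auto
    then show "(\<lambda>\<omega>. X \<omega> $ k * \<xi> i \<omega> $ k $ l) \<in> borel_measurable (F (max t (\<tau> i)))"
      by (intro borel_measurable_times borel_measurable_vec_nth)
    obtain K where K: "\<And>\<omega>. \<omega> \<in> space M \<Longrightarrow> norm (\<xi> i \<omega>) \<le> K"
      using step_processD(4)[OF step i] by blast
    show "integrable M (\<lambda>\<omega>. X \<omega> $ k * \<xi> i \<omega> $ k $ l)"
    proof (rule Bochner_Integration.integrable_bound)
      show "integrable M (\<lambda>\<omega>. K * X \<omega> $ k)"
        by (rule integrable_mult_right) (rule component_integrable[OF XM X(2)])
      show "(\<lambda>\<omega>. X \<omega> $ k * \<xi> i \<omega> $ k $ l) \<in> borel_measurable M"
        by (intro borel_measurable_times borel_measurable_vec_nth XM step_processD(3)[OF step i])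
      have "\<bar>\<xi> i \<omega> $ k $ l\<bar> \<le> \<bar>K\<bar>" if "\<omega> \<in> space M" for \<omega>
        by (rule order_trans[OF order_trans[OF order_trans[OF component_le_norm_cart Finite_Cartesian_Product.norm_nth_le] K[OF that]] abs_ge_self])
      then show "AE \<omega> in M. norm (X \<omega> $ k * \<xi> i \<omega> $ k $ l) \<le> norm (K * X \<omega> $ k)"
        unfolding real_norm_def abs_mult by (intro AE_I2) (subst mult.commute, intro mult_right_mono, auto)
    qed
  qed
  then have sum: "has_bochner_integral M (\<lambda>\<omega>. \<Sum>i<N. \<Sum>k\<in>UNIV. \<Sum>l\<in>UNIV.
      (X \<omega> $ k * \<xi> i \<omega> $ k $ l) * (W (max t (\<tau> (Suc i))) \<omega> - W (max t (\<tau> i)) \<omega>) $ l) (\<Sum>i<N. \<Sum>k\<in>(UNIV::'k set). \<Sum>l\<in>(UNIV::'d set). 0)"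
    by (intro has_bochner_integral_sum) simp
  have "X \<omega> \<bullet> (step_integral W N \<tau> \<xi> T \<omega> - step_integral W N \<tau> \<xi> t \<omega>) = (\<Sum>i<N. \<Sum>k\<in>UNIV. \<Sum>l\<in>UNIV.
      (X \<omega> $ k * \<xi> i \<omega> $ k $ l) * (W (max t (\<tau> (Suc i))) \<omega> - W (max t (\<tau> i)) \<omega>) $ l)" for \<omega>
  proof -
    have "step_integral W N \<tau> \<xi> T \<omega> - step_integral W N \<tau> \<xi> t \<omega>
        = (\<Sum>i<N. \<xi> i \<omega> *v (W (max t (\<tau> (Suc i))) \<omega> - W (max t (\<tau> i)) \<omega>))"
      unfolding step_integral_def sum_subtractf[symmetric]
    proof (intro sum.cong refl)
      fix i assume "i \<in> {..<N}"
      then have "min T (\<tau> i) = \<tau> i" "min T (\<tau> (Suc i)) = \<tau> (Suc i)"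
        using step_process_times[OF step, of i] step_process_times[OF step, of "Suc i"] by auto
      \<comment> \<open>Cutting from above and cutting from below are complementary, so subtracting
        the sum stopped at t leaves the sum that starts at t.\<close>
      moreover have "W (max t u) \<omega> = W t \<omega> + W u \<omega> - W (min t u) \<omega>" for u
        by (simp add: max_def min_def)
      ultimately show "\<xi> i \<omega> *v (W (min T (\<tau> (Suc i))) \<omega> - W (min T (\<tau> i)) \<omega>) - \<xi> i \<omega> *v (W (min t (\<tau> (Suc i))) \<omega> - W (min t (\<tau> i)) \<omega>)
          = \<xi> i \<omega> *v (W (max t (\<tau> (Suc i))) \<omega> - W (max t (\<tau> i)) \<omega>)"
        by (simp add: matrix_vector_mult_diff_distrib matrix_vector_right_distrib)
    qed
    then show ?thesis
      by (simp only: inner_sum_right) (simp only: inner_vec_def matrix_vector_mult_def vec_lambda_beta inner_real_def sum_distrib_left mult.assoc)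
  qed
  then show ?thesis using sum by (simp only: sum.neutral_const)
qed

text \<open>\<open>J\<close> lies within finite L2 distance of a step integral, and the isometry
  bounds that step integral by its integrand, which in turn lies within finite distance of the
  square-integrable \<open>Z\<close>.\<close>

lemma has_ito_integral_square_integrable:
  assumes ito: "has_ito_integral M F T W Z t J" and t: "0 \<le> t" "t \<le> T"
  shows "integrable M (\<lambda>\<omega>. (norm (J \<omega>))\<^sup>2)"
proof -
  obtain N \<tau> \<xi> where step: "\<And>k. step_process M F T (N k) (\<tau> k) (\<xi> k)"
    and lim: "(\<lambda>k. \<integral>\<^sup>+(s, \<omega>). ennreal ((norm (Z s \<omega> - step_value (N k) (\<tau> k) (\<xi> k) s \<omega>))\<^sup>2) \<partial>time_prod M T) \<longlonglongrightarrow> 0"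
    and limJ: "(\<lambda>k. \<integral>\<^sup>+\<omega>. ennreal ((norm (J \<omega> - step_integral W (N k) (\<tau> k) (\<xi> k) t \<omega>))\<^sup>2) \<partial>M) \<longlonglongrightarrow> 0"
    using ito by (auto simp: has_ito_integral_def)
  have Z: "(\<lambda>z. Z (fst z) (snd z)) \<in> borel_measurable (time_prod M T)" and J [measurable]: "J \<in> borel_measurable M"
    and Z_int: "integrable (time_prod M T) (\<lambda>z. (norm (Z (fst z) (snd z)))\<^sup>2)"
    using ito by (auto simp: has_ito_integral_def L2_adapted_def split_beta')
  have "\<forall>\<^sub>F k in sequentially. (\<integral>\<^sup>+(s, \<omega>). ennreal ((norm (Z s \<omega> - step_value (N k) (\<tau> k) (\<xi> k) s \<omega>))\<^sup>2) \<partial>time_prod M T) < 1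
      \<and> (\<integral>\<^sup>+\<omega>. ennreal ((norm (J \<omega> - step_integral W (N k) (\<tau> k) (\<xi> k) t \<omega>))\<^sup>2) \<partial>M) < 1"
    by (intro eventually_conj order_tendstoD(2)[OF lim] order_tendstoD(2)[OF limJ]) simp_all
  then obtain k where k: "(\<integral>\<^sup>+z. ennreal ((norm (Z (fst z) (snd z) - step_value (N k) (\<tau> k) (\<xi> k) (fst z) (snd z)))\<^sup>2) \<partial>time_prod M T) < 1"
      "(\<integral>\<^sup>+\<omega>. ennreal ((norm (J \<omega> - step_integral W (N k) (\<tau> k) (\<xi> k) t \<omega>))\<^sup>2) \<partial>M) < 1"
    unfolding eventually_sequentially split_beta' by blast
  define V where "V z = step_value (N k) (\<tau> k) (\<xi> k) (fst z) (snd z)" for z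
  define S where "S = step_integral W (N k) (\<tau> k) (\<xi> k) t"
  have V [measurable]: "V \<in> borel_measurable (time_prod M T)"
    unfolding V_def[abs_def] by (rule step_value_measurable[OF step])
  have S [measurable]: "S \<in> borel_measurable M"
    unfolding S_def by (rule step_integral_measurable[OF step t])
  \<comment> \<open>Compared with the zero process, the estimate for pairs bounds a single step
    integral.\<close>
  have zero: "step_process M F T (N k) (\<tau> k) (\<lambda>_ _. 0)"
    using step[of k] by (auto simp: step_process_def)
  have "(\<integral>\<^sup>+\<omega>. ennreal ((norm (S \<omega>))\<^sup>2) \<partial>M) \<le> (\<integral>\<^sup>+z. ennreal ((norm (V z))\<^sup>2) \<partial>time_prod M T)"
    using step_pair_contraction[OF step[of k] zero t] by (simp add: S_def V_def step_value_def step_integral_def split_beta')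
  also have "\<dots> \<le> 2 * (\<integral>\<^sup>+z. ennreal ((norm (V z - Z (fst z) (snd z)))\<^sup>2) \<partial>time_prod M T)
      + 2 * (\<integral>\<^sup>+z. ennreal ((norm (0 - Z (fst z) (snd z)))\<^sup>2) \<partial>time_prod M T)"
    using nn_integral_norm_diff_power2_le[OF V Z, of "\<lambda>_. 0"] by simp
  also have "\<dots> < \<infinity>"
  proof (rule ennreal_2_2_less_top)
    show "(\<integral>\<^sup>+z. ennreal ((norm (V z - Z (fst z) (snd z)))\<^sup>2) \<partial>time_prod M T) < \<infinity>"
      using order.strict_trans[OF k(1) ennreal_one_less_top] by (simp add: V_def norm_minus_commute)
    show "(\<integral>\<^sup>+z. ennreal ((norm (0 - Z (fst z) (snd z)))\<^sup>2) \<partial>time_prod M T) < \<infinity>"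
      using Z_int unfolding integrable_iff_bounded by simp
  qed
  finally have fin: "(\<integral>\<^sup>+\<omega>. ennreal ((norm (S \<omega>))\<^sup>2) \<partial>M) < \<infinity>" .
  have "(\<integral>\<^sup>+\<omega>. ennreal ((norm (J \<omega>))\<^sup>2) \<partial>M) \<le> 2 * (\<integral>\<^sup>+\<omega>. ennreal ((norm (J \<omega> - S \<omega>))\<^sup>2) \<partial>M) + 2 * (\<integral>\<^sup>+\<omega>. ennreal ((norm (0 - S \<omega>))\<^sup>2) \<partial>M)"
    using nn_integral_norm_diff_power2_le[OF J S, of "\<lambda>_. 0"] by simp
  also have "\<dots> < \<infinity>"
    by (rule ennreal_2_2_less_top)
       (use order.strict_trans[OF k(2) ennreal_one_less_top] fin in \<open>simp_all add: S_def\<close>)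
  finally show ?thesis
    by (intro integrableI_bounded) simp_all
qed

lemma square_integrable_inner:
  fixes X Y :: "'w \<Rightarrow> 'v::euclidean_space"
  assumes [measurable]: "X \<in> borel_measurable M" "Y \<in> borel_measurable M"
    and int: "integrable M (\<lambda>\<omega>. (norm (X \<omega>))\<^sup>2)" "integrable M (\<lambda>\<omega>. (norm (Y \<omega>))\<^sup>2)"
  shows "integrable M (\<lambda>\<omega>. X \<omega> \<bullet> Y \<omega>)"
proof (rule Bochner_Integration.integrable_bound[OF Bochner_Integration.integrable_add[OF int]])
  have "\<bar>X \<omega> \<bullet> Y \<omega>\<bar> \<le> (norm (X \<omega>))\<^sup>2 + (norm (Y \<omega>))\<^sup>2" for \<omega>
    using Cauchy_Schwarz_ineq2[of "X \<omega>" "Y \<omega>"] sum_squares_bound[of "norm (X \<omega>)" "norm (Y \<omega>)"]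
      mult_nonneg_nonneg[OF norm_ge_zero norm_ge_zero, of "X \<omega>" "Y \<omega>"] by linarith
  then show "AE \<omega> in M. norm (X \<omega> \<bullet> Y \<omega>) \<le> norm ((norm (X \<omega>))\<^sup>2 + (norm (Y \<omega>))\<^sup>2)"
    by simp
qed measurable

lemma square_integrable_diff:
  fixes X Y :: "'w \<Rightarrow> 'v::euclidean_space"
  assumes [measurable]: "X \<in> borel_measurable M" "Y \<in> borel_measurable M"
    and int: "integrable M (\<lambda>\<omega>. (norm (X \<omega>))\<^sup>2)" "integrable M (\<lambda>\<omega>. (norm (Y \<omega>))\<^sup>2)"
  shows "integrable M (\<lambda>\<omega>. (norm (X \<omega> - Y \<omega>))\<^sup>2)"
proof (rule Bochner_Integration.integrable_bound)
  show "integrable M (\<lambda>\<omega>. 2 * (norm (X \<omega>))\<^sup>2 + 2 * (norm (Y \<omega>))\<^sup>2)"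
    using int by simp
  show "AE \<omega> in M. norm ((norm (X \<omega> - Y \<omega>))\<^sup>2) \<le> norm (2 * (norm (X \<omega>))\<^sup>2 + 2 * (norm (Y \<omega>))\<^sup>2)"
    using norm_add_power2_le[of "X _" "- Y _"] by (intro AE_I2) simp
qed measurable

text \<open>The martingale property, tested with \<open>X\<close>. One sequence of step processes
  approximates the integrals at both t and \<open>T\<close>, and orthogonality passes to the limit
  by Cauchy-Schwarz.\<close>

lemma ito_orthogonal:
  fixes Z :: "real \<Rightarrow> 'w \<Rightarrow> real ^ 'd ^ 'k"
  assumes ito: "has_ito_integral M F T W Z t J" "has_ito_integral M F T W Z T J'" and t: "0 \<le> t" "t \<le> T"
    and X: "X \<in> borel_measurable (F t)" "integrable M (\<lambda>\<omega>. (norm (X \<omega>))\<^sup>2)"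
  shows "has_bochner_integral M (\<lambda>\<omega>. X \<omega> \<bullet> (J' \<omega> - J \<omega>)) 0"
proof -
  have T0: "0 \<le> T" using T by simp
  have XM [measurable]: "X \<in> borel_measurable M" by (rule F_measurable_M[OF X(1) t])
  have J [measurable]: "J \<in> borel_measurable M" "J' \<in> borel_measurable M"
    using ito by (auto simp: has_ito_integral_def)
  obtain N \<tau> \<xi> where step: "\<And>k. step_process M F T (N k) (\<tau> k) (\<xi> k)"
    and lim: "(\<lambda>k. \<integral>\<^sup>+(s, \<omega>). ennreal ((norm (Z s \<omega> - step_value (N k) (\<tau> k) (\<xi> k) s \<omega>))\<^sup>2) \<partial>time_prod M T) \<longlonglongrightarrow> 0"
    using ito(1) by (auto simp: has_ito_integral_def)
  define S S' where "S k = step_integral W (N k) (\<tau> k) (\<xi> k) t" and "S' k = step_integral W (N k) (\<tau> k) (\<xi> k) T" for k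
  have [measurable]: "S k \<in> borel_measurable M" "S' k \<in> borel_measurable M" for k
    unfolding S_def S'_def using step_integral_measurable[OF step] t T0 by auto
  have limS: "(\<lambda>k. \<integral>\<^sup>+\<omega>. ennreal ((norm (J \<omega> - S k \<omega>))\<^sup>2) \<partial>M) \<longlonglongrightarrow> 0"
    "(\<lambda>k. \<integral>\<^sup>+\<omega>. ennreal ((norm (J' \<omega> - S' k \<omega>))\<^sup>2) \<partial>M) \<longlonglongrightarrow> 0"
    unfolding S_def S'_def
    using has_ito_integral_consistent[OF ito(1) t step lim] has_ito_integral_consistent[OF ito(2) T0 order_refl step lim] by simp_all
  have int: "integrable M (\<lambda>\<omega>. X \<omega> \<bullet> (J' \<omega> - J \<omega>))"
    by (intro square_integrable_inner square_integrable_diff X(2) has_ito_integral_square_integrable[OF ito(1)]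
        has_ito_integral_square_integrable[OF ito(2)] t T0 order_refl) measurable
  have orth: "has_bochner_integral M (\<lambda>\<omega>. X \<omega> \<bullet> (S' k \<omega> - S k \<omega>)) 0" for k
    unfolding S_def S'_def by (rule step_integral_orthogonal[OF step t X])
  \<comment> \<open>The approximation error of the increment. Step increments are orthogonal to
    \<open>X\<close>, so pairing \<open>X\<close> with \<open>D k\<close> gives the same number
    \<open>m\<close> for every k, while \<open>D k\<close> tends to 0 in L2.\<close>
  define D where "D k \<omega> = (J' \<omega> - S' k \<omega>) - (J \<omega> - S k \<omega>)" for k \<omega>
  have [measurable]: "D k \<in> borel_measurable M" for k
    unfolding D_def[abs_def] by measurable
  have limD: "(\<lambda>k. \<integral>\<^sup>+\<omega>. ennreal ((norm (D k \<omega>))\<^sup>2) \<partial>M) \<longlonglongrightarrow> 0"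
  proof (rule tendsto_sandwich[OF _ always_eventually tendsto_const tendsto_ennreal_2_2_0[OF limS(2) limS(1)]])
    show "\<forall>k. (\<integral>\<^sup>+\<omega>. ennreal ((norm (D k \<omega>))\<^sup>2) \<partial>M) \<le>
        2 * (\<integral>\<^sup>+\<omega>. ennreal ((norm (J' \<omega> - S' k \<omega>))\<^sup>2) \<partial>M) + 2 * (\<integral>\<^sup>+\<omega>. ennreal ((norm (J \<omega> - S k \<omega>))\<^sup>2) \<partial>M)"
    proof
      fix k
      show "(\<integral>\<^sup>+\<omega>. ennreal ((norm (D k \<omega>))\<^sup>2) \<partial>M) \<le>
        2 * (\<integral>\<^sup>+\<omega>. ennreal ((norm (J' \<omega> - S' k \<omega>))\<^sup>2) \<partial>M) + 2 * (\<integral>\<^sup>+\<omega>. ennreal ((norm (J \<omega> - S k \<omega>))\<^sup>2) \<partial>M)"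
        using nn_integral_norm_add_power2_le[of "\<lambda>\<omega>. J' \<omega> - S' k \<omega>" M "\<lambda>\<omega>. S k \<omega> - J \<omega>"]
        by (simp add: D_def norm_minus_commute[of "S k _" "J _"] algebra_simps)
    qed
  qed simp
  define m where "m = expectation (\<lambda>\<omega>. X \<omega> \<bullet> (J' \<omega> - J \<omega>))"
  have "(ennreal \<bar>m\<bar>)\<^sup>2 \<le> (\<integral>\<^sup>+\<omega>. ennreal ((norm (X \<omega>))\<^sup>2) \<partial>M) * (\<integral>\<^sup>+\<omega>. ennreal ((norm (D k \<omega>))\<^sup>2) \<partial>M)" for k
  proof -
    have m: "has_bochner_integral M (\<lambda>\<omega>. X \<omega> \<bullet> D k \<omega>) m"
      using has_bochner_integral_diff[OF has_bochner_integral_integrable[OF int] orth[of k]]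
      by (simp add: D_def m_def inner_diff_right algebra_simps)
    have "ennreal \<bar>m\<bar> = ennreal (norm (expectation (\<lambda>\<omega>. X \<omega> \<bullet> D k \<omega>)))"
      using has_bochner_integral_integral_eq[OF m] by simp
    also have "\<dots> \<le> (\<integral>\<^sup>+\<omega>. ennreal (norm (X \<omega> \<bullet> D k \<omega>)) \<partial>M)"
      by (rule integral_norm_bound_ennreal[OF integrable.intros[OF m]])
    also have "\<dots> \<le> (\<integral>\<^sup>+\<omega>. ennreal (norm (X \<omega>)) * ennreal (norm (D k \<omega>)) \<partial>M)"
      by (intro nn_integral_mono) (simp add: ennreal_mult[symmetric] Cauchy_Schwarz_ineq2)
    finally have "(ennreal \<bar>m\<bar>)\<^sup>2 \<le> (\<integral>\<^sup>+\<omega>. ennreal (norm (X \<omega>)) * ennreal (norm (D k \<omega>)) \<partial>M)\<^sup>2"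
      by (rule power_mono) simp
    also have "\<dots> \<le> (\<integral>\<^sup>+\<omega>. (ennreal (norm (X \<omega>)))\<^sup>2 \<partial>M) * (\<integral>\<^sup>+\<omega>. (ennreal (norm (D k \<omega>)))\<^sup>2 \<partial>M)"
      by (rule Cauchy_Schwarz_nn_integral) measurable
    finally show ?thesis by (simp add: ennreal_power)
  qed
  moreover have "(\<lambda>k. (\<integral>\<^sup>+\<omega>. ennreal ((norm (X \<omega>))\<^sup>2) \<partial>M) * (\<integral>\<^sup>+\<omega>. ennreal ((norm (D k \<omega>))\<^sup>2) \<partial>M)) \<longlonglongrightarrow> 0"
  proof -
    have "(\<integral>\<^sup>+\<omega>. ennreal ((norm (X \<omega>))\<^sup>2) \<partial>M) < top"
      using X(2) unfolding integrable_iff_bounded by simp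
    from ennreal_tendsto_cmult[OF this limD] show ?thesis by simp
  qed
  ultimately have "(ennreal \<bar>m\<bar>)\<^sup>2 = 0"
    by (rule ennreal_le_null_sequence)
  then have "m = 0" by simp
  then show ?thesis
    using has_bochner_integral_integrable[OF int] by (simp add: m_def)
qed

lemma nn_integral_W_increment:
  assumes "0 \<le> u" "u \<le> v" "v \<le> T"
  shows "(\<integral>\<^sup>+\<omega>. ennreal ((norm (W v \<omega> - W u \<omega>))\<^sup>2) \<partial>M) = ennreal (real CARD('d) * (v - u))"
proof (cases "u = v")
  case False
  have "has_bochner_integral M (\<lambda>\<omega>. (W v \<omega> - W u \<omega>) $ i * (W v \<omega> - W u \<omega>) $ i) (v - u)" for i
    using W_covariance[of u v i i] assms False by (simp add: has_bochner_integral_iff)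
  then have "has_bochner_integral M (\<lambda>\<omega>. \<Sum>i\<in>UNIV. (W v \<omega> - W u \<omega>) $ i * (W v \<omega> - W u \<omega>) $ i) (\<Sum>i\<in>(UNIV :: 'd set). v - u)"
    by (intro has_bochner_integral_sum)
  then have "has_bochner_integral M (\<lambda>\<omega>. (norm (W v \<omega> - W u \<omega>))\<^sup>2) (real CARD('d) * (v - u))"
    unfolding norm_vec_power2 by (simp add: power2_eq_square)
  then show ?thesis
    by (subst nn_integral_eq_integral) (auto simp: has_bochner_integral_iff)
qed simp

lemma L2_adapted_continuousI:
  fixes X :: "real \<Rightarrow> 'w \<Rightarrow> 'v::euclidean_space"
  assumes meas: "\<And>t. t \<in> {0..T} \<Longrightarrow> X t \<in> borel_measurable (F t)"
    and cont: "\<And>\<omega>. \<omega> \<in> space M \<Longrightarrow> continuous_on {0..T} (\<lambda>t. X t \<omega>)"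
    and C: "\<And>t. t \<in> {0..T} \<Longrightarrow> (\<integral>\<^sup>+\<omega>. ennreal ((norm (X t \<omega>))\<^sup>2) \<partial>M) \<le> ennreal C"
  shows "L2_adapted M F T X"
proof -
  have XM: "X t \<in> borel_measurable M" if "t \<in> {0..T}" for t
    using F_measurable_M[OF meas[OF that]] that by simp
  have joint [measurable]: "(\<lambda>(t, \<omega>). X t \<omega>) \<in> borel_measurable (time_prod M T)"
    by (rule continuous_paths_jointly_measurable[OF less_imp_le[OF T] XM cont])
  have "(\<integral>\<^sup>+z. ennreal ((norm (case z of (t, \<omega>) \<Rightarrow> X t \<omega>))\<^sup>2) \<partial>time_prod M T)
      = (\<integral>\<^sup>+t. \<integral>\<^sup>+\<omega>. ennreal ((norm (X t \<omega>))\<^sup>2) \<partial>M \<partial>restrict_space lborel {0..T})"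
    by (subst nn_integral_time_prod) simp_all
  also have "\<dots> \<le> (\<integral>\<^sup>+t. ennreal C \<partial>restrict_space lborel {0..T})"
    by (intro nn_integral_mono C) (simp add: space_restrict_space)
  also have "\<dots> < \<infinity>"
    using T by (simp add: emeasure_restrict_space space_restrict_space ennreal_mult_less_top)
  finally have "integrable (time_prod M T) (\<lambda>z. (norm (case z of (t, \<omega>) \<Rightarrow> X t \<omega>))\<^sup>2)"
    by (intro integrableI_bounded) simp_all
  then show ?thesis
    using joint meas by (simp add: L2_adapted_def split_beta')
qed

section \<open>Ito integrals of differentiable functions of time\<close>

lemma derivative_has_integral:
  fixes Z :: "real \<Rightarrow> real ^ 'd ^ 'k"
  assumes Z: "\<And>s. s \<in> {0..T} \<Longrightarrow> (Z has_vector_derivative Z' s) (at s within {0..T})"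
    and ab: "0 \<le> a" "a \<le> b" "b \<le> T"
  shows "(Z' has_integral Z b - Z a) {a..b}"
  by (rule fundamental_theorem_of_calculus[OF ab(2)])
     (use ab in \<open>auto intro!: has_vector_derivative_within_subset[OF Z]\<close>)

text \<open>Integration by parts on each partition interval. The left-endpoint sum differs from the
  pathwise formula by integrals of Z' against the increment from s to the right end, which are small
  on short intervals.\<close>

lemma deterministic_ito_remainder:
  fixes Z :: "real \<Rightarrow> real ^ 'd ^ 'k"
  assumes Z: "\<And>s. s \<in> {0..T} \<Longrightarrow> (Z has_vector_derivative Z' s) (at s within {0..T})"
    and Z': "continuous_on {0..T} Z'" and t: "0 \<le> t" "t \<le> T"
    and \<tau>: "\<tau> 0 = 0" "\<tau> N = T" "\<And>i. i < N \<Longrightarrow> \<tau> i \<le> \<tau> (Suc i)"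
    and \<tau>_range: "\<And>i. i \<le> N \<Longrightarrow> 0 \<le> \<tau> i \<and> \<tau> i \<le> T" and \<omega>: "\<omega> \<in> space M"
  shows "Z t *v (W t \<omega> - W 0 \<omega>) - (LINT s:{0..t}|lborel. Z' s *v (W s \<omega> - W 0 \<omega>))
      - step_integral W N \<tau> (\<lambda>i \<omega>. Z (\<tau> i)) t \<omega>
    = (\<Sum>i<N. LINT s:{min t (\<tau> i)..min t (\<tau> (Suc i))}|lborel. Z' s *v (W (min t (\<tau> (Suc i))) \<omega> - W s \<omega>))"
proof -
  let ?w = "\<lambda>s. W s \<omega> - W 0 \<omega>"
  have cont: "continuous_on {a..b} (\<lambda>s. Z' s *v (c - W s \<omega>))" "continuous_on {a..b} (\<lambda>s. Z' s *v (W s \<omega> - c))"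
    if "0 \<le> a" "b \<le> T" for a b c
    by (intro continuous_intros continuous_on_subset[OF Z'] continuous_on_subset[OF W_continuous[OF \<omega>]]; use that in auto)+
  \<comment> \<open>The pathwise candidate for the integral up to u. Its increments telescope over
    the stopped partition, and \<open>piece\<close> computes each one up to the step term.\<close>
  define G where "G u = Z u *v ?w u - integral {0..u} (\<lambda>s. Z' s *v ?w s)" for u
  have piece: "G b - G a - Z a *v (W b \<omega> - W a \<omega>) = integral {a..b} (\<lambda>s. Z' s *v (W b \<omega> - W s \<omega>))"
    if ab: "0 \<le> a" "a \<le> b" "b \<le> T" for a b
  proof -
    have i1: "integral {0..b} (\<lambda>s. Z' s *v ?w s) = integral {0..a} (\<lambda>s. Z' s *v ?w s) + integral {a..b} (\<lambda>s. Z' s *v ?w s)"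
      by (rule Henstock_Kurzweil_Integration.integral_combine[symmetric])
         (use ab in \<open>auto intro!: integrable_continuous_real cont\<close>)
    have "((\<lambda>s. Z' s *v ?w b) has_integral (Z b - Z a) *v ?w b) {a..b}"
      using has_integral_linear[OF derivative_has_integral[OF Z ab]
          bounded_bilinear.bounded_linear_left[OF bounded_bilinear_matrix_vector_mult, of "?w b"]]
      by (simp add: o_def)
    moreover have "((\<lambda>s. Z' s *v ?w s) has_integral integral {a..b} (\<lambda>s. Z' s *v ?w s)) {a..b}"
      by (intro integrable_integral integrable_continuous_real cont) (use ab in auto)
    ultimately have "((\<lambda>s. Z' s *v ?w b - Z' s *v ?w s) has_integral
        (Z b - Z a) *v ?w b - integral {a..b} (\<lambda>s. Z' s *v ?w s)) {a..b}"
      by (rule has_integral_diff)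
    then have i2: "integral {a..b} (\<lambda>s. Z' s *v (W b \<omega> - W s \<omega>)) = (Z b - Z a) *v ?w b - integral {a..b} (\<lambda>s. Z' s *v ?w s)"
      by (intro integral_unique) (simp add: matrix_vector_mult_diff_distrib[symmetric])
    show ?thesis
      unfolding G_def i1 i2 by (simp add: matrix_vector_mult_diff_distrib matrix_vector_mult_diff_rdistrib)
  qed
  have "Z t *v ?w t - (LINT s:{0..t}|lborel. Z' s *v ?w s) = G (min t (\<tau> N)) - G (min t (\<tau> 0))"
    using t \<tau> set_integral_continuous_eq_integral(1)[OF cont(2)[of 0 t "W 0 \<omega>"]] by (simp add: G_def min_def)
  also have "\<dots> = (\<Sum>i<N. G (min t (\<tau> (Suc i))) - G (min t (\<tau> i)))"
    by (rule sum_lessThan_telescope[symmetric])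
  finally have "Z t *v ?w t - (LINT s:{0..t}|lborel. Z' s *v ?w s) - step_integral W N \<tau> (\<lambda>i \<omega>. Z (\<tau> i)) t \<omega>
    = (\<Sum>i<N. G (min t (\<tau> (Suc i))) - G (min t (\<tau> i)) - Z (\<tau> i) *v (W (min t (\<tau> (Suc i))) \<omega> - W (min t (\<tau> i)) \<omega>))"
    by (simp add: step_integral_def sum_subtractf)
  also have "\<dots> = (\<Sum>i<N. LINT s:{min t (\<tau> i)..min t (\<tau> (Suc i))}|lborel. Z' s *v (W (min t (\<tau> (Suc i))) \<omega> - W s \<omega>))"
  proof (intro sum.cong refl)
    fix i assume "i \<in> {..<N}"
    then have i: "0 \<le> \<tau> i" "\<tau> i \<le> \<tau> (Suc i)" "\<tau> (Suc i) \<le> T"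
      using \<tau>(3) \<tau>_range[of i] \<tau>_range[of "Suc i"] by auto
    then have ab: "0 \<le> min t (\<tau> i)" "min t (\<tau> i) \<le> min t (\<tau> (Suc i))" "min t (\<tau> (Suc i)) \<le> T"
      using t by auto
    \<comment> \<open>If \<tau> i lies beyond t, both stopped points equal t and the increment is 0,
      so the place at which Z is evaluated does not matter.\<close>
    have "Z (\<tau> i) *v (W (min t (\<tau> (Suc i))) \<omega> - W (min t (\<tau> i)) \<omega>) = Z (min t (\<tau> i)) *v (W (min t (\<tau> (Suc i))) \<omega> - W (min t (\<tau> i)) \<omega>)"
      using i by (cases "\<tau> i \<le> t") (auto simp: min_def)
    then show "G (min t (\<tau> (Suc i))) - G (min t (\<tau> i)) - Z (\<tau> i) *v (W (min t (\<tau> (Suc i))) \<omega> - W (min t (\<tau> i)) \<omega>) =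
        (LINT s:{min t (\<tau> i)..min t (\<tau> (Suc i))}|lborel. Z' s *v (W (min t (\<tau> (Suc i))) \<omega> - W s \<omega>))"
      using piece[OF ab] set_integral_continuous_eq_integral(1)[OF cont(1)[OF ab(1,3)]] by simp
  qed
  finally show ?thesis .
qed

lemma uniform_partition_step_process:
  fixes Z :: "real \<Rightarrow> real ^ 'd ^ 'k"
  defines "\<tau> \<equiv> \<lambda>n i. real i * T / real (Suc n)"
  shows "step_process M F T (Suc n) (\<tau> n) (\<lambda>i \<omega>. Z (\<tau> n i))"
  using T by (auto simp: step_process_def \<tau>_def divide_right_mono simp del: of_nat_Suc intro!: mult_right_mono)

text \<open>Z is Lipschitz, so its left-endpoint values on uniform partitions converge uniformly for
  s > 0. Each of the n + 1 remainder terms has second moment of order h^3, and the Cauchy-Schwarz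
  bound for their sum costs (n + 1)^2, which leaves order h. The integral thus has a version given
  by an explicit formula in each path.\<close>

lemma deterministic_ito:
  fixes Z :: "real \<Rightarrow> real ^ 'd ^ 'k"
  assumes Z: "\<And>s. s \<in> {0..T} \<Longrightarrow> (Z has_vector_derivative Z' s) (at s within {0..T})"
    and Z': "continuous_on {0..T} Z'" and t: "0 \<le> t" "t \<le> T"
  shows "has_ito_integral M F T W (\<lambda>s \<omega>. Z s) t
    (\<lambda>\<omega>. Z t *v (W t \<omega> - W 0 \<omega>) - (LINT s:{0..t}|lborel. Z' s *v (W s \<omega> - W 0 \<omega>)))"
proof -
  note T0 = less_imp_le[OF T]
  define \<tau> where "\<tau> n i = real i * T / real (Suc n)" for n i
  define h where "h n = T / real (Suc n)" for n
  have h: "0 \<le> h n" for n using T by (simp add: h_def)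
  have h_lim: "h \<longlonglongrightarrow> 0"
    unfolding h_def[abs_def] by (rule LIMSEQ_Suc[OF lim_const_over_n])
  have step: "step_process M F T (Suc n) (\<tau> n) (\<lambda>i \<omega>. Z (\<tau> n i))" for n
    unfolding \<tau>_def by (rule uniform_partition_step_process)
  have mesh: "\<tau> n (Suc i) = \<tau> n i + h n" for n i
    by (simp add: \<tau>_def h_def distrib_right add_divide_distrib)
  have \<tau>_ends: "\<tau> n 0 = 0" "\<tau> n (Suc n) = T" for n
    by (simp_all add: \<tau>_def del: of_nat_Suc)
  have range: "0 \<le> \<tau> n i" "\<tau> n i \<le> T" if "i \<le> Suc n" for n i
    using step_process_times[OF step that] by simp_all
  have cont_Z: "continuous_on {0..T} Z"
    by (rule continuous_on_vector_derivative[OF Z])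
  obtain B where B: "B \<ge> 0" "\<And>s v. s \<in> {0..T} \<Longrightarrow> norm (Z' s *v v) \<le> B * norm v"
    using matrix_vector_mult_norm_bound[OF Z'] by metis
  have "bounded (Z' ` {0..T})"
    by (intro compact_imp_bounded compact_continuous_image Z') simp
  then obtain L where L: "\<And>s. s \<in> {0..T} \<Longrightarrow> norm (Z' s) \<le> L"
    unfolding bounded_iff by (meson imageI)
  then have "L \<ge> 0" using T0 norm_ge_zero order_trans by (metis atLeastAtMost_iff order_refl)
  have lip: "norm (Z b - Z a) \<le> L * (b - a)" if ab: "0 \<le> a" "a \<le> b" "b \<le> T" for a b
    using has_integral_bound[OF \<open>L \<ge> 0\<close>, of Z' "Z b - Z a" a b] derivative_has_integral[OF Z ab] L ab
    by (simp add: cbox_interval)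
  have value_bound: "norm (Z s - step_value (Suc n) (\<tau> n) (\<lambda>i \<omega>. Z (\<tau> n i)) s \<omega>) \<le> L * h n"
    if s: "0 < s" "s \<le> T" for s n \<omega>
  proof -
    have ind: "(\<Sum>i<Suc n. indicator {\<tau> n i<..\<tau> n (Suc i)} s) = (1 :: real)"
    proof -
      have "(\<Sum>i<Suc n. indicator {\<tau> n i<..\<tau> n (Suc i)} s) = (indicator {\<tau> n 0<..\<tau> n (Suc n)} s :: real)"
        by (rule indicator_partition_sum[THEN conjunct2]) (simp add: mesh h)
      then show ?thesis unfolding \<tau>_ends using s by simp
    qed
    have "Z s - step_value (Suc n) (\<tau> n) (\<lambda>i \<omega>. Z (\<tau> n i)) s \<omega>
        = (\<Sum>i<Suc n. indicator {\<tau> n i<..\<tau> n (Suc i)} s *\<^sub>R (Z s - Z (\<tau> n i)))"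
      unfolding step_value_def scaleR_diff_right sum_subtractf scaleR_sum_left[symmetric] ind by simp
    also have "norm \<dots> \<le> (\<Sum>i<Suc n. indicator {\<tau> n i<..\<tau> n (Suc i)} s * (L * h n))"
    proof (rule sum_norm_le)
      fix i assume i: "i \<in> {..<Suc n}"
      show "norm (indicator {\<tau> n i<..\<tau> n (Suc i)} s *\<^sub>R (Z s - Z (\<tau> n i))) \<le> indicator {\<tau> n i<..\<tau> n (Suc i)} s * (L * h n)"
      proof (cases "s \<in> {\<tau> n i<..\<tau> n (Suc i)}")
        case True
        then have "norm (Z s - Z (\<tau> n i)) \<le> L * (s - \<tau> n i)"
          by (intro lip) (use i s range[of i n] in auto)
        also have "\<dots> \<le> L * h n"
          using True \<open>L \<ge> 0\<close> by (intro mult_left_mono) (auto simp: mesh)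
        finally show ?thesis using True by simp
      qed simp
    qed
    also have "\<dots> = L * h n"
      unfolding sum_distrib_right[symmetric] ind by simp
    finally show ?thesis .
  qed
  have limZ: "(\<lambda>n. \<integral>\<^sup>+(s, \<omega>). ennreal ((norm (Z s - step_value (Suc n) (\<tau> n) (\<lambda>i \<omega>. Z (\<tau> n i)) s \<omega>))\<^sup>2) \<partial>time_prod M T) \<longlonglongrightarrow> 0"
  proof (rule tendsto_sandwich[OF _ always_eventually tendsto_const])
    show "\<forall>n. (\<integral>\<^sup>+(s, \<omega>). ennreal ((norm (Z s - step_value (Suc n) (\<tau> n) (\<lambda>i \<omega>. Z (\<tau> n i)) s \<omega>))\<^sup>2) \<partial>time_prod M T)
        \<le> ennreal ((L * h n)\<^sup>2 * T)"
    proof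
      fix n
      have Z_meas: "(\<lambda>z. Z (fst z)) \<in> borel_measurable (time_prod M T)"
        using continuous_paths_jointly_measurable[OF T0, of "\<lambda>s \<omega>. Z s" M] cont_Z by (simp add: split_beta')
      have [measurable]: "(\<lambda>z. Z (fst z) - step_value (Suc n) (\<tau> n) (\<lambda>i \<omega>. Z (\<tau> n i)) (fst z) (snd z)) \<in> borel_measurable (time_prod M T)"
        by (rule borel_measurable_diff[OF Z_meas step_value_measurable[OF step]])
      have "(\<integral>\<^sup>+z. ennreal ((norm (Z (fst z) - step_value (Suc n) (\<tau> n) (\<lambda>i \<omega>. Z (\<tau> n i)) (fst z) (snd z)))\<^sup>2) \<partial>time_prod M T)
          = (\<integral>\<^sup>+s. \<integral>\<^sup>+\<omega>. ennreal ((norm (Z s - step_value (Suc n) (\<tau> n) (\<lambda>i \<omega>. Z (\<tau> n i)) s \<omega>))\<^sup>2) \<partial>M \<partial>restrict_space lborel {0..T})"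
        by (subst nn_integral_time_prod) simp_all
      also have "\<dots> \<le> (\<integral>\<^sup>+s. ennreal ((L * h n)\<^sup>2) \<partial>restrict_space lborel {0..T})"
      proof (rule nn_integral_mono_AE)
        \<comment> \<open>The half-open intervals of a step process do not contain 0, so the step
          value there is 0 and the uniform bound may fail; this point is a null set.\<close>
        have "AE s in lborel. s \<in> {0..T} \<longrightarrow> 0 < s"
          using AE_lborel_singleton[of 0] by eventually_elim auto
        then have "AE s in restrict_space lborel {0..T}. 0 < s"
          by (subst AE_restrict_space_iff) auto
        moreover have "AE s in restrict_space lborel {0..T}. s \<in> {0..T}"
          by (rule AE_I2) (simp add: space_restrict_space)
        ultimately show "AE s in restrict_space lborel {0..T}.
            (\<integral>\<^sup>+\<omega>. ennreal ((norm (Z s - step_value (Suc n) (\<tau> n) (\<lambda>i \<omega>. Z (\<tau> n i)) s \<omega>))\<^sup>2) \<partial>M) \<le> ennreal ((L * h n)\<^sup>2)"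
        proof eventually_elim
          case (elim s)
          have "(\<integral>\<^sup>+\<omega>. ennreal ((norm (Z s - step_value (Suc n) (\<tau> n) (\<lambda>i \<omega>. Z (\<tau> n i)) s \<omega>))\<^sup>2) \<partial>M) \<le> (\<integral>\<^sup>+\<omega>. ennreal ((L * h n)\<^sup>2) \<partial>M)"
            using elim by (intro nn_integral_mono ennreal_leI power_mono value_bound) auto
          then show ?case by (simp add: emeasure_space_1)
        qed
      qed
      also have "\<dots> = ennreal ((L * h n)\<^sup>2 * T)"
        using T by (simp add: emeasure_restrict_space space_restrict_space ennreal_mult)
      finally show "(\<integral>\<^sup>+(s, \<omega>). ennreal ((norm (Z s - step_value (Suc n) (\<tau> n) (\<lambda>i \<omega>. Z (\<tau> n i)) s \<omega>))\<^sup>2) \<partial>time_prod M T)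
        \<le> ennreal ((L * h n)\<^sup>2 * T)"
        by (simp add: split_beta')
    qed
    have "(\<lambda>n. (L * h n)\<^sup>2 * T) \<longlonglongrightarrow> (L * 0)\<^sup>2 * T"
      by (intro tendsto_intros h_lim)
    then show "(\<lambda>n. ennreal ((L * h n)\<^sup>2 * T)) \<longlonglongrightarrow> 0"
      using tendsto_ennrealI by fastforce
  qed simp
  define J where "J \<omega> = Z t *v (W t \<omega> - W 0 \<omega>) - (LINT s:{0..t}|lborel. Z' s *v (W s \<omega> - W 0 \<omega>))" for \<omega>
  have paths: "(\<lambda>(s, \<omega>). Z' s *v (c \<omega> - W s \<omega>)) \<in> borel_measurable (restrict_space lborel {a..b} \<Otimes>\<^sub>M M)"
    if "0 \<le> a" "a \<le> b" "b \<le> T" and [measurable]: "c \<in> borel_measurable M" for a b and c :: "'w \<Rightarrow> real ^ 'd"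
  proof (rule continuous_paths_jointly_measurable[OF that(2)])
    show "(\<lambda>\<omega>. Z' s *v (c \<omega> - W s \<omega>)) \<in> borel_measurable M" if "s \<in> {a..b}" for s
      using that \<open>0 \<le> a\<close> \<open>b \<le> T\<close>
      by (intro borel_measurable_matrix_vector_mult borel_measurable_const borel_measurable_diff W_measurable) auto
    show "continuous_on {a..b} (\<lambda>s. Z' s *v (c \<omega> - W s \<omega>))" if "\<omega> \<in> space M" for \<omega>
      using \<open>0 \<le> a\<close> \<open>b \<le> T\<close>
      by (intro continuous_intros continuous_on_subset[OF Z'] continuous_on_subset[OF W_continuous[OF that]]) auto
  qed
  have J_meas: "J \<in> borel_measurable M"
  proof -
    have "(\<lambda>\<omega>. LINT s:{0..t}|lborel. Z' s *v (W 0 \<omega> - W s \<omega>)) \<in> borel_measurable M"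
      by (rule borel_measurable_set_integral_paths[OF paths]) (use t T0 in \<open>auto intro: W_measurable\<close>)
    moreover have "(LINT s:{0..t}|lborel. Z' s *v (W s \<omega> - W 0 \<omega>)) = - (LINT s:{0..t}|lborel. Z' s *v (W 0 \<omega> - W s \<omega>))" for \<omega>
      unfolding set_lebesgue_integral_def integral_minus[symmetric]
      by (simp add: scaleR_minus_right[symmetric] matrix_vector_mult_diff_distrib del: scaleR_minus_right)
    ultimately show ?thesis
      unfolding J_def[abs_def]
      by (simp only:) (intro borel_measurable_diff borel_measurable_uminus borel_measurable_matrix_vector_mult borel_measurable_const W_measurable t T0 order_refl; assumption)
  qed
  have limJ: "(\<lambda>n. \<integral>\<^sup>+\<omega>. ennreal ((norm (J \<omega> - step_integral W (Suc n) (\<tau> n) (\<lambda>i \<omega>. Z (\<tau> n i)) t \<omega>))\<^sup>2) \<partial>M) \<longlonglongrightarrow> 0"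
  proof (rule tendsto_sandwich[OF _ always_eventually tendsto_const])
    \<comment> \<open>B bounds the action of Z', and an increment of length h has second moment
      CARD('d) h.\<close>
    define c where "c = B\<^sup>2 * real CARD('d)"
    have "c \<ge> 0" by (simp add: c_def)
    show "\<forall>n. (\<integral>\<^sup>+\<omega>. ennreal ((norm (J \<omega> - step_integral W (Suc n) (\<tau> n) (\<lambda>i \<omega>. Z (\<tau> n i)) t \<omega>))\<^sup>2) \<partial>M) \<le> ennreal (T\<^sup>2 * c * h n)"
    proof
      fix n
      define a b where "a i = min t (\<tau> n i)" and "b i = min t (\<tau> n (Suc i))" for i
      define e where "e i \<omega> = (LINT s:{a i..b i}|lborel. Z' s *v (W (b i) \<omega> - W s \<omega>))" for i \<omega>
      have ab: "0 \<le> a i" "a i \<le> b i" "b i \<le> T" "b i - a i \<le> h n" if "i < Suc n" for i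
        using that range[of i n] range[of "Suc i" n] t h[of n] by (auto simp: a_def b_def mesh)
      have joint: "(\<lambda>(s, \<omega>). Z' s *v (W (b i) \<omega> - W s \<omega>)) \<in> borel_measurable (restrict_space lborel {a i..b i} \<Otimes>\<^sub>M M)" if "i < Suc n" for i
        by (rule paths[OF ab(1,2,3)[OF that] W_measurable]) (use ab[OF that] in auto)
      have e_meas [measurable]: "e i \<in> borel_measurable M" if "i < Suc n" for i
        unfolding e_def[abs_def] by (rule borel_measurable_set_integral_paths[OF joint[OF that]])
      have e_bound: "(\<integral>\<^sup>+\<omega>. ennreal ((norm (e i \<omega>))\<^sup>2) \<partial>M) \<le> ennreal ((h n)\<^sup>2 * (c * h n))" if i: "i < Suc n" for i
      proof -
        have "(\<integral>\<^sup>+\<omega>. ennreal ((norm (e i \<omega>))\<^sup>2) \<partial>M) \<le> ennreal ((b i - a i)\<^sup>2) * ennreal (c * h n)"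
          unfolding e_def
        proof (rule nn_integral_set_integral_power2_le_const[OF ab(2)[OF i] joint[OF i]])
          fix s assume s: "s \<in> {a i..b i}"
          then have s': "0 \<le> s" "s \<le> b i" "s \<le> T" using ab[OF i] by auto
          have "(\<integral>\<^sup>+\<omega>. ennreal ((norm (Z' s *v (W (b i) \<omega> - W s \<omega>)))\<^sup>2) \<partial>M) \<le> (\<integral>\<^sup>+\<omega>. ennreal (B\<^sup>2) * ennreal ((norm (W (b i) \<omega> - W s \<omega>))\<^sup>2) \<partial>M)"
          proof (rule nn_integral_mono)
            fix \<omega>
            have "(norm (Z' s *v (W (b i) \<omega> - W s \<omega>)))\<^sup>2 \<le> (B * norm (W (b i) \<omega> - W s \<omega>))\<^sup>2"
              by (intro power_mono B(2)) (use s' in auto)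
            then show "ennreal ((norm (Z' s *v (W (b i) \<omega> - W s \<omega>)))\<^sup>2) \<le> ennreal (B\<^sup>2) * ennreal ((norm (W (b i) \<omega> - W s \<omega>))\<^sup>2)"
              by (simp add: ennreal_mult[symmetric] power_mult_distrib ennreal_leI)
          qed
          also have "\<dots> = ennreal (B\<^sup>2) * ennreal (real CARD('d) * (b i - s))"
            using W_measurable[of s] W_measurable[of "b i"] s' ab[OF i]
            by (subst nn_integral_cmult) (auto simp: nn_integral_W_increment)
          also have "\<dots> \<le> ennreal (c * h n)"
            using s s' ab[OF i] h[of n]
            by (auto simp: ennreal_mult[symmetric] c_def mult.assoc intro!: ennreal_leI mult_left_mono)
          finally show "(\<integral>\<^sup>+\<omega>. ennreal ((norm (Z' s *v (W (b i) \<omega> - W s \<omega>)))\<^sup>2) \<partial>M) \<le> ennreal (c * h n)" .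
        qed
        also have "\<dots> \<le> ennreal ((h n)\<^sup>2) * ennreal (c * h n)"
          using ab[OF i] by (intro mult_right_mono ennreal_leI power_mono) auto
        also have "\<dots> = ennreal ((h n)\<^sup>2 * (c * h n))"
          using h[of n] \<open>c \<ge> 0\<close> by (simp add: ennreal_mult)
        finally show ?thesis .
      qed
      have "(\<integral>\<^sup>+\<omega>. ennreal ((norm (J \<omega> - step_integral W (Suc n) (\<tau> n) (\<lambda>i \<omega>. Z (\<tau> n i)) t \<omega>))\<^sup>2) \<partial>M)
          = (\<integral>\<^sup>+\<omega>. ennreal ((norm (\<Sum>i<Suc n. e i \<omega>))\<^sup>2) \<partial>M)"
        unfolding J_def e_def a_def b_def
        by (intro nn_integral_cong arg_cong[where f = ennreal] arg_cong[where f = "\<lambda>v. (norm v)\<^sup>2"]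
            deterministic_ito_remainder[OF Z Z' t]) (use range h in \<open>auto simp: \<tau>_ends mesh\<close>)
      also have "\<dots> \<le> (\<integral>\<^sup>+\<omega>. ennreal (real (Suc n)) * (\<Sum>i<Suc n. ennreal ((norm (e i \<omega>))\<^sup>2)) \<partial>M)"
      proof (rule nn_integral_mono)
        fix \<omega>
        have "(norm (\<Sum>i<Suc n. e i \<omega>))\<^sup>2 \<le> real (Suc n) * (\<Sum>i<Suc n. (norm (e i \<omega>))\<^sup>2)"
          using norm_sum_power2_le[of "\<lambda>i. e i \<omega>" "{..<Suc n}"] by simp
        then show "ennreal ((norm (\<Sum>i<Suc n. e i \<omega>))\<^sup>2) \<le> ennreal (real (Suc n)) * (\<Sum>i<Suc n. ennreal ((norm (e i \<omega>))\<^sup>2))"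
          by (subst sum_ennreal) (simp_all add: ennreal_mult[symmetric] ennreal_leI sum_nonneg del: sum.lessThan_Suc of_nat_Suc)
      qed
      also have "\<dots> = ennreal (real (Suc n)) * (\<Sum>i<Suc n. \<integral>\<^sup>+\<omega>. ennreal ((norm (e i \<omega>))\<^sup>2) \<partial>M)"
      proof -
        have m: "(\<lambda>\<omega>. ennreal ((norm (e i \<omega>))\<^sup>2)) \<in> borel_measurable M" if "i \<in> {..<Suc n}" for i
          using e_meas[of i] that by simp
        have "(\<integral>\<^sup>+\<omega>. (\<Sum>i<Suc n. ennreal ((norm (e i \<omega>))\<^sup>2)) \<partial>M) = (\<Sum>i<Suc n. \<integral>\<^sup>+\<omega>. ennreal ((norm (e i \<omega>))\<^sup>2) \<partial>M)"
          by (rule nn_integral_sum[OF m])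
        then show ?thesis
          by (simp only: nn_integral_cmult[OF borel_measurable_sum[OF m]])
      qed
      also have "\<dots> \<le> ennreal (real (Suc n)) * (\<Sum>i<Suc n. ennreal ((h n)\<^sup>2 * (c * h n)))"
        by (intro mult_left_mono sum_mono e_bound) auto
      also have "\<dots> = ennreal (real (Suc n) * (real (Suc n) * ((h n)\<^sup>2 * (c * h n))))"
        using h[of n] \<open>c \<ge> 0\<close> by (subst sum_ennreal) (simp_all add: ennreal_mult[symmetric] del: sum.lessThan_Suc of_nat_Suc)
      \<comment> \<open>Since (n + 1) h = T, both factors n + 1 are absorbed and one power of h
        remains.\<close>
      also have "real (Suc n) * (real (Suc n) * ((h n)\<^sup>2 * (c * h n))) = T\<^sup>2 * c * h n"
        by (simp add: h_def power2_eq_square del: of_nat_Suc)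
      finally show "(\<integral>\<^sup>+\<omega>. ennreal ((norm (J \<omega> - step_integral W (Suc n) (\<tau> n) (\<lambda>i \<omega>. Z (\<tau> n i)) t \<omega>))\<^sup>2) \<partial>M) \<le> ennreal (T\<^sup>2 * c * h n)" .
    qed
    have "(\<lambda>n. T\<^sup>2 * c * h n) \<longlonglongrightarrow> T\<^sup>2 * c * 0"
      by (intro tendsto_intros h_lim)
    then show "(\<lambda>n. ennreal (T\<^sup>2 * c * h n)) \<longlonglongrightarrow> 0"
      using tendsto_ennrealI by fastforce
  qed simp
  have "L2_adapted M F T (\<lambda>s \<omega>. Z s)"
  proof -
    have "bounded (Z ` {0..T})"
      by (intro compact_imp_bounded compact_continuous_image cont_Z) simp
    then obtain K where K: "\<And>s. s \<in> {0..T} \<Longrightarrow> norm (Z s) \<le> K"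
      unfolding bounded_iff by (meson imageI)
    show ?thesis
      by (rule L2_adapted_continuousI[where C = "K\<^sup>2"])
         (use cont_Z K in \<open>auto simp: emeasure_space_1 intro!: ennreal_leI power_mono\<close>)
  qed
  then show ?thesis
    unfolding has_ito_integral_def J_def[symmetric] using J_meas step limZ limJ
    by (intro conjI exI[of _ "\<lambda>n. Suc n"] exI[of _ \<tau>] exI[of _ "\<lambda>n i \<omega>. Z (\<tau> n i)"]) auto
qed

end

section \<open>Existence of solutions\<close>

lemma continuous_on_indefinite_integral:
  fixes f :: "real \<Rightarrow> 'v::euclidean_space"
  assumes "continuous_on {a..b} f"
  shows "continuous_on {a..b} (\<lambda>t. integral {a..t} f)"
  by (rule indefinite_integral_continuous_1[OF integrable_continuous_real[OF assms]])

context filtered_wiener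
begin

text \<open>A bound on second moments uniform in time. It is stable under the operations that build
  the solution and, for adapted processes with continuous paths, implies \<open>L2_adapted\<close>.
  The form \<open>ennreal C\<close> makes the bound finite.\<close>

definition L2_bounded :: "(real \<Rightarrow> 'w \<Rightarrow> 'v::euclidean_space) \<Rightarrow> bool" where
  "L2_bounded X \<longleftrightarrow> (\<exists>C. \<forall>t\<in>{0..T}. (\<integral>\<^sup>+\<omega>. ennreal ((norm (X t \<omega>))\<^sup>2) \<partial>M) \<le> ennreal C)"

lemma L2_boundedI:
  assumes "\<And>t. t \<in> {0..T} \<Longrightarrow> (\<integral>\<^sup>+\<omega>. ennreal ((norm (X t \<omega>))\<^sup>2) \<partial>M) \<le> ennreal C"
  shows "L2_bounded X"
  using assms unfolding L2_bounded_def by blast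

lemma L2_boundedE:
  assumes "L2_bounded X"
  obtains C where "C \<ge> 0" "\<And>t. t \<in> {0..T} \<Longrightarrow> (\<integral>\<^sup>+\<omega>. ennreal ((norm (X t \<omega>))\<^sup>2) \<partial>M) \<le> ennreal C"
proof -
  obtain C where C: "\<And>t. t \<in> {0..T} \<Longrightarrow> (\<integral>\<^sup>+\<omega>. ennreal ((norm (X t \<omega>))\<^sup>2) \<partial>M) \<le> ennreal C"
    using assms unfolding L2_bounded_def by blast
  show thesis
    by (rule that[of "max 0 C"]) (auto intro: order_trans[OF C] ennreal_leI)
qed

lemma L2_bounded_add:
  assumes "L2_bounded X" "L2_bounded Y" and meas: "\<And>t. t \<in> {0..T} \<Longrightarrow> X t \<in> borel_measurable M" "\<And>t. t \<in> {0..T} \<Longrightarrow> Y t \<in> borel_measurable M"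
  shows "L2_bounded (\<lambda>t \<omega>. X t \<omega> + Y t \<omega>)"
proof -
  obtain C where C: "C \<ge> 0" "\<And>t. t \<in> {0..T} \<Longrightarrow> (\<integral>\<^sup>+\<omega>. ennreal ((norm (X t \<omega>))\<^sup>2) \<partial>M) \<le> ennreal C"
    using L2_boundedE[OF assms(1)] by metis
  obtain D where D: "D \<ge> 0" "\<And>t. t \<in> {0..T} \<Longrightarrow> (\<integral>\<^sup>+\<omega>. ennreal ((norm (Y t \<omega>))\<^sup>2) \<partial>M) \<le> ennreal D"
    using L2_boundedE[OF assms(2)] by metis
  show ?thesis
  proof (rule L2_boundedI)
    fix t assume t: "t \<in> {0..T}"
    have "(\<integral>\<^sup>+\<omega>. ennreal ((norm (X t \<omega> + Y t \<omega>))\<^sup>2) \<partial>M) \<le> 2 * (\<integral>\<^sup>+\<omega>. ennreal ((norm (X t \<omega>))\<^sup>2) \<partial>M) + 2 * (\<integral>\<^sup>+\<omega>. ennreal ((norm (Y t \<omega>))\<^sup>2) \<partial>M)"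
      by (rule nn_integral_norm_add_power2_le[OF meas(1)[OF t] meas(2)[OF t]])
    also have "\<dots> \<le> 2 * ennreal C + 2 * ennreal D"
      by (intro add_mono mult_left_mono C D t) auto
    also have "\<dots> = ennreal (2 * C + 2 * D)"
      using C(1) D(1) by (simp add: ennreal_mult ennreal_plus)
    finally show "(\<integral>\<^sup>+\<omega>. ennreal ((norm (X t \<omega> + Y t \<omega>))\<^sup>2) \<partial>M) \<le> ennreal (2 * C + 2 * D)" .
  qed
qed

lemma L2_bounded_mult:
  fixes G :: "real \<Rightarrow> real ^ 'm ^ 'n"
  assumes "L2_bounded X" and G: "continuous_on {0..T} G" and meas: "\<And>t. t \<in> {0..T} \<Longrightarrow> X t \<in> borel_measurable M"
  shows "L2_bounded (\<lambda>t \<omega>. G t *v X t \<omega>)"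
proof -
  obtain C where C: "C \<ge> 0" "\<And>t. t \<in> {0..T} \<Longrightarrow> (\<integral>\<^sup>+\<omega>. ennreal ((norm (X t \<omega>))\<^sup>2) \<partial>M) \<le> ennreal C"
    using L2_boundedE[OF assms(1)] by metis
  obtain B where B: "B \<ge> 0" "\<And>s v. s \<in> {0..T} \<Longrightarrow> norm (G s *v v) \<le> B * norm v"
    using matrix_vector_mult_norm_bound[OF G] by metis
  show ?thesis
  proof (rule L2_boundedI)
    fix t assume t: "t \<in> {0..T}"
    note [measurable] = meas[OF t]
    have "(\<integral>\<^sup>+\<omega>. ennreal ((norm (G t *v X t \<omega>))\<^sup>2) \<partial>M) \<le> (\<integral>\<^sup>+\<omega>. ennreal (B\<^sup>2) * ennreal ((norm (X t \<omega>))\<^sup>2) \<partial>M)"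
    proof (rule nn_integral_mono)
      fix \<omega>
      have "(norm (G t *v X t \<omega>))\<^sup>2 \<le> (B * norm (X t \<omega>))\<^sup>2"
        by (intro power_mono B(2) t norm_ge_zero)
      then show "ennreal ((norm (G t *v X t \<omega>))\<^sup>2) \<le> ennreal (B\<^sup>2) * ennreal ((norm (X t \<omega>))\<^sup>2)"
        by (simp add: ennreal_mult[symmetric] power_mult_distrib ennreal_leI)
    qed
    also have "\<dots> = ennreal (B\<^sup>2) * (\<integral>\<^sup>+\<omega>. ennreal ((norm (X t \<omega>))\<^sup>2) \<partial>M)"
      by (rule nn_integral_cmult) measurable
    also have "\<dots> \<le> ennreal (B\<^sup>2) * ennreal C"
      by (intro mult_left_mono C t) simp
    also have "\<dots> = ennreal (B\<^sup>2 * C)"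
      using C(1) by (simp add: ennreal_mult)
    finally show "(\<integral>\<^sup>+\<omega>. ennreal ((norm (G t *v X t \<omega>))\<^sup>2) \<partial>M) \<le> ennreal (B\<^sup>2 * C)" .
  qed
qed

lemma L2_bounded_deterministic:
  fixes g :: "real \<Rightarrow> 'v::euclidean_space"
  assumes "continuous_on {0..T} g"
  shows "L2_bounded (\<lambda>t \<omega>. g t)"
proof -
  have "bounded (g ` {0..T})"
    by (intro compact_imp_bounded compact_continuous_image assms) simp
  then obtain K where "\<And>s. s \<in> {0..T} \<Longrightarrow> norm (g s) \<le> K"
    unfolding bounded_iff by (meson imageI)
  then show ?thesis
    by (intro L2_boundedI[of _ "K\<^sup>2"]) (auto simp: emeasure_space_1 intro!: ennreal_leI power_mono)
qed

lemma L2_bounded_const: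
  fixes \<xi> :: "'w \<Rightarrow> 'v::euclidean_space"
  assumes "integrable M (\<lambda>\<omega>. (norm (\<xi> \<omega>))\<^sup>2)"
  shows "L2_bounded (\<lambda>t. \<xi>)"
  by (rule L2_boundedI[of _ "expectation (\<lambda>\<omega>. (norm (\<xi> \<omega>))\<^sup>2)"])
     (simp add: nn_integral_eq_integral[OF assms])

lemma L2_bounded_W: "L2_bounded (\<lambda>t \<omega>. W t \<omega> - W 0 \<omega>)"
proof (rule L2_boundedI)
  fix t assume t: "t \<in> {0..T}"
  then show "(\<integral>\<^sup>+\<omega>. ennreal ((norm (W t \<omega> - W 0 \<omega>))\<^sup>2) \<partial>M) \<le> ennreal (real CARD('d) * T)"
    by (subst nn_integral_W_increment) (auto intro!: ennreal_leI mult_left_mono)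
qed

lemma L2_bounded_integral:
  fixes h :: "real \<Rightarrow> 'w \<Rightarrow> 'v::euclidean_space"
  assumes h: "L2_bounded h" and meas: "\<And>t. t \<in> {0..T} \<Longrightarrow> h t \<in> borel_measurable M"
    and cont: "\<And>\<omega>. \<omega> \<in> space M \<Longrightarrow> continuous_on {0..T} (\<lambda>t. h t \<omega>)"
  shows "L2_bounded (\<lambda>t \<omega>. integral {0..t} (\<lambda>s. h s \<omega>))"
proof -
  obtain C where C: "C \<ge> 0" "\<And>t. t \<in> {0..T} \<Longrightarrow> (\<integral>\<^sup>+\<omega>. ennreal ((norm (h t \<omega>))\<^sup>2) \<partial>M) \<le> ennreal C"
    using L2_boundedE[OF h] by metis
  show ?thesis
  proof (rule L2_boundedI)
    fix t assume t: "t \<in> {0..T}"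
    then have sub: "{0..t} \<subseteq> {0..T}" by auto
    have "(\<integral>\<^sup>+\<omega>. ennreal ((norm (integral {0..t} (\<lambda>s. h s \<omega>)))\<^sup>2) \<partial>M) = (\<integral>\<^sup>+\<omega>. ennreal ((norm (LINT s:{0..t}|lborel. h s \<omega>))\<^sup>2) \<partial>M)"
      by (intro nn_integral_cong)
         (simp add: set_integral_continuous_eq_integral(1)[OF continuous_on_subset[OF cont sub]])
    also have "\<dots> \<le> ennreal ((t - 0)\<^sup>2) * ennreal C"
      by (rule nn_integral_set_integral_power2_le_const[OF _ continuous_paths_jointly_measurable])
         (use t sub C(2) meas in \<open>auto intro: continuous_on_subset[OF cont]\<close>)
    also have "\<dots> \<le> ennreal (T\<^sup>2) * ennreal C"
      using t by (intro mult_right_mono ennreal_leI power_mono) auto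
    also have "\<dots> = ennreal (T\<^sup>2 * C)"
      using C(1) by (simp add: ennreal_mult)
    finally show "(\<integral>\<^sup>+\<omega>. ennreal ((norm (integral {0..t} (\<lambda>s. h s \<omega>)))\<^sup>2) \<partial>M) \<le> ennreal (T\<^sup>2 * C)" .
  qed
qed

text \<open>Joint measurability is applied over the \<sigma>-algebra \<open>F t\<close> in place of
  \<open>M\<close> and on [0, t], so that only values known by time t enter.\<close>

lemma integral_paths_adapted:
  fixes h :: "real \<Rightarrow> 'w \<Rightarrow> 'v::euclidean_space"
  assumes t: "t \<in> {0..T}" and meas: "\<And>s. s \<in> {0..t} \<Longrightarrow> h s \<in> borel_measurable (F t)"
    and cont: "\<And>\<omega>. \<omega> \<in> space M \<Longrightarrow> continuous_on {0..T} (\<lambda>t. h t \<omega>)"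
  shows "(\<lambda>\<omega>. integral {0..t} (\<lambda>s. h s \<omega>)) \<in> borel_measurable (F t)"
proof -
  have sub: "{0..t} \<subseteq> {0..T}" using t by auto
  have "(\<lambda>\<omega>. LINT s:{0..t}|lborel. h s \<omega>) \<in> borel_measurable (F t)"
    by (intro borel_measurable_set_integral_paths continuous_paths_jointly_measurable)
       (use t meas sub space_F[OF t] in \<open>auto intro: continuous_on_subset[OF cont]\<close>)
  then show ?thesis
    by (rule measurable_cong[THEN iffD1, rotated])
       (use space_F[OF t] in \<open>simp add: set_integral_continuous_eq_integral(1)[OF continuous_on_subset[OF cont sub]]\<close>)
qed

text \<open>The noise is additive, so y = x - \<Sigma> w solves an ordinary linear equation with
  random forcing along each path, and \<open>p\<close> is defined by the affine relation. Then
  \<Gamma> y + g has a classical derivative, while the remaining term \<Gamma> \<Sigma> w is turned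
  into drift and Ito integral by \<open>deterministic_ito\<close>.\<close>

lemma fbsde_exists:
  fixes S :: "('p::finite, 'q::finite, 'd) linear_system" and X Y :: "real \<Rightarrow> real ^ 'p ^ 'p"
  assumes x0: "x0 \<in> borel_measurable (F 0)" "integrable M (\<lambda>\<omega>. (norm (x0 \<omega>))\<^sup>2)"
    and ric: "riccati_solution T S \<Gamma>" and g: "offset_solution T S \<Gamma> g"
    and X: "\<And>t. t \<in> {0..T} \<Longrightarrow> (X has_vector_derivative (sysA S - sysB S ** \<Gamma> t) ** X t) (at t within {0..T})"
    and XY: "\<And>t. t \<in> {0..T} \<Longrightarrow> X t ** Y t = mat 1" and Y: "continuous_on {0..T} Y"
  obtains x p Z where "fbsde_solution M F T W S x0 x p Z"
    "\<And>\<omega> t. \<omega> \<in> space M \<Longrightarrow> t \<in> {0..T} \<Longrightarrow> p t \<omega> = \<Gamma> t *v x t \<omega> + g t"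
proof -
  let ?A = "sysA S" and ?B = "sysB S" and ?C = "sysC S" and ?D = "sysD S" and ?Sig = "sysSigma S"
  have T0: "0 \<le> T" using T by simp
  \<comment> \<open>Subtracting \<open>W 0\<close> makes the noise start at 0 on every path; a
    Wiener process itself starts at 0 only almost surely.\<close>
  define w where "w t \<omega> = W t \<omega> - W 0 \<omega>" for t \<omega>
  define K where "K t = ?A - ?B ** \<Gamma> t" for t
  \<comment> \<open>Inserting p = \<Gamma> x + g and x = y + \<Sigma> w into A x - B p gives K y
    plus this forcing term.\<close>
  define f where "f s \<omega> = K s *v (?Sig *v w s \<omega>) - ?B *v g s" for s \<omega>
  \<comment> \<open>Variation of constants. The fundamental matrix is normalised at \<open>T\<close>
    and not at 0, hence the factor \<open>Y 0\<close> in front of \<open>x0\<close>.\<close>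
  define y where "y t \<omega> = X t *v (Y 0 *v x0 \<omega> + integral {0..t} (\<lambda>s. Y s *v f s \<omega>))" for t \<omega>
  define x where "x t \<omega> = y t \<omega> + ?Sig *v w t \<omega>" for t \<omega>
  define p where "p t \<omega> = \<Gamma> t *v x t \<omega> + g t" for t \<omega>
  define \<Gamma>' where "\<Gamma>' t = - (\<Gamma> t ** ?A + ?C ** \<Gamma> t - \<Gamma> t ** ?B ** \<Gamma> t + ?D)" for t
  have \<Gamma>: "(\<Gamma> has_vector_derivative \<Gamma>' t) (at t within {0..T})" if "t \<in> {0..T}" for t
    using ric that by (simp add: riccati_solution_def \<Gamma>'_def)
  have g_deriv: "(g has_vector_derivative - ((?C - \<Gamma> t ** ?B) *v g t + sysM S)) (at t within {0..T})" if "t \<in> {0..T}" for t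
    using g that by (simp add: offset_solution_def)
  have cont\<Gamma>: "continuous_on {0..T} \<Gamma>" by (rule riccati_solution_continuous_on[OF ric])
  have contg: "continuous_on {0..T} g" by (rule continuous_on_vector_derivative[OF g_deriv])
  have contX: "continuous_on {0..T} X" by (rule continuous_on_vector_derivative[OF X])
  have contK: "continuous_on {0..T} K" unfolding K_def by (intro continuous_intros cont\<Gamma>)
  have cont\<Gamma>': "continuous_on {0..T} \<Gamma>'" unfolding \<Gamma>'_def by (intro continuous_intros cont\<Gamma>)
  have contw: "continuous_on {0..T} (\<lambda>t. w t \<omega>)" if "\<omega> \<in> space M" for \<omega>
    unfolding w_def by (intro continuous_intros W_continuous that)
  have contf: "continuous_on {0..T} (\<lambda>t. f t \<omega>)" if "\<omega> \<in> space M" for \<omega>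
    unfolding f_def by (intro continuous_intros contw that contK contg)
  have contYf: "continuous_on {0..T} (\<lambda>t. Y t *v f t \<omega>)" if "\<omega> \<in> space M" for \<omega>
    by (intro continuous_intros contf that Y)
  have y_0: "y 0 \<omega> = x0 \<omega>" for \<omega>
    using XY[of 0] T0 by (simp add: y_def matrix_vector_mul_assoc)
  have y_deriv: "((\<lambda>t. y t \<omega>) has_vector_derivative ?A *v x t \<omega> - ?B *v p t \<omega>) (at t within {0..T})"
    if \<omega>: "\<omega> \<in> space M" and t: "t \<in> {0..T}" for \<omega> t
  proof -
    have "((\<lambda>t. Y 0 *v x0 \<omega> + integral {0..t} (\<lambda>s. Y s *v f s \<omega>)) has_vector_derivative 0 + Y t *v f t \<omega>) (at t within {0..T})"
      by (intro has_vector_derivative_add has_vector_derivative_const integral_has_vector_derivative contYf[OF \<omega>] t)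
    then have "((\<lambda>t. y t \<omega>) has_vector_derivative X t *v (0 + Y t *v f t \<omega>)
        + ((?A - ?B ** \<Gamma> t) ** X t) *v (Y 0 *v x0 \<omega> + integral {0..t} (\<lambda>s. Y s *v f s \<omega>))) (at t within {0..T})"
      unfolding y_def by (intro bounded_bilinear.has_vector_derivative[OF bounded_bilinear_matrix_vector_mult] X t)
    moreover have "X t *v (0 + Y t *v f t \<omega>)
        + ((?A - ?B ** \<Gamma> t) ** X t) *v (Y 0 *v x0 \<omega> + integral {0..t} (\<lambda>s. Y s *v f s \<omega>)) = f t \<omega> + K t *v y t \<omega>"
      using XY[OF t] by (simp add: matrix_vector_mul_assoc y_def K_def)
    moreover have "f t \<omega> + K t *v y t \<omega> = ?A *v x t \<omega> - ?B *v p t \<omega>"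
      by (simp add: f_def K_def p_def x_def matrix_vector_right_distrib matrix_vector_mult_diff_rdistrib
          matrix_vector_mul_assoc[symmetric])
    ultimately show ?thesis by simp
  qed
  have conty: "continuous_on {0..T} (\<lambda>t. y t \<omega>)" if "\<omega> \<in> space M" for \<omega>
    by (rule continuous_on_vector_derivative[OF y_deriv[OF that]])
  have contx: "continuous_on {0..T} (\<lambda>t. x t \<omega>)" if "\<omega> \<in> space M" for \<omega>
    unfolding x_def by (intro continuous_intros conty contw that)
  have contp: "continuous_on {0..T} (\<lambda>t. p t \<omega>)" if "\<omega> \<in> space M" for \<omega>
    unfolding p_def by (intro continuous_intros contx that cont\<Gamma> contg)
  have w_meas: "w s \<in> borel_measurable (F t)" if "s \<in> {0..t}" "t \<in> {0..T}" for s t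
    unfolding w_def[abs_def] using that by (intro borel_measurable_diff W_adapted') auto
  have f_meas: "f s \<in> borel_measurable (F t)" if "s \<in> {0..t}" "t \<in> {0..T}" for s t
    unfolding f_def[abs_def]
    by (intro borel_measurable_diff borel_measurable_matrix_vector_mult borel_measurable_const w_meas that)
  have x0_meas: "x0 \<in> borel_measurable (F t)" if "t \<in> {0..T}" for t
    using F_measurable_mono[OF x0(1), of t] that by auto
  have y_meas: "y t \<in> borel_measurable (F t)" if "t \<in> {0..T}" for t
    unfolding y_def[abs_def]
    by (intro borel_measurable_matrix_vector_mult borel_measurable_const borel_measurable_add x0_meas
        integral_paths_adapted f_meas contYf that)
  have x_meas: "x t \<in> borel_measurable (F t)" if "t \<in> {0..T}" for t
    unfolding x_def[abs_def] using that
    by (intro borel_measurable_add borel_measurable_matrix_vector_mult borel_measurable_const y_meas w_meas) auto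
  have p_meas: "p t \<in> borel_measurable (F t)" if "t \<in> {0..T}" for t
    unfolding p_def[abs_def]
    by (intro borel_measurable_add borel_measurable_matrix_vector_mult borel_measurable_const x_meas that)
  have wM: "w t \<in> borel_measurable M" and fM: "f t \<in> borel_measurable M" and x0M: "x0 \<in> borel_measurable M"
    and yM: "y t \<in> borel_measurable M" and xM: "x t \<in> borel_measurable M"
    if t: "t \<in> {0..T}" for t
    using t by (auto intro!: F_measurable_M[of _ t] w_meas f_meas x0_meas y_meas x_meas)
  have bddw: "L2_bounded w"
    using L2_bounded_W by (simp add: w_def[abs_def])
  have bddf: "L2_bounded f"
  proof -
    have "L2_bounded (\<lambda>t \<omega>. (K t ** ?Sig) *v w t \<omega> + - (?B *v g t))"
      by (intro L2_bounded_add L2_bounded_mult bddw L2_bounded_deterministic continuous_intros contK contg wM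
          borel_measurable_matrix_vector_mult borel_measurable_const)
    then show ?thesis by (simp add: f_def[abs_def] matrix_vector_mul_assoc)
  qed
  have YfM: "(\<lambda>\<omega>. Y t *v f t \<omega>) \<in> borel_measurable M" if "t \<in> {0..T}" for t
    by (intro borel_measurable_matrix_vector_mult borel_measurable_const fM that)
  have I_adapted: "(\<lambda>\<omega>. integral {0..t} (\<lambda>s. Y s *v f s \<omega>)) \<in> borel_measurable (F t)" if "t \<in> {0..T}" for t
    by (intro integral_paths_adapted borel_measurable_matrix_vector_mult borel_measurable_const f_meas contYf that)
  have IM: "(\<lambda>\<omega>. integral {0..t} (\<lambda>s. Y s *v f s \<omega>)) \<in> borel_measurable M" if "t \<in> {0..T}" for t
    by (rule F_measurable_M[OF I_adapted[OF that]]) (use that in auto)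
  have bddy: "L2_bounded y"
    unfolding y_def[abs_def]
    by (intro L2_bounded_mult L2_bounded_add L2_bounded_const[OF x0(2)] L2_bounded_integral bddf contX Y
        continuous_on_const x0M fM YfM IM contYf borel_measurable_matrix_vector_mult borel_measurable_const borel_measurable_add)
  have bddx: "L2_bounded x"
    unfolding x_def[abs_def]
    by (intro L2_bounded_add L2_bounded_mult bddy bddw continuous_on_const yM wM borel_measurable_matrix_vector_mult borel_measurable_const)
  have bddp: "L2_bounded p"
    unfolding p_def[abs_def]
    by (intro L2_bounded_add L2_bounded_mult bddx L2_bounded_deterministic contg cont\<Gamma> xM borel_measurable_matrix_vector_mult borel_measurable_const)
  have adapted_x: "L2_adapted M F T x"
    using L2_boundedE[OF bddx] L2_adapted_continuousI[OF x_meas contx] by metis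
  have adapted_p: "L2_adapted M F T p"
    using L2_boundedE[OF bddp] L2_adapted_continuousI[OF p_meas contp] by metis
  have cont_drift: "continuous_on {0..T} (\<lambda>t. ?A *v x t \<omega> - ?B *v p t \<omega>)"
    "continuous_on {0..T} (\<lambda>t. - (?C *v p t \<omega> + ?D *v x t \<omega> + sysM S))" if "\<omega> \<in> space M" for \<omega>
    by (intro continuous_intros contx contp that)+
  have FTC: "(LINT s:{0..t}|lborel. v' s) = v t - v 0"
    if v: "\<And>s. s \<in> {0..T} \<Longrightarrow> (v has_vector_derivative v' s) (at s within {0..T})" and v': "continuous_on {0..T} v'"
      and t: "t \<in> {0..T}" for v v' :: "real \<Rightarrow> real ^ 'k" and t
  proof -
    have sub: "{0..t} \<subseteq> {0..T}" using t by auto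
    have "(v' has_integral v t - v 0) {0..t}"
      by (rule fundamental_theorem_of_calculus)
         (use t sub in \<open>auto intro!: has_vector_derivative_within_subset[OF v]\<close>)
    then show ?thesis
      unfolding set_integral_continuous_eq_integral(1)[OF continuous_on_subset[OF v' sub]] by (rule integral_unique)
  qed
  have dx: "has_stoch_differential M F T W x (\<lambda>t \<omega>. ?A *v x t \<omega> - ?B *v p t \<omega>) (\<lambda>t \<omega>. ?Sig)"
    unfolding has_stoch_differential_def
  proof (intro conjI ballI)
    show "AE \<omega> in M. set_integrable lborel {0..T} (\<lambda>s. ?A *v x s \<omega> - ?B *v p s \<omega>)"
      by (intro AE_I2 set_integral_continuous_eq_integral(2) cont_drift)
    fix t assume t: "t \<in> {0..T}"
    have "has_ito_integral M F T W (\<lambda>s \<omega>. ?Sig) t (\<lambda>\<omega>. ?Sig *v w t \<omega>)"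
      using deterministic_ito[of "\<lambda>_. ?Sig" "\<lambda>_. 0" t] t by (simp add: w_def)
    moreover have "x t \<omega> = x 0 \<omega> + (LINT s:{0..t}|lborel. ?A *v x s \<omega> - ?B *v p s \<omega>) + ?Sig *v w t \<omega>"
      if \<omega>: "\<omega> \<in> space M" for \<omega>
    proof -
      have "(LINT s:{0..t}|lborel. ?A *v x s \<omega> - ?B *v p s \<omega>) = y t \<omega> - y 0 \<omega>"
        by (rule FTC[OF y_deriv[OF \<omega>] cont_drift(1)[OF \<omega>] t])
      then show ?thesis by (simp only: x_def[of t] x_def[of 0] w_def) simp
    qed
    ultimately show "\<exists>J. has_ito_integral M F T W (\<lambda>s \<omega>. ?Sig) t J \<and>
        (AE \<omega> in M. x t \<omega> = x 0 \<omega> + (LINT s:{0..t}|lborel. ?A *v x s \<omega> - ?B *v p s \<omega>) + J \<omega>)"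
      by (intro exI[of _ "\<lambda>\<omega>. ?Sig *v w t \<omega>"] conjI AE_I2)
  qed
  have Z_deriv: "((\<lambda>t. \<Gamma> t ** ?Sig) has_vector_derivative \<Gamma>' t ** ?Sig) (at t within {0..T})" if "t \<in> {0..T}" for t
    by (rule bounded_linear.has_vector_derivative[OF bounded_bilinear.bounded_linear_left[OF bounded_bilinear_matrix_mult] \<Gamma>[OF that]])
  have cont_Z': "continuous_on {0..T} (\<lambda>t. \<Gamma>' t ** ?Sig)"
    by (intro continuous_intros cont\<Gamma>')
  have ito_Z: "has_ito_integral M F T W (\<lambda>s \<omega>. \<Gamma> s ** ?Sig) t
      (\<lambda>\<omega>. (\<Gamma> t ** ?Sig) *v w t \<omega> - (LINT s:{0..t}|lborel. (\<Gamma>' s ** ?Sig) *v w s \<omega>))" if "t \<in> {0..T}" for t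
    unfolding w_def by (rule deterministic_ito[OF Z_deriv cont_Z']) (use that in auto)
  \<comment> \<open>The Riccati and offset equations reduce the derivative to the adjoint drift
    minus (\<Gamma>' \<Sigma>) w. This last term is exactly what the pathwise formula for the Ito
    integral of \<Gamma> \<Sigma> subtracts.\<close>
  have v_deriv: "((\<lambda>t. \<Gamma> t *v y t \<omega> + g t) has_vector_derivative
      - (?C *v p t \<omega> + ?D *v x t \<omega> + sysM S) - (\<Gamma>' t ** ?Sig) *v w t \<omega>) (at t within {0..T})"
    if \<omega>: "\<omega> \<in> space M" and t: "t \<in> {0..T}" for \<omega> t
  proof -
    have "((\<lambda>t. \<Gamma> t *v y t \<omega> + g t) has_vector_derivative
        (\<Gamma> t *v (?A *v x t \<omega> - ?B *v p t \<omega>) + \<Gamma>' t *v y t \<omega>) + - ((?C - \<Gamma> t ** ?B) *v g t + sysM S)) (at t within {0..T})"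
      by (intro has_vector_derivative_add bounded_bilinear.has_vector_derivative[OF bounded_bilinear_matrix_vector_mult]
          \<Gamma> y_deriv \<omega> t g_deriv)
    moreover have "(\<Gamma> t *v (?A *v x t \<omega> - ?B *v p t \<omega>) + \<Gamma>' t *v y t \<omega>) + - ((?C - \<Gamma> t ** ?B) *v g t + sysM S)
        = - (?C *v p t \<omega> + ?D *v x t \<omega> + sysM S) - (\<Gamma>' t ** ?Sig) *v w t \<omega>"
    proof -
      have y_eq: "y t \<omega> = x t \<omega> - ?Sig *v w t \<omega>" by (simp add: x_def)
      have "\<Gamma>' t *v x t \<omega> = - (\<Gamma> t *v (?A *v x t \<omega>)) - ?C *v (\<Gamma> t *v x t \<omega>) + \<Gamma> t *v (?B *v (\<Gamma> t *v x t \<omega>)) - ?D *v x t \<omega>"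
        by (simp add: \<Gamma>'_def matrix_vector_mult_uminus matrix_vector_mult_add_rdistrib matrix_vector_mult_diff_rdistrib
            matrix_vector_mul_assoc[symmetric])
      then show ?thesis
        unfolding y_eq p_def
        by (simp add: matrix_vector_mult_diff_distrib matrix_vector_right_distrib matrix_vector_mult_diff_rdistrib
            matrix_vector_mul_assoc[symmetric])
    qed
    ultimately show ?thesis by (simp only:)
  qed
  have dp: "has_stoch_differential M F T W p (\<lambda>t \<omega>. - (?C *v p t \<omega> + ?D *v x t \<omega> + sysM S)) (\<lambda>t \<omega>. \<Gamma> t ** ?Sig)"
    unfolding has_stoch_differential_def
  proof (intro conjI ballI)
    show "AE \<omega> in M. set_integrable lborel {0..T} (\<lambda>s. - (?C *v p s \<omega> + ?D *v x s \<omega> + sysM S))"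
      by (intro AE_I2 set_integral_continuous_eq_integral(2) cont_drift)
    fix t assume t: "t \<in> {0..T}"
    have "p t \<omega> = p 0 \<omega> + (LINT s:{0..t}|lborel. - (?C *v p s \<omega> + ?D *v x s \<omega> + sysM S))
        + ((\<Gamma> t ** ?Sig) *v w t \<omega> - (LINT s:{0..t}|lborel. (\<Gamma>' s ** ?Sig) *v w s \<omega>))"
      if \<omega>: "\<omega> \<in> space M" for \<omega>
    proof -
      have sub: "{0..t} \<subseteq> {0..T}" using t by auto
      have contw': "continuous_on {0..T} (\<lambda>s. (\<Gamma>' s ** ?Sig) *v w s \<omega>)"
        by (intro continuous_intros cont\<Gamma>' contw \<omega>)
      have "(LINT s:{0..t}|lborel. - (?C *v p s \<omega> + ?D *v x s \<omega> + sysM S)) - (LINT s:{0..t}|lborel. (\<Gamma>' s ** ?Sig) *v w s \<omega>)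
          = (LINT s:{0..t}|lborel. - (?C *v p s \<omega> + ?D *v x s \<omega> + sysM S) - (\<Gamma>' s ** ?Sig) *v w s \<omega>)"
        by (rule set_integral_diff(2)[symmetric])
           (intro set_integral_continuous_eq_integral(2) continuous_on_subset[OF _ sub] cont_drift \<omega> contw')+
      also have "\<dots> = \<Gamma> t *v y t \<omega> + g t - (\<Gamma> 0 *v y 0 \<omega> + g 0)"
        by (rule FTC[OF v_deriv[OF \<omega>] _ t], assumption) (intro continuous_on_diff cont_drift \<omega> contw')
      finally show ?thesis
        by (simp add: p_def x_def matrix_vector_right_distrib matrix_vector_mul_assoc w_def[of 0] algebra_simps)
    qed
    then show "\<exists>J. has_ito_integral M F T W (\<lambda>t \<omega>. \<Gamma> t ** ?Sig) t J \<and>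
        (AE \<omega> in M. p t \<omega> = p 0 \<omega> + (LINT s:{0..t}|lborel. - (?C *v p s \<omega> + ?D *v x s \<omega> + sysM S)) + J \<omega>)"
      by (intro exI[of _ "\<lambda>\<omega>. (\<Gamma> t ** ?Sig) *v w t \<omega> - (LINT s:{0..t}|lborel. (\<Gamma>' s ** ?Sig) *v w s \<omega>)"] conjI AE_I2 ito_Z[OF t])
  qed
  have adapted_Z: "L2_adapted M F T (\<lambda>t \<omega>. \<Gamma> t ** ?Sig)"
    using ito_Z[of 0] T0 by (auto simp: has_ito_integral_def)
  show thesis
  proof
    show "fbsde_solution M F T W S x0 x p (\<lambda>t \<omega>. \<Gamma> t ** ?Sig)"
      unfolding fbsde_solution_def
      using adapted_x adapted_p adapted_Z dx dp contx contp ric g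
      by (auto simp: x_def[of 0] y_0 w_def[of 0] p_def[of T] riccati_solution_def offset_solution_def)
    show "p t \<omega> = \<Gamma> t *v x t \<omega> + g t" for t \<omega>
      by (rule p_def)
  qed
qed

end

section \<open>Uniqueness of solutions\<close>

lemma indicator_Icc_measurable_restrict [measurable]:
  "(\<lambda>s. indicator {u..v} s :: ennreal) \<in> borel_measurable (restrict_space lborel {a..b :: real})"
  by (intro measurable_restrict_space1) simp

text \<open>On an interval of length \<open>\<delta>\<close> with \<open>c \<delta> < 1/2\<close> the bound halves the integral of \<open>m\<close>, which therefore
  vanishes there. Such intervals exhaust \<open>[0, T]\<close> backwards from \<open>T\<close>.\<close>

lemma nn_integral_gronwall_zero:
  fixes m :: "real \<Rightarrow> ennreal"
  assumes T: "0 < T" and meas [measurable]: "m \<in> borel_measurable (restrict_space lborel {0..T})"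
    and fin: "(\<integral>\<^sup>+s. m s \<partial>restrict_space lborel {0..T}) < \<infinity>" and c: "0 \<le> c"
    and bound: "\<And>t. t \<in> {0..T} \<Longrightarrow> m t \<le> ennreal c * (\<integral>\<^sup>+s. indicator {t..T} s * m s \<partial>restrict_space lborel {0..T})"
    and t: "t \<in> {0..T}"
  shows "m t = 0"
proof -
  let ?R = "restrict_space lborel {0..T}"
  define \<delta> where "\<delta> = 1 / (2 * c + 1)"
  have \<delta>: "\<delta> > 0" using c by (simp add: \<delta>_def)
  define A where "A u = (\<integral>\<^sup>+s. indicator {u..T} s * m s \<partial>?R)" for u
  have A_fin: "A u < \<infinity>" for u
  proof -
    have "A u \<le> (\<integral>\<^sup>+s. m s \<partial>?R)"
      unfolding A_def by (intro nn_integral_mono) (auto simp: indicator_def)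
    then show ?thesis using fin by (rule order.strict_trans1)
  qed
  have A_mono: "A v \<le> A u" if "u \<le> v" for u v
    unfolding A_def using that by (intro nn_integral_mono) (auto simp: indicator_def)
  have step: "A (u - \<delta>) = 0" if "A u = 0" for u
  proof -
    have "A (u - \<delta>) \<le> (\<integral>\<^sup>+s. ennreal c * A (u - \<delta>) * indicator {u - \<delta>..u} s + indicator {u..T} s * m s \<partial>?R)"
      unfolding A_def[of "u - \<delta>"]
    proof (rule nn_integral_mono)
      fix s assume "s \<in> space ?R"
      then have s: "s \<in> {0..T}" by (simp add: space_restrict_space)
      have "m s \<le> ennreal c * A (u - \<delta>)" if "u - \<delta> \<le> s"
        using bound[OF s] A_mono[OF that] unfolding A_def[of s, symmetric]
        by (meson mult_left_mono order_trans zero_le)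
      then show "indicator {u - \<delta>..T} s * m s \<le> ennreal c * (\<integral>\<^sup>+s. indicator {u - \<delta>..T} s * m s \<partial>?R) * indicator {u - \<delta>..u} s + indicator {u..T} s * m s"
        unfolding A_def[of "u - \<delta>", symmetric] by (auto simp: indicator_def)
    qed
    also have "\<dots> = ennreal c * A (u - \<delta>) * (\<integral>\<^sup>+s. indicator {u - \<delta>..u} s \<partial>?R) + A u"
      unfolding A_def[of u]
      by (subst nn_integral_add) (measurable, simp add: nn_integral_cmult[OF indicator_Icc_measurable_restrict])
    also have "\<dots> \<le> ennreal c * A (u - \<delta>) * ennreal \<delta> + A u"
    proof (intro add_right_mono mult_left_mono)
      have "(\<integral>\<^sup>+s. indicator {u - \<delta>..u} s \<partial>?R) = (\<integral>\<^sup>+s. indicator {u - \<delta>..u} s * indicator {0..T} s \<partial>lborel)"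
        by (rule nn_integral_restrict_space) simp
      also have "\<dots> \<le> (\<integral>\<^sup>+s. indicator {u - \<delta>..u} s \<partial>lborel)"
        by (intro nn_integral_mono) (auto simp: indicator_def)
      also have "\<dots> = ennreal \<delta>"
        using \<delta> by simp
      finally show "(\<integral>\<^sup>+s. indicator {u - \<delta>..u} s \<partial>?R) \<le> ennreal \<delta>" .
    qed simp
    finally have le: "A (u - \<delta>) \<le> ennreal c * A (u - \<delta>) * ennreal \<delta> + A u" .
    \<comment> \<open>Absorption needs a finite number: a \<le> a / 2 forces a = 0 in the reals but
      would allow infinity in \<open>ennreal\<close>.\<close>
    obtain a where a: "A (u - \<delta>) = ennreal a" "0 \<le> a"
      using A_fin[of "u - \<delta>"] by (cases "A (u - \<delta>)") auto
    have "ennreal a \<le> ennreal (c * a * \<delta>)"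
      using le c a(2) \<delta> unfolding that a(1) by (simp add: ennreal_mult[symmetric])
    then have "a \<le> c * a * \<delta>"
      using c a(2) \<delta> by (subst (asm) ennreal_le_iff) auto
    also have "c * a * \<delta> = a * (c * \<delta>)" by simp
    also have "\<dots> \<le> a * (1 / 2)"
      using c a(2) by (intro mult_left_mono) (auto simp: \<delta>_def field_simps)
    finally show ?thesis using a by simp
  qed
  have "A T = 0"
  proof -
    have "(\<integral>\<^sup>+s. indicator {T..T} s * m s \<partial>?R) = (\<integral>\<^sup>+s. 0 \<partial>?R)"
    proof (rule nn_integral_cong_AE)
      have "AE s in lborel. s \<in> {0..T} \<longrightarrow> indicator {T..T} s * m s = 0"
        using AE_lborel_singleton[of T] by eventually_elim auto
      then show "AE s in ?R. indicator {T..T} s * m s = 0"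
        by (subst AE_restrict_space_iff) auto
    qed
    then show ?thesis by (simp add: A_def)
  qed
  then have zero: "A (T - real n * \<delta>) = 0" for n
  proof (induction n)
    case (Suc n)
    then show ?case using step[of "T - real n * \<delta>"] by (simp add: algebra_simps)
  qed simp
  obtain n where "T < real n * \<delta>"
    using reals_Archimedean3[OF \<delta>] by blast
  then have "A t \<le> A (T - real n * \<delta>)"
    using t by (intro A_mono) auto
  then have "A t = 0" using zero by simp
  then show ?thesis
    using bound[OF t] by (simp add: A_def)
qed

text \<open>Stochastic identities come with a null set for each time. Imposed at rational times they
  share one null set, and continuity of the paths extends them to all times.\<close>

lemma continuous_on_eq_if_eq_rationals:
  fixes f g :: "real \<Rightarrow> 'v::real_normed_vector"
  assumes T: "0 < T" and cont: "continuous_on {0..T} f" "continuous_on {0..T} g"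
    and eq: "\<And>t. t \<in> {0..T} \<inter> \<rat> \<Longrightarrow> f t = g t" and t: "t \<in> {0..T}"
  shows "f t = g t"
proof -
  have cl: "closure ({0<..<T} \<inter> \<rat>) = {0..T}"
    using closure_open_Int_superset[of "{0<..<T}" "\<rat>"] T by (simp add: Rats_closure_real)
  have "f t - g t = 0"
    by (rule continuous_constant_on_closure[where S = "{0<..<T} \<inter> \<rat>" and f = "\<lambda>t. f t - g t"])
       (use cl cont eq t in \<open>auto intro!: continuous_intros\<close>)
  then show ?thesis by simp
qed

lemma has_stoch_differentialE:
  assumes "has_stoch_differential M F T W X b Z"
  obtains J where "\<And>t. t \<in> {0..T} \<Longrightarrow> has_ito_integral M F T W Z t (J t)"
    "\<And>t. t \<in> {0..T} \<Longrightarrow> AE \<omega> in M. X t \<omega> = X 0 \<omega> + (LINT s:{0..t}|lborel. b s \<omega>) + J t \<omega>"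
proof -
  have "\<forall>t\<in>{0..T}. \<exists>J. has_ito_integral M F T W Z t J \<and> (AE \<omega> in M. X t \<omega> = X 0 \<omega> + (LINT s:{0..t}|lborel. b s \<omega>) + J \<omega>)"
    using assms by (simp add: has_stoch_differential_def)
  from bchoice[OF this] show thesis
    using that by blast
qed

context filtered_wiener
begin

text \<open>At time t, q equals a time integral I minus the increment N of the martingale part over
  [t, T]. Since q t is known at t, it is orthogonal to N, so E |q t|^2 = E (q t \<bullet> I) and
  hence E |q t|^2 is at most E |I|^2. The martingale part is kept as a pair of Ito integrals, the
  form in which the difference of two solutions produces it.\<close>

lemma linear_bsde_zero:
  fixes q :: "real \<Rightarrow> 'w \<Rightarrow> real ^ 'k" and H :: "real \<Rightarrow> real ^ 'k ^ 'k"
  assumes adapted: "\<And>t. t \<in> {0..T} \<Longrightarrow> q t \<in> borel_measurable (F t)"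
    and joint: "(\<lambda>(t, \<omega>). q t \<omega>) \<in> borel_measurable (time_prod M T)"
    and fin: "(\<integral>\<^sup>+(t, \<omega>). ennreal ((norm (q t \<omega>))\<^sup>2) \<partial>time_prod M T) < \<infinity>"
    and H: "continuous_on {0..T} H"
    and J: "\<And>t. t \<in> {0..T} \<Longrightarrow> has_ito_integral M F T W Z t (J t)"
    and J': "\<And>t. t \<in> {0..T} \<Longrightarrow> has_ito_integral M F T W Z' t (J' t)"
    and eq: "\<And>t. t \<in> {0..T} \<Longrightarrow> AE \<omega> in M. q t \<omega> =
      (LINT s:{0..T}|lborel. indicator {t..T} s *\<^sub>R (H s *v q s \<omega>)) - ((J' T \<omega> - J' t \<omega>) - (J T \<omega> - J t \<omega>))"
    and t: "t \<in> {0..T}"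
  shows "AE \<omega> in M. q t \<omega> = 0"
proof -
  have T0: "0 \<le> T" and TT: "T \<in> {0..T}" using T by auto
  have joint' [measurable]: "(\<lambda>z. q (fst z) (snd z)) \<in> borel_measurable (time_prod M T)"
    using joint by (simp add: split_beta')
  have qM [measurable]: "q t \<in> borel_measurable M" if "t \<in> {0..T}" for t
    using F_measurable_M[OF adapted[OF that]] that by auto
  obtain B where B: "B \<ge> 0" "\<And>s v. s \<in> {0..T} \<Longrightarrow> norm (H s *v v) \<le> B * norm v"
    using matrix_vector_mult_norm_bound[OF H] by metis
  have H_meas: "(\<lambda>z. H (fst z)) \<in> borel_measurable (time_prod M T)"
    using continuous_paths_jointly_measurable[OF T0, of "\<lambda>s \<omega>. H s" M] H by (simp add: split_beta')
  define m where "m s = (\<integral>\<^sup>+\<omega>. ennreal ((norm (q s \<omega>))\<^sup>2) \<partial>M)" for s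
  let ?R = "restrict_space lborel {0..T}"
  have m_meas [measurable]: "m \<in> borel_measurable ?R"
    unfolding m_def[abs_def] by (intro borel_measurable_nn_integral) (simp add: split_beta')
  have m_fin: "(\<integral>\<^sup>+s. m s \<partial>?R) < \<infinity>"
    using fin unfolding m_def by (subst (asm) nn_integral_time_prod) (simp_all add: split_beta')
  \<comment> \<open>Written over the fixed interval [0, T] with an indicator, so that the one
    product space \<open>time_prod M T\<close> serves every t.\<close>
  define I where "I t \<omega> = (LINT s:{0..T}|lborel. indicator {t..T} s *\<^sub>R (H s *v q s \<omega>))" for t \<omega>
  have hI [measurable]: "(\<lambda>(s, \<omega>). indicator {t..T} s *\<^sub>R (H s *v q s \<omega>)) \<in> borel_measurable (time_prod M T)" for t
    unfolding split_beta' by (intro borel_measurable_scaleR borel_measurable_matrix_vector_mult H_meas joint') measurable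
  have IM [measurable]: "I t \<in> borel_measurable M" for t
    unfolding I_def[abs_def] by (rule borel_measurable_set_integral_paths[OF hI])
  have I_bound: "(\<integral>\<^sup>+\<omega>. ennreal ((norm (I t \<omega>))\<^sup>2) \<partial>M) \<le> ennreal (T * B\<^sup>2) * (\<integral>\<^sup>+s. indicator {t..T} s * m s \<partial>?R)" for t
  proof -
    have "(\<integral>\<^sup>+\<omega>. ennreal ((norm (I t \<omega>))\<^sup>2) \<partial>M) \<le> ennreal (T - 0) *
        (\<integral>\<^sup>+s. \<integral>\<^sup>+\<omega>. ennreal ((norm (indicator {t..T} s *\<^sub>R (H s *v q s \<omega>)))\<^sup>2) \<partial>M \<partial>?R)"
      unfolding I_def by (rule nn_integral_set_integral_power2_le[OF T0 hI])
    also have "\<dots> \<le> ennreal (T - 0) * (\<integral>\<^sup>+s. ennreal (B\<^sup>2) * (indicator {t..T} s * m s) \<partial>?R)"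
    proof (intro mult_left_mono nn_integral_mono)
      fix s assume "s \<in> space ?R"
      then have s: "s \<in> {0..T}" by (simp add: space_restrict_space)
      have "(\<integral>\<^sup>+\<omega>. ennreal ((norm (indicator {t..T} s *\<^sub>R (H s *v q s \<omega>)))\<^sup>2) \<partial>M)
          \<le> (\<integral>\<^sup>+\<omega>. (ennreal (B\<^sup>2) * indicator {t..T} s) * ennreal ((norm (q s \<omega>))\<^sup>2) \<partial>M)"
      proof (rule nn_integral_mono)
        fix \<omega>
        have "(norm (H s *v q s \<omega>))\<^sup>2 \<le> (B * norm (q s \<omega>))\<^sup>2"
          by (intro power_mono B(2) s norm_ge_zero)
        then show "ennreal ((norm (indicator {t..T} s *\<^sub>R (H s *v q s \<omega>)))\<^sup>2) \<le> (ennreal (B\<^sup>2) * indicator {t..T} s) * ennreal ((norm (q s \<omega>))\<^sup>2)"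
          by (auto simp: indicator_def ennreal_mult[symmetric] power_mult_distrib ennreal_leI)
      qed
      also have "\<dots> = ennreal (B\<^sup>2) * (indicator {t..T} s * m s)"
        unfolding m_def using qM[OF s] by (subst nn_integral_cmult) (simp_all add: mult.assoc)
      finally show "(\<integral>\<^sup>+\<omega>. ennreal ((norm (indicator {t..T} s *\<^sub>R (H s *v q s \<omega>)))\<^sup>2) \<partial>M) \<le> ennreal (B\<^sup>2) * (indicator {t..T} s * m s)" .
    qed simp
    also have "\<dots> = ennreal (T * B\<^sup>2) * (\<integral>\<^sup>+s. indicator {t..T} s * m s \<partial>?R)"
      using T0 by (subst nn_integral_cmult, measurable) (simp add: ennreal_mult mult.assoc)
    finally show ?thesis .
  qed
  have I_fin: "integrable M (\<lambda>\<omega>. (norm (I t \<omega>))\<^sup>2)" for t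
  proof (rule integrableI_bounded)
    have "(\<integral>\<^sup>+s. indicator {t..T} s * m s \<partial>?R) \<le> (\<integral>\<^sup>+s. m s \<partial>?R)"
      by (intro nn_integral_mono) (auto simp: indicator_def)
    then have "(\<integral>\<^sup>+s. indicator {t..T} s * m s \<partial>?R) < \<infinity>"
      using m_fin by (rule order.strict_trans1)
    then have "ennreal (T * B\<^sup>2) * (\<integral>\<^sup>+s. indicator {t..T} s * m s \<partial>?R) < \<infinity>"
      by (simp add: ennreal_mult_less_top)
    with I_bound[of t] show "(\<integral>\<^sup>+\<omega>. ennreal (norm ((norm (I t \<omega>))\<^sup>2)) \<partial>M) < \<infinity>"
      by (simp add: order.strict_trans1)
  qed measurable
  have JM [measurable]: "J t \<in> borel_measurable M" "J' t \<in> borel_measurable M" if "t \<in> {0..T}" for t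
    using J[OF that] J'[OF that] by (auto simp: has_ito_integral_def)
  have m_le: "m t \<le> (\<integral>\<^sup>+\<omega>. ennreal ((norm (I t \<omega>))\<^sup>2) \<partial>M)" if t: "t \<in> {0..T}" for t
  proof -
    have t': "0 \<le> t" "t \<le> T" using t by auto
    note [measurable] = qM[OF t] JM[OF t] JM[OF TT]
    define N where "N \<omega> = (J' T \<omega> - J' t \<omega>) - (J T \<omega> - J t \<omega>)" for \<omega>
    have N_fin: "integrable M (\<lambda>\<omega>. (norm (N \<omega>))\<^sup>2)"
      unfolding N_def
      by (intro square_integrable_diff has_ito_integral_square_integrable[OF J] has_ito_integral_square_integrable[OF J'] t TT t' T0 order_refl)
         measurable
    have [measurable]: "N \<in> borel_measurable M" unfolding N_def[abs_def] by measurable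
    have q_eq: "AE \<omega> in M. q t \<omega> = I t \<omega> - N \<omega>"
      using eq[OF t] unfolding I_def N_def .
    \<comment> \<open>Finiteness on the product space gives E |q t|^2 < \<infinity> only for almost
      every t; the equation itself gives it for the present t, as orthogonality requires.\<close>
    have "integrable M (\<lambda>\<omega>. (norm (I t \<omega> - N \<omega>))\<^sup>2)"
      by (rule square_integrable_diff[OF _ _ I_fin N_fin]) measurable
    then have q_fin: "integrable M (\<lambda>\<omega>. (norm (q t \<omega>))\<^sup>2)"
      by (rule integrable_cong_AE_imp) (use q_eq in auto)
    have orth: "has_bochner_integral M (\<lambda>\<omega>. q t \<omega> \<bullet> N \<omega>) 0"
      using has_bochner_integral_diff[OF ito_orthogonal[OF J'[OF t] J'[OF TT] t' adapted[OF t] q_fin]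
          ito_orthogonal[OF J[OF t] J[OF TT] t' adapted[OF t] q_fin]]
      by (simp add: N_def inner_diff_right)
    have qI: "integrable M (\<lambda>\<omega>. q t \<omega> \<bullet> I t \<omega>)"
      by (rule square_integrable_inner[OF _ _ q_fin I_fin]) measurable
    have "expectation (\<lambda>\<omega>. (norm (q t \<omega>))\<^sup>2) = expectation (\<lambda>\<omega>. q t \<omega> \<bullet> I t \<omega> - q t \<omega> \<bullet> N \<omega>)"
      by (rule integral_cong_AE) (use q_eq in \<open>auto simp: power2_norm_eq_inner inner_diff_right[symmetric]\<close>)
    also have "\<dots> = expectation (\<lambda>\<omega>. q t \<omega> \<bullet> I t \<omega>)"
      using orth qI by (subst Bochner_Integration.integral_diff) (auto simp: has_bochner_integral_iff)
    \<comment> \<open>Young's inequality; half of E |q t|^2 is then absorbed on the left.\<close>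
    also have "\<dots> \<le> expectation (\<lambda>\<omega>. (norm (q t \<omega>))\<^sup>2 / 2 + (norm (I t \<omega>))\<^sup>2 / 2)"
    proof (rule integral_mono[OF qI])
      show "integrable M (\<lambda>\<omega>. (norm (q t \<omega>))\<^sup>2 / 2 + (norm (I t \<omega>))\<^sup>2 / 2)"
        using q_fin I_fin[of t] by simp
      fix \<omega>
      show "q t \<omega> \<bullet> I t \<omega> \<le> (norm (q t \<omega>))\<^sup>2 / 2 + (norm (I t \<omega>))\<^sup>2 / 2"
        using norm_cauchy_schwarz[of "q t \<omega>" "I t \<omega>"] sum_squares_bound[of "norm (q t \<omega>)" "norm (I t \<omega>)"] by simp
    qed
    also have "\<dots> = expectation (\<lambda>\<omega>. (norm (q t \<omega>))\<^sup>2) / 2 + expectation (\<lambda>\<omega>. (norm (I t \<omega>))\<^sup>2) / 2"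
      using q_fin I_fin[of t] by simp
    finally have "expectation (\<lambda>\<omega>. (norm (q t \<omega>))\<^sup>2) \<le> expectation (\<lambda>\<omega>. (norm (I t \<omega>))\<^sup>2)"
      by simp
    then show ?thesis
      using nn_integral_eq_integral[OF q_fin] nn_integral_eq_integral[OF I_fin[of t]]
      by (simp add: m_def ennreal_leI)
  qed
  have "m t = 0"
    by (rule nn_integral_gronwall_zero[OF T m_meas m_fin _ order_trans[OF m_le I_bound] t]) (use T0 in auto)
  then have "AE \<omega> in M. ennreal ((norm (q t \<omega>))\<^sup>2) = 0"
    unfolding m_def using qM[OF t] by (subst (asm) nn_integral_0_iff_AE) auto
  then show ?thesis by eventually_elim simp
qed

lemma L2_adapted_diff_finite:
  assumes "L2_adapted M F T X" "L2_adapted M F T Y"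
  shows "(\<lambda>z. X (fst z) (snd z) - Y (fst z) (snd z)) \<in> borel_measurable (time_prod M T)"
    and "(\<integral>\<^sup>+z. ennreal ((norm (X (fst z) (snd z) - Y (fst z) (snd z)))\<^sup>2) \<partial>time_prod M T) < \<infinity>"
proof -
  have X: "(\<lambda>z. X (fst z) (snd z)) \<in> borel_measurable (time_prod M T)"
    "(\<integral>\<^sup>+z. ennreal ((norm (X (fst z) (snd z)))\<^sup>2) \<partial>time_prod M T) < \<infinity>"
    using assms(1) by (auto simp: L2_adapted_def split_beta' integrable_iff_bounded)
  have Y: "(\<lambda>z. Y (fst z) (snd z)) \<in> borel_measurable (time_prod M T)"
    "(\<integral>\<^sup>+z. ennreal ((norm (Y (fst z) (snd z)))\<^sup>2) \<partial>time_prod M T) < \<infinity>"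
    using assms(2) by (auto simp: L2_adapted_def split_beta' integrable_iff_bounded)
  show "(\<lambda>z. X (fst z) (snd z) - Y (fst z) (snd z)) \<in> borel_measurable (time_prod M T)"
    by (rule borel_measurable_diff[OF X(1) Y(1)])
  show "(\<integral>\<^sup>+z. ennreal ((norm (X (fst z) (snd z) - Y (fst z) (snd z)))\<^sup>2) \<partial>time_prod M T) < \<infinity>"
    using nn_integral_norm_diff_power2_le[OF X(1) borel_measurable_const[of 0] Y(1)]
    by (intro order.strict_trans1[OF _ ennreal_2_2_less_top[OF X(2) Y(2)]]) simp
qed

text \<open>Both forward equations carry the same constant integrand, so their Ito integrals agree
  almost surely and \<delta>x is differentiable along almost every path. The product \<Gamma>
  \<delta>x in q therefore obeys the ordinary product rule, and all randomness of the equation for q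
  comes from \<delta>p.\<close>

lemma fbsde_unique:
  fixes S :: "('p::finite, 'q::finite, 'd) linear_system"
  assumes ric: "riccati_solution T S \<Gamma>"
    and sol: "fbsde_solution M F T W S x0 x p Z" and sol': "fbsde_solution M F T W S x0 x' p' Z'"
  shows "AE \<omega> in M. \<forall>t\<in>{0..T}. x' t \<omega> = x t \<omega> \<and> p' t \<omega> = p t \<omega>"
    and "AE (t, \<omega>) in time_prod M T. Z' t \<omega> = Z t \<omega>"
proof -
  let ?A = "sysA S" and ?B = "sysB S" and ?C = "sysC S" and ?D = "sysD S" and ?Sig = "sysSigma S"
  have T0: "0 \<le> T" and TT: "T \<in> {0..T}" using T by auto
  obtain Jx where Jx: "\<And>t. t \<in> {0..T} \<Longrightarrow> has_ito_integral M F T W (\<lambda>t \<omega>. ?Sig) t (Jx t)"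
    "\<And>t. t \<in> {0..T} \<Longrightarrow> AE \<omega> in M. x t \<omega> = x 0 \<omega> + (LINT s:{0..t}|lborel. ?A *v x s \<omega> - ?B *v p s \<omega>) + Jx t \<omega>"
    using sol unfolding fbsde_solution_def by (elim conjE) (erule has_stoch_differentialE, blast)
  obtain Jx' where Jx': "\<And>t. t \<in> {0..T} \<Longrightarrow> has_ito_integral M F T W (\<lambda>t \<omega>. ?Sig) t (Jx' t)"
    "\<And>t. t \<in> {0..T} \<Longrightarrow> AE \<omega> in M. x' t \<omega> = x' 0 \<omega> + (LINT s:{0..t}|lborel. ?A *v x' s \<omega> - ?B *v p' s \<omega>) + Jx' t \<omega>"
    using sol' unfolding fbsde_solution_def by (elim conjE) (erule has_stoch_differentialE, blast)
  have dp: "has_stoch_differential M F T W p (\<lambda>t \<omega>. - (?C *v p t \<omega> + ?D *v x t \<omega> + sysM S)) Z"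
    and dp': "has_stoch_differential M F T W p' (\<lambda>t \<omega>. - (?C *v p' t \<omega> + ?D *v x' t \<omega> + sysM S)) Z'"
    using sol sol' by (auto simp: fbsde_solution_def)
  obtain J where J: "\<And>t. t \<in> {0..T} \<Longrightarrow> has_ito_integral M F T W Z t (J t)"
    "\<And>t. t \<in> {0..T} \<Longrightarrow> AE \<omega> in M. p t \<omega> = p 0 \<omega> + (LINT s:{0..t}|lborel. - (?C *v p s \<omega> + ?D *v x s \<omega> + sysM S)) + J t \<omega>"
    using has_stoch_differentialE[OF dp] by blast
  obtain J' where J': "\<And>t. t \<in> {0..T} \<Longrightarrow> has_ito_integral M F T W Z' t (J' t)"
    "\<And>t. t \<in> {0..T} \<Longrightarrow> AE \<omega> in M. p' t \<omega> = p' 0 \<omega> + (LINT s:{0..t}|lborel. - (?C *v p' s \<omega> + ?D *v x' s \<omega> + sysM S)) + J' t \<omega>"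
    using has_stoch_differentialE[OF dp'] by blast
  define \<delta>x \<delta>p where "\<delta>x t \<omega> = x' t \<omega> - x t \<omega>" and "\<delta>p t \<omega> = p' t \<omega> - p t \<omega>" for t \<omega>
  define \<Gamma>' where "\<Gamma>' t = - (\<Gamma> t ** ?A + ?C ** \<Gamma> t - \<Gamma> t ** ?B ** \<Gamma> t + ?D)" for t
  have \<Gamma>: "(\<Gamma> has_vector_derivative \<Gamma>' t) (at t within {0..T})" if "t \<in> {0..T}" for t
    using ric that by (simp add: riccati_solution_def \<Gamma>'_def)
  have cont\<Gamma>: "continuous_on {0..T} \<Gamma>" by (rule riccati_solution_continuous_on[OF ric])
  define H where "H t = ?C - \<Gamma> t ** ?B" for t
  have contH: "continuous_on {0..T} H" unfolding H_def by (intro continuous_intros cont\<Gamma>)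
  have contx: "AE \<omega> in M. continuous_on {0..T} (\<lambda>t. x t \<omega>) \<and> continuous_on {0..T} (\<lambda>t. p t \<omega>)"
    and contx': "AE \<omega> in M. continuous_on {0..T} (\<lambda>t. x' t \<omega>) \<and> continuous_on {0..T} (\<lambda>t. p' t \<omega>)"
    and init: "AE \<omega> in M. x 0 \<omega> = x0 \<omega>" "AE \<omega> in M. x' 0 \<omega> = x0 \<omega>"
    and terminal: "AE \<omega> in M. p T \<omega> = sysE S *v x T \<omega> + sysh S" "AE \<omega> in M. p' T \<omega> = sysE S *v x' T \<omega> + sysh S"
    using sol sol' unfolding fbsde_solution_def by blast+
  have diff_integral: "(LINT s:{0..t}|lborel. u s) - (LINT s:{0..t}|lborel. v s) = integral {0..t} (\<lambda>s. u s - v s)"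
    if "continuous_on {0..T} u" "continuous_on {0..T} v" "t \<in> {0..T}" for u v :: "real \<Rightarrow> real ^ 'k" and t
  proof -
    have sub: "{0..t} \<subseteq> {0..T}" using that(3) by auto
    show ?thesis
      unfolding set_integral_continuous_eq_integral(1)[OF continuous_on_subset[OF that(1) sub]]
        set_integral_continuous_eq_integral(1)[OF continuous_on_subset[OF that(2) sub]]
      by (rule Henstock_Kurzweil_Integration.integral_diff[symmetric])
         (intro integrable_continuous_real continuous_on_subset[OF that(1) sub] continuous_on_subset[OF that(2) sub])+
  qed
  have \<delta>x_AE: "AE \<omega> in M. \<delta>x t \<omega> = integral {0..t} (\<lambda>s. ?A *v \<delta>x s \<omega> - ?B *v \<delta>p s \<omega>)" if t: "t \<in> {0..T}" for t
  proof -
    have t': "0 \<le> t" "t \<le> T" using t by auto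
    show ?thesis
      using Jx(2)[OF t] Jx'(2)[OF t] has_ito_integral_unique[OF Jx(1)[OF t] Jx'(1)[OF t] t'] contx contx' init
    proof eventually_elim
      case (elim \<omega>)
      have "\<delta>x t \<omega> = (LINT s:{0..t}|lborel. ?A *v x' s \<omega> - ?B *v p' s \<omega>) - (LINT s:{0..t}|lborel. ?A *v x s \<omega> - ?B *v p s \<omega>)"
        using elim by (simp add: \<delta>x_def)
      also have "\<dots> = integral {0..t} (\<lambda>s. (?A *v x' s \<omega> - ?B *v p' s \<omega>) - (?A *v x s \<omega> - ?B *v p s \<omega>))"
        by (rule diff_integral[OF _ _ t]) (use elim in \<open>auto intro!: continuous_intros\<close>)
      also have "\<dots> = integral {0..t} (\<lambda>s. ?A *v \<delta>x s \<omega> - ?B *v \<delta>p s \<omega>)"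
        by (rule arg_cong[where f = "integral _"]) (simp add: fun_eq_iff \<delta>x_def \<delta>p_def matrix_vector_mult_diff_distrib)
      finally show ?case .
    qed
  qed
  have \<delta>p_AE: "AE \<omega> in M. \<delta>p t \<omega> = \<delta>p 0 \<omega> + integral {0..t} (\<lambda>s. - (?C *v \<delta>p s \<omega> + ?D *v \<delta>x s \<omega>)) + (J' t \<omega> - J t \<omega>)" if t: "t \<in> {0..T}" for t
    using J(2)[OF t] J'(2)[OF t] contx contx'
  proof eventually_elim
    case (elim \<omega>)
    have "\<delta>p t \<omega> = \<delta>p 0 \<omega> + ((LINT s:{0..t}|lborel. - (?C *v p' s \<omega> + ?D *v x' s \<omega> + sysM S)) - (LINT s:{0..t}|lborel. - (?C *v p s \<omega> + ?D *v x s \<omega> + sysM S)))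
        + (J' t \<omega> - J t \<omega>)"
      using elim by (simp add: \<delta>p_def)
    also have "(LINT s:{0..t}|lborel. - (?C *v p' s \<omega> + ?D *v x' s \<omega> + sysM S)) - (LINT s:{0..t}|lborel. - (?C *v p s \<omega> + ?D *v x s \<omega> + sysM S))
        = integral {0..t} (\<lambda>s. - (?C *v p' s \<omega> + ?D *v x' s \<omega> + sysM S) - - (?C *v p s \<omega> + ?D *v x s \<omega> + sysM S))"
      by (rule diff_integral[OF _ _ t]) (use elim in \<open>auto intro!: continuous_intros\<close>)
    also have "\<dots> = integral {0..t} (\<lambda>s. - (?C *v \<delta>p s \<omega> + ?D *v \<delta>x s \<omega>))"
      by (rule arg_cong[where f = "integral _"]) (simp add: fun_eq_iff \<delta>x_def \<delta>p_def matrix_vector_mult_diff_distrib)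
    finally show ?case .
  qed
  \<comment> \<open>The pathwise facts gathered outside one null set. The equation for \<delta>p
    stays outside, because its Ito integrals are fixed only up to a null set for each time.\<close>
  define good where "good \<omega> \<longleftrightarrow> continuous_on {0..T} (\<lambda>t. \<delta>x t \<omega>) \<and> continuous_on {0..T} (\<lambda>t. \<delta>p t \<omega>) \<and>
     \<delta>x 0 \<omega> = 0 \<and> \<delta>p T \<omega> = sysE S *v \<delta>x T \<omega> \<and>
     (\<forall>t\<in>{0..T} \<inter> \<rat>. \<delta>x t \<omega> = integral {0..t} (\<lambda>s. ?A *v \<delta>x s \<omega> - ?B *v \<delta>p s \<omega>))" for \<omega>
  have countable: "countable ({0..T} \<inter> \<rat>)"
    by (intro countable_Int2 countable_rat)
  have "AE \<omega> in M. \<forall>t\<in>{0..T} \<inter> \<rat>. \<delta>x t \<omega> = integral {0..t} (\<lambda>s. ?A *v \<delta>x s \<omega> - ?B *v \<delta>p s \<omega>)"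
    unfolding AE_ball_countable[OF countable] using \<delta>x_AE by blast
  then have good: "AE \<omega> in M. good \<omega>"
    using contx contx' init terminal
    by eventually_elim (auto simp: good_def \<delta>x_def \<delta>p_def matrix_vector_mult_diff_distrib intro!: continuous_intros)
  have \<delta>x_eq: "\<delta>x t \<omega> = integral {0..t} (\<lambda>s. ?A *v \<delta>x s \<omega> - ?B *v \<delta>p s \<omega>)" if "good \<omega>" "t \<in> {0..T}" for t \<omega>
    by (rule continuous_on_eq_if_eq_rationals[OF T _ _ _ that(2)])
       (use that(1) in \<open>auto simp: good_def intro!: continuous_on_indefinite_integral continuous_intros\<close>)
  have \<delta>x_deriv: "((\<lambda>t. \<delta>x t \<omega>) has_vector_derivative ?A *v \<delta>x t \<omega> - ?B *v \<delta>p t \<omega>) (at t within {0..T})"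
    if "good \<omega>" and t: "t \<in> {0..T}" for t \<omega>
  proof -
    have "((\<lambda>t. integral {0..t} (\<lambda>s. ?A *v \<delta>x s \<omega> - ?B *v \<delta>p s \<omega>)) has_vector_derivative ?A *v \<delta>x t \<omega> - ?B *v \<delta>p t \<omega>) (at t within {0..T})"
      by (rule integral_has_vector_derivative[OF _ t]) (use that(1) in \<open>auto simp: good_def intro!: continuous_intros\<close>)
    then show ?thesis
      by (rule has_vector_derivative_transform[OF t, rotated]) (rule \<delta>x_eq[OF that(1)])
  qed
  define q where "q t \<omega> = \<delta>p t \<omega> - \<Gamma> t *v \<delta>x t \<omega>" for t \<omega>
  have contq: "continuous_on {0..T} (\<lambda>t. q t \<omega>)" if "good \<omega>" for \<omega>
    using that unfolding q_def good_def by (auto intro!: continuous_intros cont\<Gamma>)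
  have contHq: "continuous_on {0..T} (\<lambda>t. H t *v q t \<omega>)" if "good \<omega>" for \<omega>
    by (intro continuous_intros contH contq that)
  have q_AE: "AE \<omega> in M. q t \<omega> = \<delta>p 0 \<omega> - integral {0..t} (\<lambda>s. H s *v q s \<omega>) + (J' t \<omega> - J t \<omega>)" if t: "t \<in> {0..T}" for t
    using \<delta>p_AE[OF t] good
  proof eventually_elim
    case (elim \<omega>)
    have sub: "{0..t} \<subseteq> {0..T}" using t by auto
    have cont: "continuous_on {0..T} (\<lambda>t. \<delta>x t \<omega>)" "continuous_on {0..T} (\<lambda>t. \<delta>p t \<omega>)" and zero: "\<delta>x 0 \<omega> = 0"
      using elim(2) by (auto simp: good_def)
    have "((\<lambda>s. \<Gamma> s *v (?A *v \<delta>x s \<omega> - ?B *v \<delta>p s \<omega>) + \<Gamma>' s *v \<delta>x s \<omega>) has_integral \<Gamma> t *v \<delta>x t \<omega> - \<Gamma> 0 *v \<delta>x 0 \<omega>) {0..t}"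
      by (rule fundamental_theorem_of_calculus)
         (use t sub in \<open>auto intro!: has_vector_derivative_within_subset[OF _ sub] bounded_bilinear.has_vector_derivative[OF bounded_bilinear_matrix_vector_mult] \<Gamma> \<delta>x_deriv elim(2)\<close>)
    moreover have "((\<lambda>s. - (?C *v \<delta>p s \<omega> + ?D *v \<delta>x s \<omega>)) has_integral integral {0..t} (\<lambda>s. - (?C *v \<delta>p s \<omega> + ?D *v \<delta>x s \<omega>))) {0..t}"
      by (intro integrable_integral integrable_continuous_real continuous_on_subset[OF _ sub] continuous_intros cont)
    ultimately have "((\<lambda>s. - (?C *v \<delta>p s \<omega> + ?D *v \<delta>x s \<omega>) - (\<Gamma> s *v (?A *v \<delta>x s \<omega> - ?B *v \<delta>p s \<omega>) + \<Gamma>' s *v \<delta>x s \<omega>)) has_integral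
        integral {0..t} (\<lambda>s. - (?C *v \<delta>p s \<omega> + ?D *v \<delta>x s \<omega>)) - (\<Gamma> t *v \<delta>x t \<omega> - \<Gamma> 0 *v \<delta>x 0 \<omega>)) {0..t}"
      by (intro has_integral_diff)
    \<comment> \<open>The Riccati equation cancels the terms in \<delta>x that do not combine with
      \<delta>p into q = \<delta>p - \<Gamma> \<delta>x, which closes the equation for q.\<close>
    moreover have "- (?C *v \<delta>p s \<omega> + ?D *v \<delta>x s \<omega>) - (\<Gamma> s *v (?A *v \<delta>x s \<omega> - ?B *v \<delta>p s \<omega>) + \<Gamma>' s *v \<delta>x s \<omega>) = - (H s *v q s \<omega>)" for s
      by (simp add: \<Gamma>'_def H_def q_def matrix_vector_mult_uminus matrix_vector_mult_add_rdistrib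
          matrix_vector_mult_diff_rdistrib matrix_vector_mult_diff_distrib matrix_vector_mul_assoc[symmetric])
    ultimately have "((\<lambda>s. - (H s *v q s \<omega>)) has_integral
        integral {0..t} (\<lambda>s. - (?C *v \<delta>p s \<omega> + ?D *v \<delta>x s \<omega>)) - \<Gamma> t *v \<delta>x t \<omega>) {0..t}"
      by (simp only: zero matrix_vector_mult_0_right diff_zero)
    then have "integral {0..t} (\<lambda>s. - (H s *v q s \<omega>)) = integral {0..t} (\<lambda>s. - (?C *v \<delta>p s \<omega> + ?D *v \<delta>x s \<omega>)) - \<Gamma> t *v \<delta>x t \<omega>"
      by (rule integral_unique)
    with elim(1) show ?case
      by (simp add: q_def)
  qed
  have \<Gamma>T: "\<Gamma> T = sysE S"
    using ric by (simp add: riccati_solution_def)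
  have q_eq: "AE \<omega> in M. q t \<omega> = (LINT s:{0..T}|lborel. indicator {t..T} s *\<^sub>R (H s *v q s \<omega>)) - ((J' T \<omega> - J' t \<omega>) - (J T \<omega> - J t \<omega>))"
    if t: "t \<in> {0..T}" for t
    using q_AE[OF t] q_AE[OF TT] good
  proof eventually_elim
    case (elim \<omega>)
    have q_T: "q T \<omega> = 0"
      using elim(3) by (simp add: good_def q_def \<Gamma>T)
    have "integral {0..T} (\<lambda>s. H s *v q s \<omega>) = integral {0..t} (\<lambda>s. H s *v q s \<omega>) + integral {t..T} (\<lambda>s. H s *v q s \<omega>)"
      by (rule Henstock_Kurzweil_Integration.integral_combine[symmetric])
         (use t in \<open>auto intro!: integrable_continuous_real contHq elim(3)\<close>)
    moreover have "integral {t..T} (\<lambda>s. H s *v q s \<omega>) = (LINT s:{t..T}|lborel. H s *v q s \<omega>)"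
      by (rule set_integral_continuous_eq_integral(1)[symmetric])
         (use t in \<open>auto intro!: continuous_on_subset[OF contHq[OF elim(3)]]\<close>)
    moreover have "(LINT s:{t..T}|lborel. H s *v q s \<omega>) = (LINT s:{0..T}|lborel. indicator {t..T} s *\<^sub>R (H s *v q s \<omega>))"
      unfolding set_lebesgue_integral_def
      by (rule Bochner_Integration.integral_cong) (use t in \<open>auto simp: indicator_def\<close>)
    \<comment> \<open>The relation q T = 0 determines the unknown initial value \<delta>p 0, which
      turns the forward form of the equation into the backward one.\<close>
    moreover have "\<delta>p 0 \<omega> = integral {0..T} (\<lambda>s. H s *v q s \<omega>) - (J' T \<omega> - J T \<omega>)"
    proof -
      have "\<delta>p 0 \<omega> = (\<delta>p 0 \<omega> - integral {0..T} (\<lambda>s. H s *v q s \<omega>) + (J' T \<omega> - J T \<omega>))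
          + integral {0..T} (\<lambda>s. H s *v q s \<omega>) - (J' T \<omega> - J T \<omega>)"
        by simp
      also have "\<dots> = integral {0..T} (\<lambda>s. H s *v q s \<omega>) - (J' T \<omega> - J T \<omega>)"
        unfolding elim(2)[symmetric] q_T by simp
      finally show ?thesis .
    qed
    ultimately show ?case
      unfolding elim(1) by simp
  qed
  have L2: "(\<lambda>z. \<delta>x (fst z) (snd z)) \<in> borel_measurable (time_prod M T)" "(\<integral>\<^sup>+z. ennreal ((norm (\<delta>x (fst z) (snd z)))\<^sup>2) \<partial>time_prod M T) < \<infinity>"
    "(\<lambda>z. \<delta>p (fst z) (snd z)) \<in> borel_measurable (time_prod M T)" "(\<integral>\<^sup>+z. ennreal ((norm (\<delta>p (fst z) (snd z)))\<^sup>2) \<partial>time_prod M T) < \<infinity>"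
    unfolding \<delta>x_def \<delta>p_def
    using sol sol' L2_adapted_diff_finite[of x' x] L2_adapted_diff_finite[of p' p] by (auto simp: fbsde_solution_def)
  obtain B where B: "B \<ge> 0" "\<And>s v. s \<in> {0..T} \<Longrightarrow> norm (\<Gamma> s *v v) \<le> B * norm v"
    using matrix_vector_mult_norm_bound[OF cont\<Gamma>] by metis
  have \<Gamma>_meas: "(\<lambda>z. \<Gamma> (fst z)) \<in> borel_measurable (time_prod M T)"
    using continuous_paths_jointly_measurable[OF T0, of "\<lambda>s \<omega>. \<Gamma> s" M] cont\<Gamma> by (simp add: split_beta')
  have \<Gamma>\<delta>x: "(\<lambda>z. \<Gamma> (fst z) *v \<delta>x (fst z) (snd z)) \<in> borel_measurable (time_prod M T)"
    by (rule borel_measurable_matrix_vector_mult[OF \<Gamma>_meas L2(1)])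
  have q_meas: "(\<lambda>(t, \<omega>). q t \<omega>) \<in> borel_measurable (time_prod M T)"
    unfolding q_def split_beta' by (rule borel_measurable_diff[OF L2(3) \<Gamma>\<delta>x])
  have q_fin: "(\<integral>\<^sup>+(t, \<omega>). ennreal ((norm (q t \<omega>))\<^sup>2) \<partial>time_prod M T) < \<infinity>"
  proof -
    have "(\<integral>\<^sup>+z. ennreal ((norm (\<Gamma> (fst z) *v \<delta>x (fst z) (snd z)))\<^sup>2) \<partial>time_prod M T)
        \<le> (\<integral>\<^sup>+z. ennreal (B\<^sup>2) * ennreal ((norm (\<delta>x (fst z) (snd z)))\<^sup>2) \<partial>time_prod M T)"
    proof (rule nn_integral_mono)
      fix z assume "z \<in> space (time_prod M T)"
      then have "(norm (\<Gamma> (fst z) *v \<delta>x (fst z) (snd z)))\<^sup>2 \<le> (B * norm (\<delta>x (fst z) (snd z)))\<^sup>2"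
        by (intro power_mono B(2)) (auto simp: space_pair_measure space_restrict_space)
      then show "ennreal ((norm (\<Gamma> (fst z) *v \<delta>x (fst z) (snd z)))\<^sup>2) \<le> ennreal (B\<^sup>2) * ennreal ((norm (\<delta>x (fst z) (snd z)))\<^sup>2)"
        by (simp add: ennreal_mult[symmetric] power_mult_distrib ennreal_leI)
    qed
    also have "\<dots> = ennreal (B\<^sup>2) * (\<integral>\<^sup>+z. ennreal ((norm (\<delta>x (fst z) (snd z)))\<^sup>2) \<partial>time_prod M T)"
    proof (rule nn_integral_cmult)
      have "(\<lambda>v :: real ^ 'p. ennreal ((norm v)\<^sup>2)) \<in> borel_measurable borel" by measurable
      from measurable_compose[OF L2(1) this]
      show "(\<lambda>z. ennreal ((norm (\<delta>x (fst z) (snd z)))\<^sup>2)) \<in> borel_measurable (time_prod M T)" .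
    qed
    also have "\<dots> < \<infinity>"
      using L2(2) by (simp add: ennreal_mult_less_top)
    finally have fin: "(\<integral>\<^sup>+z. ennreal ((norm (\<Gamma> (fst z) *v \<delta>x (fst z) (snd z)))\<^sup>2) \<partial>time_prod M T) < \<infinity>" .
    have "(\<integral>\<^sup>+z. ennreal ((norm (q (fst z) (snd z)))\<^sup>2) \<partial>time_prod M T) < \<infinity>"
      using nn_integral_norm_diff_power2_le[OF L2(3) borel_measurable_const[of 0] \<Gamma>\<delta>x]
      by (intro order.strict_trans1[OF _ ennreal_2_2_less_top[OF L2(4) fin]]) (simp add: q_def)
    then show ?thesis by (simp add: split_beta')
  qed
  have q_adapted: "q t \<in> borel_measurable (F t)" if "t \<in> {0..T}" for t
    using sol sol' that unfolding q_def[abs_def] \<delta>x_def \<delta>p_def fbsde_solution_def L2_adapted_def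
    by (intro borel_measurable_diff borel_measurable_matrix_vector_mult borel_measurable_const) blast+
  have "AE \<omega> in M. q t \<omega> = 0" if "t \<in> {0..T}" for t
    by (rule linear_bsde_zero[OF q_adapted q_meas q_fin contH J(1) J'(1) q_eq that])
  then have "AE \<omega> in M. \<forall>t\<in>{0..T} \<inter> \<rat>. q t \<omega> = 0"
    unfolding AE_ball_countable[OF countable] by blast
  then have zero: "AE \<omega> in M. \<forall>t\<in>{0..T}. \<delta>x t \<omega> = 0 \<and> \<delta>p t \<omega> = 0"
    using good
  proof eventually_elim
    case (elim \<omega>)
    have q_0: "q t \<omega> = 0" if "t \<in> {0..T}" for t
      by (rule continuous_on_eq_if_eq_rationals[OF T contq[OF elim(2)] continuous_on_const _ that]) (use elim(1) in auto)
    have cont: "continuous_on {0..T} (\<lambda>t. ?A - ?B ** \<Gamma> t)"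
      by (intro continuous_intros cont\<Gamma>)
    obtain k where k: "\<And>s v. s \<in> {0..T} \<Longrightarrow> norm ((?A - ?B ** \<Gamma> s) *v v) \<le> k * norm v"
      using linear_ode_lipschitz[OF cont] by metis
    have "\<delta>x t \<omega> = 0" if t: "t \<in> {0..T}" for t
    proof (rule ode_zero_forward[OF \<delta>x_deriv[OF elim(2)] _ _ t])
      show "\<delta>x 0 \<omega> = 0" using elim(2) by (simp add: good_def)
      fix s assume s: "s \<in> {0..T}"
      have "?A *v \<delta>x s \<omega> - ?B *v \<delta>p s \<omega> = (?A - ?B ** \<Gamma> s) *v \<delta>x s \<omega>"
        using q_0[OF s] by (simp add: q_def matrix_vector_mult_diff_rdistrib matrix_vector_mul_assoc[symmetric])
      then show "norm (?A *v \<delta>x s \<omega> - ?B *v \<delta>p s \<omega>) \<le> k * norm (\<delta>x s \<omega>)"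
        using k[OF s] by simp
    qed
    then show ?case
      using q_0 by (auto simp: q_def)
  qed
  then show "AE \<omega> in M. \<forall>t\<in>{0..T}. x' t \<omega> = x t \<omega> \<and> p' t \<omega> = p t \<omega>"
    by eventually_elim (simp add: \<delta>x_def \<delta>p_def)
  \<comment> \<open>Once \<delta>x and \<delta>p vanish, the adjoint equation at \<open>T\<close>
    leaves only the equality of the two Ito integrals, and this identifies their integrands.\<close>
  have "AE \<omega> in M. J' T \<omega> = J T \<omega>"
    using \<delta>p_AE[OF TT] zero
  proof eventually_elim
    case (elim \<omega>)
    have "integral {0..T} (\<lambda>s. - (?C *v \<delta>p s \<omega> + ?D *v \<delta>x s \<omega>)) = integral {0..T} (\<lambda>s. 0)"
      by (rule integral_cong) (use elim(2) in simp)
    then show ?case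
      using elim T0 by simp
  qed
  then show "AE (t, \<omega>) in time_prod M T. Z' t \<omega> = Z t \<omega>"
    by (rule ito_integrand_unique[OF J'(1)[OF TT] J(1)[OF TT]])
qed

end

section \<open>Solvability under Conditions 2A and 2B\<close>

text \<open>The affine relation holds by construction for one solution; indistinguishability carries
  it over to every solution.\<close>

lemma (in filtered_wiener) riccati_fbsde:
  fixes S :: "('p::finite, 'q::finite, 'd) linear_system"
  assumes x0: "x0 \<in> borel_measurable (F 0)" "integrable M (\<lambda>\<omega>. (norm (x0 \<omega>))\<^sup>2)"
    and no_conjugate: "no_conjugate_point T S"
  shows "\<exists>\<Gamma>. riccati_solution T S \<Gamma> \<and>
         (\<forall>\<Gamma>'. riccati_solution T S \<Gamma>' \<longrightarrow> (\<forall>t\<in>{0..T}. \<Gamma>' t = \<Gamma> t)) \<and>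
         fbsde_uniquely_solvable M F T W S x0 \<and>
         (\<exists>g. offset_solution T S \<Gamma> g \<and>
            (\<forall>g'. offset_solution T S \<Gamma> g' \<longrightarrow> (\<forall>t\<in>{0..T}. g' t = g t)) \<and>
            (\<forall>x p Z. fbsde_solution M F T W S x0 x p Z \<longrightarrow>
               (AE \<omega> in M. \<forall>t\<in>{0..T}. p t \<omega> = \<Gamma> t *v x t \<omega> + g t)))"
proof -
  obtain \<Gamma> and X Y :: "real \<Rightarrow> real ^ 'p ^ 'p" where \<Gamma>: "riccati_solution T S \<Gamma>"
    and X: "\<And>t. t \<in> {0..T} \<Longrightarrow> (X has_vector_derivative (sysA S - sysB S ** \<Gamma> t) ** X t) (at t within {0..T})"
    and XY: "\<And>t. t \<in> {0..T} \<Longrightarrow> X t ** Y t = mat 1" and Y: "continuous_on {0..T} Y"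
    using riccati_exists[OF T no_conjugate] by blast
  obtain g where g: "offset_solution T S \<Gamma> g"
    and g_unique: "\<And>g' t. offset_solution T S \<Gamma> g' \<Longrightarrow> t \<in> {0..T} \<Longrightarrow> g' t = g t"
    using offset_exists_unique[OF T \<Gamma>] by blast
  obtain x p Z where sol: "fbsde_solution M F T W S x0 x p Z"
    and p: "\<And>\<omega> t. \<omega> \<in> space M \<Longrightarrow> t \<in> {0..T} \<Longrightarrow> p t \<omega> = \<Gamma> t *v x t \<omega> + g t"
    using fbsde_exists[OF x0 \<Gamma> g X XY Y] by blast
  have "AE \<omega> in M. \<forall>t\<in>{0..T}. p' t \<omega> = \<Gamma> t *v x' t \<omega> + g t"
    if "fbsde_solution M F T W S x0 x' p' Z'" for x' p' Z'
    using fbsde_unique(1)[OF \<Gamma> sol that] AE_space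
    by eventually_elim (simp add: p)
  moreover have "fbsde_uniquely_solvable M F T W S x0"
    unfolding fbsde_uniquely_solvable_def
    using sol fbsde_unique[OF \<Gamma> sol] by blast
  ultimately show ?thesis
    using \<Gamma> g g_unique riccati_unique[OF _ \<Gamma>] by blast
qed

text \<open>The auxiliary component y is driven by \<open>p\<close> but, by the zero blocks, feeds
  back into neither \<open>x\<close> nor \<open>p\<close>. Every trajectory thus extends to the
  enlarged system after the fact, with y chosen to vanish where \<open>x\<close> does.\<close>

lemma extended_monotone_no_conjugate_point:
  fixes A :: "real ^ 'p ^ 'p" and Ahat :: "real ^ 'r ^ 'r" and B :: "real ^ 'q ^ 'p" and Bhat :: "real ^ 'q ^ 'r"
  assumes mono: "monotonicity_condition ((A ||| 0) === (0 ||| Ahat)) (B === Bhat) C (D ||| 0) (E ||| 0)"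
    and t0: "t0 \<le> T" and x_t0: "x t0 = 0" and p_T: "p T = E *v x T"
    and x: "\<And>t. t \<in> {t0..T} \<Longrightarrow> (x has_vector_derivative A *v x t - B *v p t) (at t within {t0..T})"
    and p: "\<And>t. t \<in> {t0..T} \<Longrightarrow> (p has_vector_derivative - (C *v p t + D *v x t)) (at t within {t0..T})"
  shows "x T = 0"
proof -
  have cont_p: "continuous_on {t0..T} p"
    by (rule continuous_on_vector_derivative[OF p])
  obtain y where y: "y t0 = 0" "\<And>t. t \<in> {t0..T} \<Longrightarrow> (y has_vector_derivative Ahat *v y t + - (Bhat *v p t)) (at t within {t0..T})"
    by (rule linear_ode_forward[OF t0, of "\<lambda>_. Ahat" "\<lambda>t. - (Bhat *v p t)"])
       (auto intro!: continuous_intros cont_p)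
  have "(\<lambda>t. x t === y t) T = 0"
  proof (rule monotone_no_conjugate_point[OF mono t0])
    show "x t0 === y t0 = 0"
      by (simp add: x_t0 y(1) vec_eq_iff split_sum_all)
    show "p T = (E ||| 0) *v (x T === y T)"
      by (simp add: hcat_mult_vec p_T)
    fix t assume t: "t \<in> {t0..T}"
    show "(p has_vector_derivative - (C *v p t + (D ||| 0) *v (x t === y t))) (at t within {t0..T})"
      using p[OF t] by (simp add: hcat_mult_vec)
    have "((\<lambda>t. x t === y t) has_vector_derivative (A *v x t - B *v p t) === (Ahat *v y t + - (Bhat *v p t))) (at t within {t0..T})"
      using bounded_linear.has_vector_derivative[OF bounded_linear_vcat has_vector_derivative_Pair[OF x[OF t] y(2)[OF t]]]
      by simp
    then show "((\<lambda>t. x t === y t) has_vector_derivative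
        ((A ||| 0) === (0 ||| Ahat)) *v (x t === y t) - (B === Bhat) *v p t) (at t within {t0..T})"
      by (simp add: vcat_mult_vec hcat_mult_vec vcat_diff)
  qed
  then show ?thesis
    by (simp add: vec_eq_iff split_sum_all)
qed

lemma condition_2B_no_conjugate_point:
  fixes run ter :: "('a::finite, 'b::finite, 'c::finite) weights"
  assumes "condition_2B c run ter"
  shows "no_conjugate_point T (systemN c run ter)"
  unfolding no_conjugate_point_def
proof (intro allI ballI impI, elim conjE)
  let ?N = "systemN c run ter"
  fix x p t0
  assume *: "t0 \<in> {0..T}" "x t0 = 0" "p T = sysE ?N *v x T"
    "\<forall>t\<in>{t0..T}. (x has_vector_derivative sysA ?N *v x t - sysB ?N *v p t) (at t within {t0..T})"
    "\<forall>t\<in>{t0..T}. (p has_vector_derivative - (sysC ?N *v p t + sysD ?N *v x t)) (at t within {t0..T})"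
  have sys: "sysA ?N = matA c" "sysB ?N = matBN c" "sysC ?N = matCN c" "sysD ?N = weight_matN run" "sysE ?N = weight_matN ter"
    by (simp_all add: systemN_def)
  obtain Ahat :: "real ^ ('b + 'a) ^ ('b + 'a)" and Bhat :: "real ^ ('a, 'b, 'c) idxN ^ ('b + 'a)" where
    "monotonicity_condition ((sysA ?N ||| 0) === (0 ||| Ahat)) (sysB ?N === Bhat) (sysC ?N) (sysD ?N ||| 0) (sysE ?N ||| 0)"
    using assms unfolding condition_2B_def sys by blast
  then show "x T = 0"
    by (rule extended_monotone_no_conjugate_point[OF _ _ *(2,3) *(4,5)[rule_format]]) (use *(1) in simp_all)
qed

theorem theorem3p5:
  fixes c :: "('a::finite, 'b::finite, 'c::finite, 'ma::finite, 'mb::finite, 'mc::finite,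
               'da::finite, 'db::finite) dynamics"
    and run ter :: "('a, 'b, 'c) weights"
    and T :: real
    and M :: "'w measure"
    and Wa :: "real \<Rightarrow> 'w \<Rightarrow> real ^ 'da"
    and Wb :: "real \<Rightarrow> 'w \<Rightarrow> real ^ 'db"
    and eta_a :: "'w \<Rightarrow> real ^ 'a"
    and eta_b :: "'w \<Rightarrow> real ^ 'b"
    and eta_1 :: "'w \<Rightarrow> real ^ 'c"
  defines "F \<equiv> join_filtration M (history M eta_a Wa) (history M eta_b Wb)"
    and "W \<equiv> (\<lambda>t \<omega>. Wa t \<omega> === Wb t \<omega>)"
    and "x0 \<equiv> (\<lambda>\<omega>. eta_a \<omega> === eta_b \<omega> === (LINT \<omega>'|M. eta_1 \<omega>') === 0 === 0)"
    and "N \<equiv> systemN c run ter"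
    and "P \<equiv> systemP c run ter"
  assumes T: "0 < T"
    and rank: "full_column_rank (D\<^sub>\<alpha> c)" "full_column_rank (D\<^sub>\<beta> c)" "full_column_rank (E\<^sub>1 c)"
    and R: "pos_def (R\<^sub>\<alpha> c)" "pos_def (R\<^sub>\<beta> c)" "pos_def (R\<^sub>1 c)"
    and Q: "pos_def (Q\<^sub>\<alpha> run)" "pos_def (Q\<^sub>\<beta> run)" "pos_def (Q\<^sub>1 run)"
    and Q_terminal: "pos_semidef (Q\<^sub>\<alpha> ter)" "pos_semidef (Q\<^sub>\<beta> ter)" "pos_semidef (Q\<^sub>1 ter)"
    and M: "prob_space M"
    and W: "wiener_process M T Wa" "wiener_process M T Wb"
    and eta_measurable: "eta_a \<in> borel_measurable M" "eta_b \<in> borel_measurable M"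
      "eta_1 \<in> borel_measurable M"
    and eta_L2: "integrable M (\<lambda>\<omega>. (norm (eta_a \<omega>))\<^sup>2)" "integrable M (\<lambda>\<omega>. (norm (eta_b \<omega>))\<^sup>2)"
      "integrable M (\<lambda>\<omega>. (norm (eta_1 \<omega>))\<^sup>2)"
    and indep: "prob_space.indep_sets M
      (\<lambda>k. [path_events M Wa T, path_events M Wb T,
            events_of M eta_a, events_of M eta_b, events_of M eta_1] ! k) {..<5}"
    and conditions: "(condition_2A N \<and> condition_2A P) \<or> (condition_2A P \<and> condition_2B c run ter)"
  shows
    "(\<exists>\<Gamma>. riccati_solution T N \<Gamma> \<and>
         (\<forall>\<Gamma>'. riccati_solution T N \<Gamma>' \<longrightarrow> (\<forall>t\<in>{0..T}. \<Gamma>' t = \<Gamma> t)) \<and>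
         fbsde_uniquely_solvable M F T W N x0 \<and>
         (\<exists>g. offset_solution T N \<Gamma> g \<and>
            (\<forall>g'. offset_solution T N \<Gamma> g' \<longrightarrow> (\<forall>t\<in>{0..T}. g' t = g t)) \<and>
            (\<forall>x p Z. fbsde_solution M F T W N x0 x p Z \<longrightarrow>
               (AE \<omega> in M. \<forall>t\<in>{0..T}. p t \<omega> = \<Gamma> t *v x t \<omega> + g t)))) \<and>
     (\<exists>\<Gamma>. riccati_solution T P \<Gamma> \<and>
         (\<forall>\<Gamma>'. riccati_solution T P \<Gamma>' \<longrightarrow> (\<forall>t\<in>{0..T}. \<Gamma>' t = \<Gamma> t)) \<and>
         fbsde_uniquely_solvable M F T W P x0 \<and>
         (\<exists>g. offset_solution T P \<Gamma> g \<and>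
            (\<forall>g'. offset_solution T P \<Gamma> g' \<longrightarrow> (\<forall>t\<in>{0..T}. g' t = g t)) \<and>
            (\<forall>x p Z. fbsde_solution M F T W P x0 x p Z \<longrightarrow>
               (AE \<omega> in M. \<forall>t\<in>{0..T}. p t \<omega> = \<Gamma> t *v x t \<omega> + g t))))"
proof -
  interpret prob_space M by (rule M)
  interpret filtered_wiener M F T W
    unfolding F_def W_def by (rule filtered_wiener_join[OF T W eta_measurable(1,2) indep])
  \<comment> \<open>\<open>eta_1\<close> enters only through its mean, a constant, so
    \<open>x0\<close> is known at time 0 although \<open>F\<close> is generated from the other two
    initial values and the Wiener paths.\<close>
  have x0_meas: "x0 \<in> borel_measurable (F 0)"
  proof -
    have "events_of M eta_a \<subseteq> sets (history M eta_a Wa 0)" "events_of M eta_b \<subseteq> sets (history M eta_b Wb 0)"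
      unfolding sets_history by auto
    moreover have "sets (history M eta_a Wa 0) \<subseteq> sets (F 0)" "sets (history M eta_b Wb 0) \<subseteq> sets (F 0)"
      unfolding F_def by (subst sets_join_filtration; auto)+
    moreover have "space (F 0) = space M"
      using space_F[of 0] T by simp
    ultimately have "eta_a \<in> borel_measurable (F 0)" "eta_b \<in> borel_measurable (F 0)"
      using events_of_subset_iff[of "F 0" M eta_a] events_of_subset_iff[of "F 0" M eta_b] by (meson order_trans)+
    then show ?thesis
      unfolding x0_def by (intro borel_measurable_vcat borel_measurable_const)
  qed
  have x0_L2: "integrable M (\<lambda>\<omega>. (norm (x0 \<omega>))\<^sup>2)"
    unfolding x0_def norm_vcat_power2 using eta_L2(1,2) by simp
  have "no_conjugate_point T N" "no_conjugate_point T P"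
    using conditions condition_2A_no_conjugate_point condition_2B_no_conjugate_point unfolding N_def by blast+
  then show ?thesis
    by (intro conjI riccati_fbsde x0_meas x0_L2)
qed

end
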